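(* Let $\{S_i\}_{i=1}^N$ be an IFS of contractive similitudes satisfying the open set condition, let $0<\lambda<1$, and let $\{Z_n\}_{n=0}^\infty$ be a $\lambda$-natural random walk ($\lambda$-NRW) on the augmented tree $(X,\mathfrak E)$. Then $$F(x,y)\asymp\lambda^{|x|-(x|y)}\,r^{\alpha(|y|-(x|y))},\qquad \forall\,x,y\in X,$$ where $(x|y)$ is the Gromov product. Moreover, the Martin kernel satisfies $$K(x,y)\asymp\lambda^{|x|-(x|y)}\,r^{-\alpha(x|y)},\qquad x,y\in X,$$ and also $$K(x,\xi)\asymp\lambda^{|x|-(x|\xi)}\,r^{-\alpha(x|\xi)},\qquad x\in X,\ \xi\in\partial_HX$$ (with $\partial_HX\approx\mathcal M\approx K$). Here $\asymp$ means two-sided bounds with positive constants independent of $x,y,\xi$.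
   Context: IFS and levels. $N\ge2$; $\{S_i\}_{i=1}^N$ are contractive similitudes of $\mathbb R^d$ with ratios $r_i\in(0,1)$, $r=\min_ir_i$; $K$ is the unique nonempty compact set with $K=\bigcup_iS_i(K)$. Open set condition (OSC): there is a nonempty bounded open $U$ with $S_i(U)\subset U$ and $S_i(U)\cap S_j(U)=\emptyset$ for $i\neq j$. $\alpha$ is the Hausdorff dimension of $K$, given by $\sum_ir_i^\alpha=1$. For a word $x=i_1\cdots i_k$ over $\{1,\dots,N\}$: $S_x=S_{i_1}\circ\cdots\circ S_{i_k}$, $r_x=r_{i_1}\cdots r_{i_k}$ ($r_\vartheta=1$ for the empty word $\vartheta$). $\mathcal J_0=\{\vartheta\}$, $\mathcal J_n=\{x=i_1\cdots i_k: r_x\le r^n<r_{i_1\cdots i_{k-1}}\}$ for $n\ge1$ (pairwise disjoint), $X=\bigcup_{n\ge0}\mathcal J_n$, $|x|=n$ for $x\in\mathcal J_n$. For $x\in\mathcal J_n$, $n\ge1$, the parent $x^-$ is the unique prefix of $x$ in $\mathcal J_{n-1}$. Augmented tree $(X,\mathfrak E)$: $\mathfrak E=\mathfrak E_v\cup\mathfrak E_h$, $\mathfrak E_v=\{(x,y):x=y^-\text{ or }y=x^-\}$ and, for a fixed $\gamma>0$, $\mathfrak E_h=\{(x,y):x\ne y,\ |x|=|y|,\ \inf_{\xi,\eta\in K}|S_x(\xi)-S_y(\eta)|\le\gamma r^{|x|}\}$. $\lambda$-NRW: Markov chain with $P(x,y)=c(x,y)/m(x)$, $m(x)=\sum_yc(x,y)$,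 $c$ symmetric and nonnegative, with $c(x,x^-)=r_x^\alpha\lambda^{-m}$ for $x\in\mathcal J_m$, $m\ge1$; $c(x,y)\asymp c(x,x^-)$ for $(x,y)\in\mathfrak E_h$ (two-sided bounds with positive constants independent of $x,y$); $c(x,y)=0$ if $(x,y)\notin\mathfrak E$. This walk is irreducible and transient. $F(x,y)$ is the probability that the chain started at $x$ ever visits $y$ (time $0$ included); $G=\sum_{k\ge0}P^k$; the Martin kernel is $K(x,y)=G(x,y)/G(\vartheta,y)=F(x,y)/F(\vartheta,y)$. Boundaries. With $d$ the graph metric, $(x|y)=\frac12(|x|+|y|-d(x,y))$. The graph is hyperbolic; $\partial_HX$ is the set of geodesic rays $(x_n)_n$ from $\vartheta$ modulo $(x_n)\sim(y_n)$ iff $(x_n|y_n)\to\infty$. The Martin compactification $\widehat X$ is the minimal compactification of $X$ to which all $K(x,\cdot)$ extend continuously; $\mathcal M=\widehat X\setminus X$. Canonical identification $\partial_HX\approx\mathcal M\approx K$: a geodesic ray $(x_n)$ from $\vartheta$ corresponds to its limit in $\mathcal M$ and to the unique point of $\bigcap_nS_{x_n}(K)$; $K(x,\xi)$ is the extended Martin kernel at the point of $\mathcal M$ corresponding to $\xi$. For $x\in X$, $\xi\in\partial_HX$: $(x|\xi)=\sup\{\lim_n(x_n|x)\}$ over all geodesic rays $(x_n)$ from $\vartheta$ converging to $\xi$. *)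

theory Defs
  imports "HOL-Probability.Probability" "HOL-Library.Sublist"
begin

section \<open>Two-sided estimates\<close>

definition comparable_on :: "'i set \<Rightarrow> ('i \<Rightarrow> real) \<Rightarrow> ('i \<Rightarrow> real) \<Rightarrow> bool" where
  "comparable_on A f g \<longleftrightarrow>
     (\<exists>C1>0. \<exists>C2>0. \<forall>a\<in>A. C1 * g a \<le> f a \<and> f a \<le> C2 * g a)"

section \<open>Iterated function systems of similitudes\<close>

definition similitude_ifs :: "nat \<Rightarrow> (nat \<Rightarrow> 'a::euclidean_space \<Rightarrow> 'a) \<Rightarrow> (nat \<Rightarrow> real) \<Rightarrow> bool" where
  "similitude_ifs N S \<rho> \<longleftrightarrow>
     2 \<le> N \<and>
     (\<forall>i\<in>{1..N}. 0 < \<rho> i \<and> \<rho> i < 1 \<and> (\<forall>u v. dist (S i u) (S i v) = \<rho> i * dist u v))"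

definition open_set_condition :: "nat \<Rightarrow> (nat \<Rightarrow> 'a::euclidean_space \<Rightarrow> 'a) \<Rightarrow> bool" where
  "open_set_condition N S \<longleftrightarrow>
     (\<exists>U. U \<noteq> {} \<and> bounded U \<and> open U \<and>
        (\<forall>i\<in>{1..N}. S i ` U \<subseteq> U) \<and>
        (\<forall>i\<in>{1..N}. \<forall>j\<in>{1..N}. i \<noteq> j \<longrightarrow> S i ` U \<inter> S j ` U = {}))"

definition self_similar_set :: "nat \<Rightarrow> (nat \<Rightarrow> 'a::euclidean_space \<Rightarrow> 'a) \<Rightarrow> 'a set \<Rightarrow> bool" where
  "self_similar_set N S K \<longleftrightarrow> compact K \<and> K \<noteq> {} \<and> K = (\<Union>i\<in>{1..N}. S i ` K)"

definition min_ratio :: "nat \<Rightarrow> (nat \<Rightarrow> real) \<Rightarrow> real" where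
  "min_ratio N \<rho> = Min (\<rho> ` {1..N})"

definition word_map :: "(nat \<Rightarrow> 'a \<Rightarrow> 'a) \<Rightarrow> nat list \<Rightarrow> 'a \<Rightarrow> 'a" where
  "word_map S x = foldr (\<lambda>i f. S i \<circ> f) x id"

definition word_ratio :: "(nat \<Rightarrow> real) \<Rightarrow> nat list \<Rightarrow> real" where
  "word_ratio \<rho> x = prod_list (map \<rho> x)"

section \<open>The augmented tree\<close>

definition level_set :: "nat \<Rightarrow> (nat \<Rightarrow> real) \<Rightarrow> nat \<Rightarrow> nat list set" where
  "level_set N \<rho> n =
     (if n = 0 then {[]}
      else {x \<in> lists {1..N}. x \<noteq> [] \<and> word_ratio \<rho> x \<le> min_ratio N \<rho> ^ n \<and>
                              min_ratio N \<rho> ^ n < word_ratio \<rho> (butlast x)})"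

definition vertices :: "nat \<Rightarrow> (nat \<Rightarrow> real) \<Rightarrow> nat list set" where
  "vertices N \<rho> = (\<Union>n. level_set N \<rho> n)"

definition level :: "nat \<Rightarrow> (nat \<Rightarrow> real) \<Rightarrow> nat list \<Rightarrow> nat" where
  "level N \<rho> x = (THE n. x \<in> level_set N \<rho> n)"

text \<open>Only meaningful for vertices other than the root \<open>[]\<close>.\<close>

definition parent :: "nat \<Rightarrow> (nat \<Rightarrow> real) \<Rightarrow> nat list \<Rightarrow> nat list" where
  "parent N \<rho> x = (THE y. prefix y x \<and> y \<in> level_set N \<rho> (level N \<rho> x - 1))"

definition vertical_edges :: "nat \<Rightarrow> (nat \<Rightarrow> real) \<Rightarrow> (nat list \<times> nat list) set" where
  "vertical_edges N \<rho> =
     {(x, y). x \<in> vertices N \<rho> \<and> y \<in> vertices N \<rho> \<and>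
              (y \<noteq> [] \<and> x = parent N \<rho> y \<or> x \<noteq> [] \<and> y = parent N \<rho> x)}"

definition horizontal_edges ::
  "nat \<Rightarrow> (nat \<Rightarrow> 'a::euclidean_space \<Rightarrow> 'a) \<Rightarrow> (nat \<Rightarrow> real) \<Rightarrow> 'a set \<Rightarrow> real \<Rightarrow> (nat list \<times> nat list) set" where
  "horizontal_edges N S \<rho> K \<gamma> =
     {(x, y). x \<in> vertices N \<rho> \<and> y \<in> vertices N \<rho> \<and> x \<noteq> y \<and> level N \<rho> x = level N \<rho> y \<and>
              setdist (word_map S x ` K) (word_map S y ` K) \<le> \<gamma> * min_ratio N \<rho> ^ level N \<rho> x}"

definition augmented_tree_edges ::
  "nat \<Rightarrow> (nat \<Rightarrow> 'a::euclidean_space \<Rightarrow> 'a) \<Rightarrow> (nat \<Rightarrow> real) \<Rightarrow> 'a set \<Rightarrow> real \<Rightarrow> (nat list \<times> nat list) set" where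
  "augmented_tree_edges N S \<rho> K \<gamma> = vertical_edges N \<rho> \<union> horizontal_edges N S \<rho> K \<gamma>"

section \<open>Gromov product and hyperbolic boundary\<close>

text \<open>In this section \<open>V\<close> is the vertex set, \<open>E\<close> the (symmetric) edge relation of a connected graph,
  \<open>base\<close> its base point and \<open>lev x\<close> stands for \<open>|x|\<close>.\<close>

definition graph_dist :: "('v \<times> 'v) set \<Rightarrow> 'v \<Rightarrow> 'v \<Rightarrow> nat" where
  "graph_dist E x y = (LEAST n. (x, y) \<in> E ^^ n)"

definition gromov_product :: "('v \<Rightarrow> nat) \<Rightarrow> ('v \<times> 'v) set \<Rightarrow> 'v \<Rightarrow> 'v \<Rightarrow> real" where
  "gromov_product lev E x y = (real (lev x) + real (lev y) - real (graph_dist E x y)) / 2"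

definition geodesic_rays :: "'v set \<Rightarrow> ('v \<times> 'v) set \<Rightarrow> 'v \<Rightarrow> (nat \<Rightarrow> 'v) set" where
  "geodesic_rays V E base =
     {s. s 0 = base \<and> range s \<subseteq> V \<and> (\<forall>m n. m \<le> n \<longrightarrow> graph_dist E (s m) (s n) = n - m)}"

text \<open>Boundary points are equivalence classes, i.e. sets of rays; a ray converges to \<open>\<xi>\<close> iff it is
  an element of \<open>\<xi>\<close>.\<close>

definition hyperbolic_boundary ::
  "('v \<Rightarrow> nat) \<Rightarrow> 'v set \<Rightarrow> ('v \<times> 'v) set \<Rightarrow> 'v \<Rightarrow> (nat \<Rightarrow> 'v) set set" where
  "hyperbolic_boundary lev V E base =
     geodesic_rays V E base //
       {(s, t). s \<in> geodesic_rays V E base \<and> t \<in> geodesic_rays V E base \<and>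
                filterlim (\<lambda>n. gromov_product lev E (s n) (t n)) at_top sequentially}"

definition gromov_product_boundary ::
  "('v \<Rightarrow> nat) \<Rightarrow> ('v \<times> 'v) set \<Rightarrow> 'v \<Rightarrow> (nat \<Rightarrow> 'v) set \<Rightarrow> real" where
  "gromov_product_boundary lev E x \<xi> = (SUP s\<in>\<xi>. lim (\<lambda>n. gromov_product lev E (s n) x))"

section \<open>Markov chains, Green function and Martin kernel\<close>

definition transition_prob :: "'v set \<Rightarrow> ('v \<Rightarrow> 'v \<Rightarrow> real) \<Rightarrow> 'v \<Rightarrow> 'v \<Rightarrow> real" where
  "transition_prob V c x y = c x y / (\<Sum>\<^sub>\<infinity>z\<in>V. c x z)"

text \<open>\<open>Z\<close> is, under the probability measure \<open>M\<close>, a Markov chain on \<open>V\<close> that starts at \<open>x\<close> and has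
  transition probabilities \<open>p\<close>. The last clause is the Markov property, multiplied out so that no
  conditioning on null events occurs.\<close>

definition markov_chain_from ::
  "'v set \<Rightarrow> ('v \<Rightarrow> 'v \<Rightarrow> real) \<Rightarrow> 'w measure \<Rightarrow> (nat \<Rightarrow> 'w \<Rightarrow> 'v) \<Rightarrow> 'v \<Rightarrow> bool" where
  "markov_chain_from V p M Z x \<longleftrightarrow>
     prob_space M \<and>
     (\<forall>n. Z n \<in> measurable M (count_space V)) \<and>
     \<P>(\<omega> in M. Z 0 \<omega> = x) = 1 \<and>
     (\<forall>n w. (\<forall>i\<le>Suc n. w i \<in> V) \<longrightarrow>
        \<P>(\<omega> in M. \<forall>i\<le>Suc n. Z i \<omega> = w i) =
        \<P>(\<omega> in M. \<forall>i\<le>n. Z i \<omega> = w i) * p (w n) (w (Suc n)))"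

text \<open>Here \<open>M x\<close> is the law under which the chain starts at \<open>x\<close>.\<close>

definition hitting_prob :: "('v \<Rightarrow> 'w measure) \<Rightarrow> (nat \<Rightarrow> 'w \<Rightarrow> 'v) \<Rightarrow> 'v \<Rightarrow> 'v \<Rightarrow> real" where
  "hitting_prob M Z x y = \<P>(\<omega> in M x. \<exists>n. Z n \<omega> = y)"

primrec step_prob :: "'v set \<Rightarrow> ('v \<Rightarrow> 'v \<Rightarrow> real) \<Rightarrow> nat \<Rightarrow> 'v \<Rightarrow> 'v \<Rightarrow> real" where
  "step_prob V p 0 x y = (if x = y then 1 else 0)"
| "step_prob V p (Suc k) x y = (\<Sum>\<^sub>\<infinity>z\<in>V. p x z * step_prob V p k z y)"

definition green :: "'v set \<Rightarrow> ('v \<Rightarrow> 'v \<Rightarrow> real) \<Rightarrow> 'v \<Rightarrow> 'v \<Rightarrow> real" where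
  "green V p x y = (\<Sum>k. step_prob V p k x y)"

definition martin_kernel :: "'v set \<Rightarrow> ('v \<Rightarrow> 'v \<Rightarrow> real) \<Rightarrow> 'v \<Rightarrow> 'v \<Rightarrow> 'v \<Rightarrow> real" where
  "martin_kernel V p base x y = green V p x y / green V p base y"

section \<open>The Martin compactification\<close>

text \<open>
  For a kernel \<open>k\<close> on a countable discrete set \<open>V\<close>, the minimal compactification of \<open>V\<close> to which all
  \<open>k x\<close> (\<open>x \<in> V\<close>) extend continuously is realised in the usual way: \<open>V\<close> is mapped into a product of
  copies of the real line by the point indicators (which make \<open>V\<close> discrete and open) and the
  functions \<open>k x\<close>, and the closure of the image is taken. The function spaces carry the product
  topology. The lemmas below show that this is a compactification with continuous extensions of
  all \<open>k x\<close>, and that every other such compactification maps onto it.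
\<close>

type_synonym 'v martin_point = "('v \<Rightarrow> real) \<times> ('v \<Rightarrow> real)"

definition martin_embedding :: "'v set \<Rightarrow> ('v \<Rightarrow> 'v \<Rightarrow> real) \<Rightarrow> 'v \<Rightarrow> 'v martin_point" where
  "martin_embedding V k y = ((\<lambda>z. if z = y then 1 else 0), (\<lambda>x. if x \<in> V then k x y else 0))"

definition martin_compactification :: "'v set \<Rightarrow> ('v \<Rightarrow> 'v \<Rightarrow> real) \<Rightarrow> 'v martin_point set" where
  "martin_compactification V k = closure (martin_embedding V k ` V)"

definition martin_boundary :: "'v set \<Rightarrow> ('v \<Rightarrow> 'v \<Rightarrow> real) \<Rightarrow> 'v martin_point set" where
  "martin_boundary V k = martin_compactification V k - martin_embedding V k ` V"

definition martin_extension :: "'v \<Rightarrow> 'v martin_point \<Rightarrow> real" where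
  "martin_extension x q = snd q x"

lemma martin_extension_embedding:
  "x \<in> V \<Longrightarrow> martin_extension x (martin_embedding V k y) = k x y"
  by (simp add: martin_extension_def martin_embedding_def)

lemma continuous_on_martin_extension: "continuous_on A (martin_extension x)"
  unfolding martin_extension_def
  by (rule continuous_on_product_then_coordinatewise) (intro continuous_intros)

lemma compact_martin_compactification:
  fixes k :: "'v::countable \<Rightarrow> 'v \<Rightarrow> real"
  assumes "\<And>x. x \<in> V \<Longrightarrow> bounded (k x ` V)"
  shows "compact (martin_compactification V k)"
proof -
  obtain B where B: "\<And>x y. x \<in> V \<Longrightarrow> y \<in> V \<Longrightarrow> \<bar>k x y\<bar> \<le> B x"
    using assms unfolding bounded_iff real_norm_def by (metis imageI)
  have box: "compact (PiE UNIV J)" if "\<And>x. compact (J x)" for J :: "'v \<Rightarrow> real set"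
    using that by (simp add: compactin_PiE flip: euclidean_product_topology compactin_euclidean_iff)
  let ?A = "PiE UNIV (\<lambda>_. {0..1}) \<times> PiE UNIV (\<lambda>x. {- \<bar>B x\<bar>..\<bar>B x\<bar>}) :: 'v martin_point set"
  have A: "compact ?A"
    by (intro compact_Times box) auto
  have "\<bar>k x y\<bar> \<le> \<bar>B x\<bar>" if "x \<in> V" "y \<in> V" for x y
    using B[OF that] by linarith
  then have "martin_embedding V k ` V \<subseteq> ?A"
    by (fastforce simp: martin_embedding_def PiE_iff abs_le_iff)
  then have "martin_compactification V k \<subseteq> ?A"
    unfolding martin_compactification_def
    by (intro closure_minimal compact_imp_closed A)
  then show ?thesis
    using compact_Int_closed[OF A, of "martin_compactification V k"]
    by (simp add: martin_compactification_def Int_absorb1)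
qed

lemma embedding_map_martin_embedding:
  "embedding_map (discrete_topology V) (top_of_set (martin_compactification V k)) (martin_embedding V k)"
proof -
  let ?e = "martin_embedding V k"
  have inj: "inj_on ?e V"
    by (auto simp: inj_on_def martin_embedding_def fun_eq_iff split: if_splits)
  have cont1: "continuous_on UNIV (\<lambda>q :: 'a martin_point. fst q y)" for y
    by (rule continuous_on_product_then_coordinatewise) (intro continuous_intros)
  have "openin (top_of_set (?e ` V)) {?e y}" if "y \<in> V" for y
  proof -
    have "open ((\<lambda>q :: 'a martin_point. fst q y) -` {1/2<..})"
      using cont1 by (simp add: continuous_on_open_vimage)
    moreover have "{?e y} = ?e ` V \<inter> (\<lambda>q. fst q y) -` {1/2<..}"
      using that by (auto simp: martin_embedding_def split: if_splits)
    ultimately show ?thesis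
      unfolding openin_open by blast
  qed
  then have disc: "top_of_set (?e ` V) = discrete_topology (?e ` V)"
    using discrete_topology_unique[of "?e ` V" "top_of_set (?e ` V)"] by auto
  have sub: "?e ` V \<subseteq> martin_compactification V k"
    by (simp add: martin_compactification_def closure_subset)
  have "homeomorphic_map (discrete_topology V) (discrete_topology (?e ` V)) ?e"
    using inj by (intro bijective_open_imp_homeomorphic_map) (auto simp: open_map_def)
  then show ?thesis
    unfolding embedding_map_def topspace_discrete_topology subtopology_subtopology
    using sub by (simp only: Int_absorb1 disc)
qed

lemma martin_compactification_minimal:
  fixes T :: "'b topology" and k :: "'v::countable \<Rightarrow> 'v \<Rightarrow> real"
  assumes "compact_space T" "Hausdorff_space T"
    and "embedding_map (discrete_topology V) T e" "T closure_of (e ` V) = topspace T"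
    and "\<And>x. x \<in> V \<Longrightarrow> \<exists>f. continuous_map T euclideanreal f \<and> (\<forall>y\<in>V. f (e y) = k x y)"
  shows "\<exists>h. continuous_map T (top_of_set (martin_compactification V k)) h \<and>
             h ` topspace T = martin_compactification V k \<and>
             (\<forall>y\<in>V. h (e y) = martin_embedding V k y)"
proof -
  define f where
    "f x = (SOME g. continuous_map T euclideanreal g \<and> (\<forall>y\<in>V. g (e y) = k x y))" for x
  have f: "continuous_map T euclideanreal (f x)" "y \<in> V \<Longrightarrow> f x (e y) = k x y" if "x \<in> V" for x y
    using someI_ex[OF assms(5)[OF that]] by (simp_all add: f_def)
  have "e ` V = topspace T \<inter> e ` V"
    using homeomorphic_imp_surjective_map[OF assms(3)[unfolded embedding_map_def]]
    unfolding topspace_discrete_topology topspace_subtopology .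
  then have eV: "e ` V \<subseteq> topspace T"
    using equalityD1 le_inf_iff by blast
  have inj: "inj_on e V"
    using homeomorphic_imp_injective_map[OF assms(3)[unfolded embedding_map_def]]
    unfolding topspace_discrete_topology .
  have iso: "openin T {e y}" if y: "y \<in> V" for y
  proof -
    have "openin (subtopology T (e ` V)) (e ` {y})"
      using homeomorphic_imp_open_map[OF assms(3)[unfolded embedding_map_def]] y
      unfolding open_map_def by (elim allE[of _ "{y}"]) simp
    then obtain W where W: "openin T W" "{e y} = W \<inter> e ` V"
      unfolding openin_subtopology image_insert image_empty by blast
    have "W \<subseteq> T closure_of (W \<inter> e ` V)"
      using openin_Int_closure_of_subset[OF W(1), of "e ` V"] assms(4) openin_subset[OF W(1)] by blast
    also have "\<dots> = {e y}"
      unfolding W(2)[symmetric] closure_of_eq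
      using closedin_Hausdorff_singleton[OF assms(2)] y eV by blast
    finally have "W = {e y}" using W(2) by blast
    then show ?thesis using W(1) by simp
  qed
  define h where "h q = ((\<lambda>z. if z \<in> V \<and> q = e z then 1 else 0 :: real),
    (\<lambda>x. if x \<in> V then f x q else 0))" for q
  have ind: "continuous_map T euclideanreal (\<lambda>q. if z \<in> V \<and> q = e z then 1 else 0)" for z
  proof (cases "z \<in> V")
    case True
    have cl: "closedin T {e z}"
      using True eV assms(2) by (auto simp: closedin_Hausdorff_singleton)
    show ?thesis
      unfolding continuous_map_def
    proof (intro conjI allI impI)
      fix U :: "real set"
      have "{q \<in> topspace T. (if z \<in> V \<and> q = e z then 1 else 0) \<in> U} =
        (if 1 \<in> U then {e z} else {}) \<union> (if 0 \<in> U then topspace T - {e z} else {})"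
        using True eV by auto
      moreover have "openin T (if 1 \<in> U then {e z} else {})"
        using iso[OF True] by simp
      moreover have "openin T (if 0 \<in> U then topspace T - {e z} else {})"
        using cl by (simp add: openin_diff)
      ultimately show "openin T {q \<in> topspace T. (if z \<in> V \<and> q = e z then 1 else 0) \<in> U}"
        by (simp only: openin_Un)
    qed auto
  qed auto
  have cont: "continuous_map T euclidean h"
  proof -
    have "continuous_map T euclideanreal (\<lambda>q. if x \<in> V then f x q else 0)" for x
      using f(1) by (cases "x \<in> V") auto
    then show ?thesis
      unfolding h_def prod_topology_euclidean[symmetric] euclidean_product_topology[symmetric]
      by (intro continuous_map_pairedI) (simp_all add: continuous_map_componentwise_UNIV ind)
  qed
  have he: "h (e y) = martin_embedding V k y" if "y \<in> V" for y
    using that f(2) inj by (auto simp: h_def martin_embedding_def fun_eq_iff inj_on_def)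
  have im: "h ` topspace T = martin_compactification V k"
  proof (rule antisym)
    have "h ` (T closure_of (e ` V)) \<subseteq> euclidean closure_of (h ` e ` V)"
      by (rule continuous_map_image_closure_subset[OF cont])
    also have "h ` e ` V = martin_embedding V k ` V"
      using he by (auto simp: image_image)
    finally show "h ` topspace T \<subseteq> martin_compactification V k"
      by (simp add: assms(4) martin_compactification_def)
    have "compact (h ` topspace T)"
      using image_compactin[OF _ cont] assms(1) by (auto simp: compact_space_def)
    moreover have "martin_embedding V k ` V \<subseteq> h ` topspace T"
      using he eV by (metis (no_types, lifting) image_subset_iff imageI)
    ultimately show "martin_compactification V k \<subseteq> h ` topspace T"
      unfolding martin_compactification_def by (intro closure_minimal compact_imp_closed)
  qed
  show ?thesis
    using cont im he by (intro exI[of _ h]) (auto simp: continuous_map_in_subtopology)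
qed

text \<open>The point of the Martin boundary identified with the hyperbolic boundary point \<open>\<xi>\<close>, and the
  extended kernel at that point.\<close>

definition martin_point_of :: "'v set \<Rightarrow> ('v \<Rightarrow> 'v \<Rightarrow> real) \<Rightarrow> (nat \<Rightarrow> 'v) set \<Rightarrow> 'v martin_point" where
  "martin_point_of V k \<xi> =
     (THE q. q \<in> martin_boundary V k \<and> (\<forall>s\<in>\<xi>. (\<lambda>n. martin_embedding V k (s n)) \<longlonglongrightarrow> q))"

definition martin_kernel_boundary :: "'v set \<Rightarrow> ('v \<Rightarrow> 'v \<Rightarrow> real) \<Rightarrow> 'v \<Rightarrow> 'v \<Rightarrow> (nat \<Rightarrow> 'v) set \<Rightarrow> real" where
  "martin_kernel_boundary V p base x \<xi> =
     martin_extension x (martin_point_of V (martin_kernel V p base) \<xi>)"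

section \<open>Natural random walks\<close>

definition natural_conductance ::
  "nat \<Rightarrow> (nat \<Rightarrow> 'a::euclidean_space \<Rightarrow> 'a) \<Rightarrow> (nat \<Rightarrow> real) \<Rightarrow> 'a set \<Rightarrow> real \<Rightarrow> real \<Rightarrow> real
     \<Rightarrow> (nat list \<Rightarrow> nat list \<Rightarrow> real) \<Rightarrow> bool" where
  "natural_conductance N S \<rho> K \<gamma> \<alpha> lam c \<longleftrightarrow>
     (\<forall>x\<in>vertices N \<rho>. \<forall>y\<in>vertices N \<rho>. c x y = c y x \<and> 0 \<le> c x y) \<and>
     (\<forall>x\<in>vertices N \<rho>. \<forall>y\<in>vertices N \<rho>. (x, y) \<notin> augmented_tree_edges N S \<rho> K \<gamma> \<longrightarrow> c x y = 0) \<and>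
     (\<forall>m\<ge>1. \<forall>x\<in>level_set N \<rho> m. c x (parent N \<rho> x) = word_ratio \<rho> x powr \<alpha> * lam powr (- real m)) \<and>
     comparable_on (horizontal_edges N S \<rho> K \<gamma>) (\<lambda>(x, y). c x y) (\<lambda>(x, y). c x (parent N \<rho> x))"

definition natural_random_walk ::
  "nat \<Rightarrow> (nat \<Rightarrow> 'a::euclidean_space \<Rightarrow> 'a) \<Rightarrow> (nat \<Rightarrow> real) \<Rightarrow> 'a set \<Rightarrow> real \<Rightarrow> real \<Rightarrow> real
     \<Rightarrow> (nat list \<Rightarrow> nat list \<Rightarrow> real) \<Rightarrow> (nat list \<Rightarrow> 'w measure) \<Rightarrow> (nat \<Rightarrow> 'w \<Rightarrow> nat list) \<Rightarrow> bool" where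
  "natural_random_walk N S \<rho> K \<gamma> \<alpha> lam c M Z \<longleftrightarrow>
     natural_conductance N S \<rho> K \<gamma> \<alpha> lam c \<and>
     (\<forall>x\<in>vertices N \<rho>.
        markov_chain_from (vertices N \<rho>) (transition_prob (vertices N \<rho>) c) (M x) Z x)"

end

theory Submission
  imports Defs
begin

text \<open>
  Write \<open>F\<close> for the hitting probabilities, \<open>|x|\<close> for the level of \<open>x\<close> and \<open>pos x = S\<^sub>x(\<xi>)\<close> for the position of
  \<open>x\<close>, where \<open>\<xi>\<close> is some point of \<open>K\<close>, the same for all \<open>x\<close>. The proof compares \<open>F\<close> with explicit superharmonic functions of the
  level and the position.

  \<^bold>\<open>Vertical motion.\<close> By \<open>\<Sum>\<^sub>i r\<^sub>i\<^sup>\<alpha> = 1\<close> the conductances from a vertex to its children add up to \<open>1/\<lambda>\<close> times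
  the conductance to its parent. Hence \<open>\<lambda>\<close> to the power of the level is harmonic off the root, which gives
  \<open>F(x,y) \<le> \<lambda>\<^bsup>|x|-|y|\<^esup>\<close> and shows that the walk escapes from every vertex with probability bounded below,
  so the Green function is comparable to \<open>F\<close>. The total conductance at \<open>x\<close> is comparable to
  \<open>(r\<^sup>\<alpha>/\<lambda>)\<^bsup>|x|\<^esup>\<close>, so reversibility turns this into \<open>F(x,y) \<le> C r\<^bsup>\<alpha>(|y|-|x|)\<^esup>\<close> (\<open>hit_ra\<close>).

  \<^bold>\<open>Upper bound.\<close> Let \<open>r\<^sup>s = r\<^sup>\<alpha> \<lambda>\<close>. For large \<open>a\<close> the function
  \<open>f(z) = \<lambda>\<^bsup>|z|\<^esup> (a r\<^bsup>|z|\<^esup> + |pos z - pos y|)\<^bsup>-s\<^esup>\<close> is superharmonic outside the cone of those \<open>z\<close> whose position is at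
  distance \<open>O(r\<^bsup>|z|\<^esup>)\<close> from \<open>pos y\<close>. In the cone \<open>f(z)\<close> is of order \<open>r\<^bsup>-\<alpha>|z|\<^esup>\<close>, so there \<open>F(z,y) \<le> C r\<^bsup>\<alpha>|y|\<^esup> f(z)\<close>
  is already known, and by minimality of \<open>F\<close> it holds everywhere (\<open>hit_cone\<close>).

  \<^bold>\<open>Lower bound.\<close> The function \<open>\<lambda>\<^bsup>|z|\<^esup> (|pos z - pos x| - a r\<^bsup>|z|\<^esup>)\<close> is superharmonic off the root. This says that,
  of the probability \<open>\<lambda>\<^sup>k\<close> of ever climbing \<open>k\<close> levels from \<open>x\<close>, at least half is carried by vertices at
  distance \<open>O(r\<^bsup>|x|-k\<^esup>)\<close> from the ancestor of \<open>x\<close>, which is then reached in boundedly many further steps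
  (\<open>hit_ancestor\<close>). Reversibility gives the estimate for descending, and a path up, across and down gives the
  general case.

  Both bounds are stated at a level where the ancestors of \<open>x\<close> and \<open>y\<close> meet. The steps of a path move the
  position by a geometric series, so this level differs from the Gromov product by a bounded amount.

  \<^bold>\<open>Boundary.\<close> The estimate at a boundary point requires that the Martin kernels converge along the
  geodesic rays of one class, all to the same limit. Subsequential limits along equivalent rays are
  positive harmonic functions \<open>h, w\<close> of the same size. If \<open>T\<close> is the supremum of \<open>w/h\<close>, then \<open>T h - w\<close> is
  nonnegative and harmonic, and the two-sided estimates transport its smallness at one vertex to the tail of the
  ray; so \<open>w/h\<close> tends to \<open>T\<close> along the ray, and for the same reason to its infimum
  (\<open>comparable_harmonic_eq\<close>). Therefore \<open>w/h\<close> is constant, and compactness yields convergence.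
\<close>

section \<open>Finite range Markov chains\<close>

locale finite_range_chain =
  fixes V :: "'v set" and P :: "'v \<Rightarrow> 'v \<Rightarrow> real" and nb :: "'v \<Rightarrow> 'v set"
  assumes finite_nb: "x \<in> V \<Longrightarrow> finite (nb x)"
    and nb_subset: "x \<in> V \<Longrightarrow> nb x \<subseteq> V"
    and P_nonneg: "x \<in> V \<Longrightarrow> z \<in> V \<Longrightarrow> 0 \<le> P x z"
    and P_eq_0: "x \<in> V \<Longrightarrow> z \<in> V \<Longrightarrow> z \<notin> nb x \<Longrightarrow> P x z = 0"
    and P_sum: "x \<in> V \<Longrightarrow> (\<Sum>z\<in>nb x. P x z) = 1"
begin

definition avg :: "('v \<Rightarrow> real) \<Rightarrow> 'v \<Rightarrow> real" where
  "avg f x = (\<Sum>z\<in>nb x. P x z * f z)"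

lemma nb_in: "z \<in> nb x \<Longrightarrow> x \<in> V \<Longrightarrow> z \<in> V"
  using nb_subset by blast

lemma avg_mono: "x \<in> V \<Longrightarrow> (\<And>z. z \<in> nb x \<Longrightarrow> f z \<le> g z) \<Longrightarrow> avg f x \<le> avg g x"
  unfolding avg_def by (intro sum_mono mult_left_mono P_nonneg) (auto dest: nb_in)

lemma avg_cmult: "avg (\<lambda>z. k * f z) x = k * avg f x"
  unfolding avg_def by (simp add: sum_distrib_left mult_ac)

lemma avg_diff: "avg (\<lambda>z. f z - g z) x = avg f x - avg g x"
  unfolding avg_def by (simp add: sum_subtractf algebra_simps)

lemma avg_const: "x \<in> V \<Longrightarrow> avg (\<lambda>_. k) x = k"
  unfolding avg_def by (simp add: P_sum flip: sum_distrib_right)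

lemma avg_nonneg: "x \<in> V \<Longrightarrow> (\<And>z. z \<in> V \<Longrightarrow> 0 \<le> f z) \<Longrightarrow> 0 \<le> avg f x"
  unfolding avg_def by (intro sum_nonneg mult_nonneg_nonneg P_nonneg) (auto dest: nb_in)

lemma avg_ge_term:
  assumes "x \<in> V" "z \<in> V" and f: "\<And>z. z \<in> V \<Longrightarrow> 0 \<le> f z"
  shows "P x z * f z \<le> avg f x"
proof (cases "z \<in> nb x")
  case True
  then show ?thesis
    unfolding avg_def using assms
    by (intro member_le_sum) (auto simp: finite_nb dest: nb_in intro!: mult_nonneg_nonneg P_nonneg f)
next
  case False
  then show ?thesis using assms avg_nonneg[of x f] P_eq_0[of x z] by auto
qed

lemma avg_tendsto:
  assumes "\<And>z. z \<in> nb x \<Longrightarrow> (\<lambda>n. f n z) \<longlonglongrightarrow> g z"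
  shows "(\<lambda>n. avg (f n) x) \<longlonglongrightarrow> avg g x"
  unfolding avg_def by (intro tendsto_intros assms)

subsection \<open>Hitting probabilities\<close>

primrec hit_by :: "nat \<Rightarrow> 'v \<Rightarrow> 'v \<Rightarrow> real" where
  "hit_by 0 y x = of_bool (x = y)"
| "hit_by (Suc n) y x = (if x = y then 1 else avg (hit_by n y) x)"

definition hit :: "'v \<Rightarrow> 'v \<Rightarrow> real" where
  "hit x y = (SUP n. hit_by n y x)"

lemma hit_by_range: "x \<in> V \<Longrightarrow> 0 \<le> hit_by n y x \<and> hit_by n y x \<le> 1"
proof (induction n arbitrary: x)
  case (Suc n)
  have "avg (hit_by n y) x \<le> avg (\<lambda>_. 1) x" "0 \<le> avg (hit_by n y) x"
    using Suc by (auto intro!: avg_mono avg_nonneg dest: nb_in)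
  then show ?case using Suc.prems by (simp add: avg_const)
qed auto

lemma hit_by_Suc_ge: "x \<in> V \<Longrightarrow> hit_by n y x \<le> hit_by (Suc n) y x"
proof (induction n arbitrary: x)
  case 0
  then show ?case using hit_by_range[of x "Suc 0" y] by (auto split: if_splits)
next
  case (Suc n)
  have "avg (hit_by n y) x \<le> avg (hit_by (Suc n) y) x"
    using Suc by (intro avg_mono) (blast dest: nb_in)+
  then show ?case by simp
qed

lemma hit_by_self [simp]: "hit_by n y y = 1"
  by (cases n) auto

lemma incseq_hit_by: "x \<in> V \<Longrightarrow> incseq (\<lambda>n. hit_by n y x)"
  by (intro incseq_SucI hit_by_Suc_ge)

lemma hit_by_tendsto: "x \<in> V \<Longrightarrow> (\<lambda>n. hit_by n y x) \<longlonglongrightarrow> hit x y"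
  unfolding hit_def
  by (intro LIMSEQ_incseq_SUP incseq_hit_by bdd_aboveI[of _ 1]) (auto simp: hit_by_range)

lemma hit_by_le_hit: "x \<in> V \<Longrightarrow> hit_by n y x \<le> hit x y"
  using incseq_le[OF incseq_hit_by hit_by_tendsto] .

lemma hit_self [simp]: "hit y y = 1"
  by (simp add: hit_def)

lemma hit_nonneg: "x \<in> V \<Longrightarrow> 0 \<le> hit x y"
  using hit_by_le_hit[of x 0 y] hit_by_range[of x 0 y] by linarith

lemma hit_le_1: "x \<in> V \<Longrightarrow> hit x y \<le> 1"
  using LIMSEQ_le_const2[OF hit_by_tendsto] hit_by_range by blast

lemma hit_avg: assumes "x \<in> V" "x \<noteq> y" shows "hit x y = avg (\<lambda>z. hit z y) x"
proof -
  have "(\<lambda>n. hit_by (Suc n) y x) \<longlonglongrightarrow> avg (\<lambda>z. hit z y) x"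
    using assms by (auto intro!: avg_tendsto hit_by_tendsto dest: nb_in)
  with LIMSEQ_Suc[OF hit_by_tendsto[OF assms(1)]] show ?thesis
    using LIMSEQ_unique by blast
qed

lemma avg_hit_le: assumes "x \<in> V" shows "avg (\<lambda>z. hit z y) x \<le> hit x y"
proof (cases "x = y")
  case True
  have "avg (\<lambda>z. hit z y) x \<le> avg (\<lambda>_. 1) x"
    using assms by (intro avg_mono hit_le_1) (auto dest: nb_in)
  then show ?thesis using True assms by (simp add: avg_const)
qed (use hit_avg assms in auto)

text \<open>\<^term>\<open>hit\<close> is the least nonnegative function that is superharmonic off the target and at least
  \<open>1\<close> there. To bound a hitting probability it thus suffices to exhibit a comparison
  function; \<open>A\<close> is a region where the bound is known for another reason, so that superharmonicity is
  needed only outside it.\<close>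

lemma hit_le_superharmonic:
  assumes "y \<in> V" and g: "\<And>x. x \<in> V \<Longrightarrow> 0 \<le> g x" and "1 \<le> g y"
    and A: "\<And>x. x \<in> V \<Longrightarrow> x \<in> A \<Longrightarrow> hit x y \<le> g x"
    and super: "\<And>x. x \<in> V \<Longrightarrow> x \<notin> A \<Longrightarrow> x \<noteq> y \<Longrightarrow> avg g x \<le> g x"
    and "x \<in> V"
  shows "hit x y \<le> g x"
proof -
  have "hit_by n y x \<le> g x" if "x \<in> V" for x n
    using that
  proof (induction n arbitrary: x)
    case 0
    then show ?case using g[of x] \<open>1 \<le> g y\<close> by auto
  next
    case (Suc n)
    consider "x = y" | "x \<in> A" | "x \<noteq> y" "x \<notin> A" by blast
    then show ?case
    proof cases
      case 2
      then show ?thesis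
        using A[OF Suc.prems 2] hit_by_le_hit[OF Suc.prems, of "Suc n" y] by linarith
    next
      case 3
      have "avg (hit_by n y) x \<le> avg g x"
        using Suc by (intro avg_mono) (auto dest: nb_in)
      with super[OF Suc.prems] 3 show ?thesis by auto
    qed (use \<open>1 \<le> g y\<close> in auto)
  qed
  with \<open>x \<in> V\<close> show ?thesis
    using LIMSEQ_le_const2[OF hit_by_tendsto] by blast
qed

text \<open>Optional stopping of a nonnegative supermartingale at the time when the chain hits \<open>y\<close>.\<close>

lemma hit_mult_le_superharmonic:
  assumes "x \<in> V" "y \<in> V" and u: "\<And>x. x \<in> V \<Longrightarrow> 0 \<le> u x" "\<And>x. x \<in> V \<Longrightarrow> avg u x \<le> u x"
  shows "hit x y * u y \<le> u x"
proof -
  have "hit_by n y x * u y \<le> u x" if "x \<in> V" for x n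
    using that
  proof (induction n arbitrary: x)
    case (Suc n)
    show ?case
    proof (cases "x = y")
      case False
      have "avg (hit_by n y) x * u y = avg (\<lambda>z. u y * hit_by n y z) x"
        by (simp add: avg_cmult mult.commute)
      also have "\<dots> \<le> avg u x"
        using Suc by (intro avg_mono) (auto dest: nb_in simp: mult.commute)
      also have "\<dots> \<le> u x" using Suc u by auto
      finally show ?thesis using False by simp
    qed auto
  qed (use u in auto)
  moreover have "(\<lambda>n. hit_by n y x * u y) \<longlonglongrightarrow> hit x y * u y"
    using assms by (intro tendsto_intros hit_by_tendsto)
  ultimately show ?thesis
    using LIMSEQ_le_const2 \<open>x \<in> V\<close> by blast
qed

lemma hit_trans: "x \<in> V \<Longrightarrow> y \<in> V \<Longrightarrow> z \<in> V \<Longrightarrow> hit x y * hit y z \<le> hit x z"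
  by (rule hit_mult_le_superharmonic) (auto intro: hit_nonneg avg_hit_le)

lemma P_le_hit: "x \<in> V \<Longrightarrow> y \<in> V \<Longrightarrow> P x y \<le> hit x y"
  using avg_ge_term[of x y "\<lambda>z. hit z y"] avg_hit_le[of x y] hit_nonneg[of _ y] by simp

subsection \<open>The Green function\<close>

lemma step_prob_Suc:
  assumes "x \<in> V" shows "step_prob V P (Suc k) x y = avg (\<lambda>z. step_prob V P k z y) x"
proof -
  have "step_prob V P (Suc k) x y = (\<Sum>\<^sub>\<infinity>z\<in>nb x. P x z * step_prob V P k z y)"
    unfolding step_prob.simps using assms nb_subset[of x] P_eq_0[of x]
    by (intro infsum_cong_neutral) auto
  then show ?thesis
    using assms finite_nb[of x] by (simp add: avg_def)
qed

declare step_prob.simps(2) [simp del]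

lemma step_prob_nonneg: "x \<in> V \<Longrightarrow> 0 \<le> step_prob V P k x y"
proof (induction k arbitrary: x)
  case (Suc k)
  then show ?case by (auto simp: step_prob_Suc intro!: avg_nonneg)
qed auto

lemma green_bound:
  assumes u: "\<And>x. x \<in> V \<Longrightarrow> avg u x + of_bool (x = y) \<le> u x"
    and "\<And>x. x \<in> V \<Longrightarrow> 0 \<le> u x" and "x \<in> V"
  shows "summable (\<lambda>k. step_prob V P k x y)" "green V P x y \<le> u x"
proof -
  have "(\<Sum>k<n. step_prob V P k x y) \<le> u x" if "x \<in> V" for n x
    using that
  proof (induction n arbitrary: x)
    case (Suc n)
    have "(\<Sum>k<Suc n. step_prob V P k x y)
        = of_bool (x = y) + (\<Sum>k<n. avg (\<lambda>z. step_prob V P k z y) x)"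
      using Suc.prems by (simp add: sum.lessThan_Suc_shift step_prob_Suc del: sum.lessThan_Suc)
    also have "(\<Sum>k<n. avg (\<lambda>z. step_prob V P k z y) x)
        = avg (\<lambda>z. \<Sum>k<n. step_prob V P k z y) x"
      unfolding avg_def by (subst sum.swap) (simp add: sum_distrib_left)
    also have "\<dots> \<le> avg u x"
      using Suc by (intro avg_mono) (auto dest: nb_in)
    finally show ?case using u[OF Suc.prems] by linarith
  qed (use assms in auto)
  then show "summable (\<lambda>k. step_prob V P k x y)" "green V P x y \<le> u x"
    unfolding green_def using \<open>x \<in> V\<close> step_prob_nonneg
    by (auto intro!: summableI_nonneg_bounded suminf_le_const)
qed

lemma green_eq:
  assumes "x \<in> V" and sm: "\<And>z. z \<in> V \<Longrightarrow> summable (\<lambda>k. step_prob V P k z y)"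
  shows "green V P x y = of_bool (x = y) + avg (\<lambda>z. green V P z y) x"
proof -
  have "green V P x y = of_bool (x = y) + (\<Sum>k. avg (\<lambda>z. step_prob V P k z y) x)"
    unfolding green_def using suminf_split_head[OF sm[OF \<open>x \<in> V\<close>]] assms
    by (simp add: step_prob_Suc)
  also have "(\<Sum>k. avg (\<lambda>z. step_prob V P k z y) x) = avg (\<lambda>z. green V P z y) x"
    unfolding avg_def green_def using assms
    by (subst suminf_sum) (auto dest: nb_in intro!: summable_mult sm sum.cong suminf_mult)
  finally show ?thesis .
qed

lemma hit_le_green:
  assumes sm: "\<And>z. z \<in> V \<Longrightarrow> summable (\<lambda>k. step_prob V P k z y)" and "x \<in> V" "y \<in> V"
  shows "hit x y \<le> green V P x y"
proof -
  have nn: "0 \<le> green V P z y" if "z \<in> V" for z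
    unfolding green_def using that sm step_prob_nonneg by (intro suminf_nonneg) auto
  show ?thesis
  proof (rule hit_le_superharmonic[where A = "{}"])
    show "1 \<le> green V P y y"
      using green_eq[OF \<open>y \<in> V\<close> sm] nn avg_nonneg[of y "\<lambda>z. green V P z y"] \<open>y \<in> V\<close> by auto
  qed (use assms green_eq[OF _ sm] nn in auto)
qed

text \<open>If the chain escapes from \<open>y\<close> with probability at least \<open>\<epsilon>\<close>, then \<^term>\<open>\<lambda>x. hit x y / \<epsilon>\<close> exceeds its
  average by at least \<open>1\<close> at \<open>y\<close>, hence dominates all partial sums of the Green function. Transience is part of
  the conclusion.\<close>

lemma green_le_hit:
  assumes "0 < \<epsilon>" and esc: "avg (\<lambda>z. hit z y) y \<le> 1 - \<epsilon>" and "x \<in> V"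
  shows "summable (\<lambda>k. step_prob V P k x y)" "green V P x y \<le> hit x y / \<epsilon>"
proof -
  have eq: "avg (\<lambda>z. hit z y / \<epsilon>) x = avg (\<lambda>z. hit z y) x / \<epsilon>" for x
    using avg_cmult[of "1 / \<epsilon>"] by simp
  have *: "avg (\<lambda>z. hit z y / \<epsilon>) x + of_bool (x = y) \<le> hit x y / \<epsilon>" if "x \<in> V" for x
  proof (cases "x = y")
    case True
    have "avg (\<lambda>z. hit z y) y / \<epsilon> + 1 \<le> 1 / \<epsilon>"
      using esc \<open>0 < \<epsilon>\<close> by (simp add: divide_simps)
    then show ?thesis using True unfolding eq by simp
  next
    case False
    then show ?thesis using avg_hit_le[OF that, of y] \<open>0 < \<epsilon>\<close> unfolding eq
      by (simp add: divide_right_mono)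
  qed
  show "summable (\<lambda>k. step_prob V P k x y)" "green V P x y \<le> hit x y / \<epsilon>"
    using green_bound[of "\<lambda>z. hit z y / \<epsilon>", OF * _ \<open>x \<in> V\<close>] \<open>0 < \<epsilon>\<close> hit_nonneg
    by auto
qed

text \<open>Splitting off the last step instead of the first one makes time reversal visible; the finite set
  \<open>B\<close> contains all states from which \<open>y\<close> is reached in one step.\<close>

lemma step_prob_Suc_right:
  assumes "x \<in> V" "y \<in> V" "finite B" "B \<subseteq> V" "\<And>z. z \<in> V \<Longrightarrow> y \<in> nb z \<Longrightarrow> z \<in> B"
  shows "step_prob V P (Suc k) x y = (\<Sum>z\<in>B. step_prob V P k x z * P z y)"
  using assms(1)
proof (induction k arbitrary: x)
  case 0
  have "step_prob V P (Suc 0) x y = P x y"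
    using 0 assms P_eq_0[of x y] finite_nb[OF 0]
    by (auto simp: step_prob_Suc avg_def if_distrib[of "\<lambda>t. _ * t"] sum.delta cong: if_cong)
  moreover have "(\<Sum>z\<in>B. step_prob V P 0 x z * P z y) = (\<Sum>z\<in>B. if x = z then P z y else 0)"
    by (intro sum.cong) auto
  ultimately show ?case
    using 0 assms P_eq_0[of x y] by (auto simp: sum.delta)
next
  case (Suc k)
  have "step_prob V P (Suc (Suc k)) x y
      = (\<Sum>w\<in>nb x. P x w * (\<Sum>z\<in>B. step_prob V P k w z * P z y))"
    using Suc nb_in[OF _ Suc.prems] by (subst step_prob_Suc) (auto simp: avg_def intro!: sum.cong)
  also have "\<dots> = (\<Sum>z\<in>B. (\<Sum>w\<in>nb x. P x w * step_prob V P k w z) * P z y)"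
    by (simp add: sum_distrib_left sum_distrib_right mult.assoc) (rule sum.swap)
  finally show ?case using Suc.prems by (simp add: step_prob_Suc avg_def)
qed

lemma green_reversible:
  assumes rev: "\<And>x y. x \<in> V \<Longrightarrow> y \<in> V \<Longrightarrow> m x * P x y = m y * P y x"
    and sym: "\<And>x y. x \<in> V \<Longrightarrow> y \<in> V \<Longrightarrow> x \<in> nb y \<Longrightarrow> y \<in> nb x"
    and "x \<in> V" "y \<in> V"
    and "\<And>z w. z \<in> V \<Longrightarrow> w \<in> V \<Longrightarrow> summable (\<lambda>k. step_prob V P k z w)"
  shows "m x * green V P x y = m y * green V P y x"
proof -
  have "m x * step_prob V P k x y = m y * step_prob V P k y x" if "x \<in> V" "y \<in> V" for k x y
    using that
  proof (induction k arbitrary: x y)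
    case (Suc k)
    have "m x * step_prob V P (Suc k) x y = (\<Sum>z\<in>nb x. m x * P x z * step_prob V P k z y)"
      using Suc.prems by (simp add: step_prob_Suc avg_def sum_distrib_left mult_ac)
    also have "\<dots> = (\<Sum>z\<in>nb x. m y * (step_prob V P k y z * P z x))"
    proof (rule sum.cong)
      fix z assume z: "z \<in> nb x"
      then have zV: "z \<in> V" using Suc.prems nb_in by blast
      show "m x * P x z * step_prob V P k z y = m y * (step_prob V P k y z * P z x)"
        using Suc.IH[OF zV Suc.prems(2)] rev[OF Suc.prems(1) zV] by (simp add: mult_ac)
    qed simp
    also have "\<dots> = m y * (\<Sum>z\<in>nb x. step_prob V P k y z * P z x)"
      by (simp add: sum_distrib_left)
    also have "\<dots> = m y * step_prob V P (Suc k) y x"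
      using Suc.prems sym finite_nb nb_subset by (subst step_prob_Suc_right[where B = "nb x"]) auto
    finally show ?case .
  qed auto
  then show ?thesis
    unfolding green_def using assms by (simp flip: suminf_mult)
qed

subsection \<open>Identification with a given Markov chain\<close>

text \<open>Only finitely many paths of a given length have positive probability, so the law of an initial
  segment of the chain reduces to finite sums over paths.\<close>

primrec paths :: "nat \<Rightarrow> 'v \<Rightarrow> 'v list set" where
  "paths 0 x = {[]}"
| "paths (Suc n) x = (\<Union>z\<in>nb x. Cons z ` paths n z)"

primrec path_prob :: "'v \<Rightarrow> 'v list \<Rightarrow> real" where
  "path_prob x [] = 1"
| "path_prob x (z # zs) = P x z * path_prob z zs"

lemma finite_paths: "x \<in> V \<Longrightarrow> finite (paths n x)"
  by (induction n arbitrary: x) (auto intro: finite_nb dest: nb_in)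

lemma paths_props: "x \<in> V \<Longrightarrow> zs \<in> paths n x \<Longrightarrow> length zs = n \<and> set zs \<subseteq> V"
proof (induction n arbitrary: x zs)
  case (Suc n)
  then obtain z zs' where "z \<in> nb x" "zs = z # zs'" "zs' \<in> paths n z" by auto
  then show ?case using Suc.IH[of z zs'] nb_in[OF _ Suc.prems(1)] by auto
qed auto

lemma sum_paths_Suc:
  assumes "x \<in> V"
  shows "(\<Sum>zs\<in>paths (Suc n) x. f zs) = (\<Sum>z\<in>nb x. \<Sum>zs\<in>paths n z. f (z # zs))"
proof -
  have "(\<Sum>zs\<in>paths (Suc n) x. f zs) = (\<Sum>z\<in>nb x. \<Sum>zs\<in>Cons z ` paths n z. f zs)"
    unfolding paths.simps using assms finite_nb finite_paths
    by (intro sum.UNION_disjoint) (auto dest: nb_in)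
  also have "\<dots> = (\<Sum>z\<in>nb x. \<Sum>zs\<in>paths n z. f (z # zs))"
    by (simp add: sum.reindex)
  finally show ?thesis .
qed

lemma sum_path_prob: "x \<in> V \<Longrightarrow> (\<Sum>zs\<in>paths n x. path_prob x zs) = 1"
proof (induction n arbitrary: x)
  case (Suc n)
  then show ?case
    using nb_in[of _ x] by (simp add: sum_paths_Suc P_sum flip: sum_distrib_left del: paths.simps)
qed auto

lemma hit_by_eq_sum_paths:
  "x \<in> V \<Longrightarrow> hit_by n y x = (\<Sum>zs\<in>paths n x. of_bool (y \<in> set (x # zs)) * path_prob x zs)"
proof (induction n arbitrary: x)
  case (Suc n)
  show ?case
  proof (cases "x = y")
    case True
    then show ?thesis using sum_path_prob[OF Suc.prems, of "Suc n"] by (simp del: paths.simps)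
  next
    case False
    then have "hit_by (Suc n) y x = (\<Sum>z\<in>nb x. P x z *
        (\<Sum>zs\<in>paths n z. of_bool (y \<in> set (z # zs)) * path_prob z zs))"
      using Suc nb_in by (simp add: avg_def)
    also have "\<dots> = (\<Sum>zs\<in>paths (Suc n) x. of_bool (y \<in> set (x # zs)) * path_prob x zs)"
      using False Suc.prems
      by (auto simp: sum_paths_Suc sum_distrib_left simp del: paths.simps intro!: sum.cong)
    finally show ?thesis .
  qed
qed auto

lemma path_prob_snoc: "path_prob x (zs @ [z]) = path_prob x zs * P (last (x # zs)) z"
  by (induction zs arbitrary: x) (auto simp: mult_ac)

lemma markov_chain_path_prob:
  assumes "markov_chain_from V P M Z x" "x \<in> V" "set zs \<subseteq> V"
  shows "\<P>(\<omega> in M. \<forall>i\<le>length zs. Z i \<omega> = (x # zs) ! i) = path_prob x zs"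
  using assms(3)
proof (induction zs rule: rev_induct)
  case Nil
  then show ?case using assms by (simp add: markov_chain_from_def)
next
  case (snoc z zs)
  let ?w = "\<lambda>i. (x # zs @ [z]) ! i"
  have inV: "?w i \<in> V" if "i \<le> Suc (length zs)" for i
  proof -
    have "?w i \<in> set (x # zs @ [z])" using that by (intro nth_mem) auto
    then show ?thesis using snoc.prems assms(2) by auto
  qed
  then have "\<P>(\<omega> in M. \<forall>i\<le>Suc (length zs). Z i \<omega> = ?w i)
      = \<P>(\<omega> in M. \<forall>i\<le>length zs. Z i \<omega> = ?w i) * P (?w (length zs)) (?w (Suc (length zs)))"
    using assms(1) unfolding markov_chain_from_def by blast
  moreover have "?w i = (x # zs) ! i" if "i \<le> length zs" for i
    using that by (auto simp: nth_append nth_Cons split: nat.splits)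
  moreover have "(x # zs) ! length zs = last (x # zs)"
    by (simp add: last_conv_nth)
  ultimately show ?case
    using snoc by (auto simp: path_prob_snoc)
qed

lemma hitting_prob_eq_hit:
  assumes mc: "markov_chain_from V P (M x) Z x" and "x \<in> V" "y \<in> V"
  shows "hitting_prob M Z x y = hit x y"
proof -
  interpret prob_space "M x" using mc by (simp add: markov_chain_from_def)
  have meas: "Z n \<in> measurable (M x) (count_space V)" for n
    using mc by (simp add: markov_chain_from_def)
  have ev: "{\<omega> \<in> space (M x). Z n \<omega> = z} \<in> events" if "z \<in> V" for n z
  proof -
    have "{\<omega> \<in> space (M x). Z n \<omega> = z} = Z n -` {z} \<inter> space (M x)" by auto
    then show ?thesis using measurable_sets[OF meas, of "{z}"] that by simp
  qed
  define B where "B N = {\<omega> \<in> space (M x). \<exists>n\<le>N. Z n \<omega> = y}" for N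
  have Bev: "B N \<in> events" for N
  proof -
    have "B N = (\<Union>n\<le>N. {\<omega> \<in> space (M x). Z n \<omega> = y})" by (auto simp: B_def)
    then show ?thesis using ev[OF \<open>y \<in> V\<close>] by auto
  qed
  have prob_B: "prob (B N) = hit_by N y x" for N
  proof -
    define T where "T zs = {\<omega> \<in> space (M x). \<forall>i\<le>length zs. Z i \<omega> = (x # zs) ! i}" for zs
    have Tev: "T zs \<in> events" if "set zs \<subseteq> V" for zs
    proof -
      have "(x # zs) ! i \<in> V" if "i \<le> length zs" for i
        using nth_mem[of i "x # zs"] that \<open>set zs \<subseteq> V\<close> \<open>x \<in> V\<close> by auto
      moreover have "T zs = (\<Inter>i\<le>length zs. {\<omega> \<in> space (M x). Z i \<omega> = (x # zs) ! i})"
        by (auto simp: T_def)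
      ultimately show ?thesis using ev by (auto intro!: sets.finite_INT)
    qed
    have Tprob: "prob (T zs) = path_prob x zs" if "set zs \<subseteq> V" for zs
      using markov_chain_path_prob[OF mc \<open>x \<in> V\<close> that] by (simp add: T_def)
    have Tdisj: "T zs \<inter> T zs' = {}" if ne: "length zs = N" "length zs' = N" "zs \<noteq> zs'" for zs zs'
    proof -
      obtain i where "i < N" "zs ! i \<noteq> zs' ! i"
        using ne by (metis nth_equalityI)
      then have "Suc i \<le> N" "(x # zs) ! Suc i \<noteq> (x # zs') ! Suc i" by auto
      then show ?thesis using that unfolding T_def by fastforce
    qed
    have sum_T: "prob (\<Union>zs\<in>A. T zs) = (\<Sum>zs\<in>A. path_prob x zs)" if "A \<subseteq> paths N x" for A
    proof -
      have A: "length zs = N" "set zs \<subseteq> V" if "zs \<in> A" for zs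
        using that \<open>A \<subseteq> paths N x\<close> paths_props[OF \<open>x \<in> V\<close>, of zs N] by auto
      have "disjoint_family_on T A"
        unfolding disjoint_family_on_def using A Tdisj by blast
      then have "prob (\<Union>zs\<in>A. T zs) = (\<Sum>zs\<in>A. prob (T zs))"
        using finite_subset[OF that finite_paths[OF \<open>x \<in> V\<close>]] A(2) Tev
        by (intro finite_measure_finite_Union) blast+
      also have "\<dots> = (\<Sum>zs\<in>A. path_prob x zs)"
        using A(2) Tprob by (intro sum.cong) auto
      finally show ?thesis .
    qed
    define A where "A = {zs \<in> paths N x. y \<in> set (x # zs)}"
    \<comment> \<open>The paths through \<open>y\<close> and the other ones have total mass \<open>1\<close>, so the lower bounds for the
      probabilities of the two complementary events are equalities.\<close>
    have sums: "(\<Sum>zs\<in>A. path_prob x zs) + (\<Sum>zs\<in>paths N x - A. path_prob x zs) = 1"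
      using sum.subset_diff[of A "paths N x" "path_prob x"] finite_paths[OF \<open>x \<in> V\<close>]
        sum_path_prob[OF \<open>x \<in> V\<close>, of N] by (auto simp: A_def)
    have "(\<Union>zs\<in>A. T zs) \<subseteq> B N"
    proof
      fix \<omega> assume "\<omega> \<in> (\<Union>zs\<in>A. T zs)"
      then obtain zs where zs: "zs \<in> A" "\<omega> \<in> T zs" by blast
      then obtain i where "i < length (x # zs)" "(x # zs) ! i = y"
        using in_set_conv_nth[of y "x # zs"] by (auto simp: A_def)
      then show "\<omega> \<in> B N"
        using zs paths_props[OF \<open>x \<in> V\<close>, of zs N] unfolding A_def T_def B_def
        by (auto simp: less_Suc_eq_le simp del: nth_Cons)
    qed
    then have 1: "(\<Sum>zs\<in>A. path_prob x zs) \<le> prob (B N)"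
      using Bev sum_T[of A] finite_measure_mono[of "\<Union>zs\<in>A. T zs" "B N"] by (auto simp: A_def)
    have "(\<Union>zs\<in>paths N x - A. T zs) \<subseteq> space (M x) - B N"
    proof
      fix \<omega> assume "\<omega> \<in> (\<Union>zs\<in>paths N x - A. T zs)"
      then obtain zs where zs: "zs \<in> paths N x - A" "\<omega> \<in> T zs" by blast
      then have "(x # zs) ! i \<noteq> y" if "i \<le> N" for i
        using that paths_props[OF \<open>x \<in> V\<close>, of zs N] nth_mem[of i "x # zs"] by (auto simp: A_def)
      then show "\<omega> \<in> space (M x) - B N"
        using zs paths_props[OF \<open>x \<in> V\<close>, of zs N] by (auto simp: T_def B_def)
    qed
    then have 2: "(\<Sum>zs\<in>paths N x - A. path_prob x zs) \<le> 1 - prob (B N)"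
      using Bev sum_T[of "paths N x - A"] prob_compl[OF Bev]
        finite_measure_mono[of "\<Union>zs\<in>paths N x - A. T zs" "space (M x) - B N"] by auto
    have "hit_by N y x = (\<Sum>zs\<in>paths N x. if y \<in> set (x # zs) then path_prob x zs else 0)"
      unfolding hit_by_eq_sum_paths[OF \<open>x \<in> V\<close>] by (intro sum.cong) auto
    also have "\<dots> = (\<Sum>zs\<in>A. path_prob x zs)"
      unfolding A_def by (rule sum.inter_filter[symmetric]) (rule finite_paths[OF \<open>x \<in> V\<close>])
    finally show ?thesis using 1 2 sums by linarith
  qed
  have "(\<lambda>N. prob (B N)) \<longlonglongrightarrow> prob (\<Union>N. B N)"
  proof (rule finite_Lim_measure_incseq)
    show "incseq B"
      by (rule incseq_SucI) (auto simp: B_def intro: le_SucI)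
  qed (use Bev in blast)
  moreover have "(\<Union>N. B N) = {\<omega> \<in> space (M x). \<exists>n. Z n \<omega> = y}"
    by (auto simp: B_def)
  ultimately show ?thesis
    using LIMSEQ_unique[OF hit_by_tendsto[OF \<open>x \<in> V\<close>, of y]] by (simp add: hitting_prob_def prob_B)
qed

end

section \<open>Random walks on a graded graph with a constant return ratio\<close>

text \<open>
  The properties of the augmented tree and of its conductances on which the estimates rest. The vertices
  carry a level, a parent and a position in a metric space; an edge at level \<open>n\<close> moves the position by
  \<open>O(r\<^sup>n)\<close>. Conversely, \<open>link\<close> says that vertices whose positions differ by at most \<^term>\<open>gam * r ^ l\<close> have
  equal or adjacent ancestors at level \<open>l\<close>. The constant return ratio is \<open>c_children\<close>, and \<open>c_peers\<close>
  and \<open>c_peer\<close> bound the horizontal conductances in terms of the conductance to the parent.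
\<close>

locale graded_walk =
  fixes V :: "'v::countable set" and root :: 'v and lev :: "'v \<Rightarrow> nat" and par :: "'v \<Rightarrow> 'v"
    and E :: "('v \<times> 'v) set" and pos :: "'v \<Rightarrow> 'a::metric_space" and c :: "'v \<Rightarrow> 'v \<Rightarrow> real"
    and r lam al gam L w1 w2 eta H :: real
  assumes r: "0 < r" "r < 1" and lam: "0 < lam" "lam < 1" and al: "0 < al" and gam: "0 < gam"
    and L: "0 < L" and w1: "0 < w1" and eta: "0 < eta" and H: "0 \<le> H"
    and finite_level: "finite {x \<in> V. lev x = n}"
    and root_in: "root \<in> V" and lev_root [simp]: "lev root = 0"
    and lev_0: "x \<in> V \<Longrightarrow> lev x = 0 \<Longrightarrow> x = root"
    and par_in: "x \<in> V \<Longrightarrow> x \<noteq> root \<Longrightarrow> par x \<in> V"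
    and lev_par: "x \<in> V \<Longrightarrow> x \<noteq> root \<Longrightarrow> lev x = Suc (lev (par x))"
    and E_subset: "E \<subseteq> V \<times> V" and E_sym: "(x, y) \<in> E \<Longrightarrow> (y, x) \<in> E"
    and E_par: "x \<in> V \<Longrightarrow> x \<noteq> root \<Longrightarrow> (x, par x) \<in> E"
    and E_cases: "(x, y) \<in> E \<Longrightarrow>
      (x \<noteq> root \<and> y = par x) \<or> (y \<noteq> root \<and> x = par y) \<or> (x \<noteq> y \<and> lev x = lev y)"
    and E_pos: "(x, y) \<in> E \<Longrightarrow> dist (pos x) (pos y) \<le> L * r ^ lev x"
    and link: "x \<in> V \<Longrightarrow> y \<in> V \<Longrightarrow> i \<le> lev x \<Longrightarrow> j \<le> lev y \<Longrightarrow> lev x - i = lev y - j \<Longrightarrow>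
      dist (pos x) (pos y) \<le> gam * r ^ (lev x - i) \<Longrightarrow>
      (par ^^ i) x = (par ^^ j) y \<or> ((par ^^ i) x, (par ^^ j) y) \<in> E"
    and c_sym: "x \<in> V \<Longrightarrow> y \<in> V \<Longrightarrow> c x y = c y x"
    and c_nonneg: "x \<in> V \<Longrightarrow> y \<in> V \<Longrightarrow> 0 \<le> c x y"
    and c_off: "x \<in> V \<Longrightarrow> y \<in> V \<Longrightarrow> (x, y) \<notin> E \<Longrightarrow> c x y = 0"
    and c_par: "x \<in> V \<Longrightarrow> x \<noteq> root \<Longrightarrow> w1 * (r powr al / lam) ^ lev x \<le> c x (par x) \<and>
      c x (par x) \<le> w2 * (r powr al / lam) ^ lev x"
    and c_children: "x \<in> V \<Longrightarrow> x \<noteq> root \<Longrightarrow>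
      (\<Sum>y\<in>{y\<in>V. y \<noteq> root \<and> par y = x}. c x y) = c x (par x) / lam"
    and c_root: "0 < (\<Sum>y\<in>{y\<in>V. y \<noteq> root \<and> par y = root}. c root y)"
    and c_peers: "x \<in> V \<Longrightarrow> x \<noteq> root \<Longrightarrow>
      (\<Sum>y\<in>{y. (x, y) \<in> E \<and> lev y = lev x}. c x y) \<le> H * c x (par x)"
    and c_peer: "(x, y) \<in> E \<Longrightarrow> lev x = lev y \<Longrightarrow> eta * c x (par x) \<le> c x y"
begin

definition nbrs :: "'v \<Rightarrow> 'v set" where "nbrs x = {y. (x, y) \<in> E}"
definition children :: "'v \<Rightarrow> 'v set" where "children x = {y \<in> V. y \<noteq> root \<and> par y = x}"
definition peers :: "'v \<Rightarrow> 'v set" where "peers x = {y. (x, y) \<in> E \<and> lev y = lev x}"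
definition mass :: "'v \<Rightarrow> real" where "mass x = (\<Sum>y\<in>nbrs x. c x y)"
definition prob :: "'v \<Rightarrow> 'v \<Rightarrow> real" where "prob = transition_prob V c"
definition up :: "'v \<Rightarrow> real" where "up x = prob x (par x)"
definition ra :: real where "ra = r powr al"

text \<open>The total conductance of a vertex is of order \<open>\<theta> ^ lev x\<close>.\<close>

definition \<theta> :: real where "\<theta> = ra / lam"

text \<open>A lower bound for the probability of stepping to the parent.\<close>

definition p0 :: real where "p0 = 1 / (1 + 1 / lam + H)"

lemma ra: "0 < ra" "ra < 1"
  using r al powr_less_mono2[of al r 1] by (auto simp: ra_def)

lemma \<theta>: "0 < \<theta>"
  using ra lam by (simp add: \<theta>_def)

lemma p0: "0 < p0" "p0 < lam" "p0 < 1"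
proof -
  have *: "1 / lam < 1 + 1 / lam + H" "0 < 1 / lam" using H lam by auto
  then show "0 < p0" unfolding p0_def by (intro divide_pos_pos) linarith+
  show "p0 < lam" using * lam H unfolding p0_def by (simp add: field_simps add_pos_nonneg)
  then show "p0 < 1" using lam by simp
qed

lemma c_par': "x \<in> V \<Longrightarrow> x \<noteq> root \<Longrightarrow> w1 * \<theta> ^ lev x \<le> c x (par x) \<and> c x (par x) \<le> w2 * \<theta> ^ lev x"
  using c_par[of x] by (simp add: \<theta>_def ra_def)

lemma c_par_pos: "x \<in> V \<Longrightarrow> x \<noteq> root \<Longrightarrow> 0 < c x (par x)"
  using c_par'[of x] w1 \<theta> by (smt (verit) zero_less_mult_iff zero_less_power)

lemma nbrs_in: "y \<in> nbrs x \<Longrightarrow> y \<in> V"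
  using E_subset unfolding nbrs_def by blast

lemma nbrs_lev: "x \<in> V \<Longrightarrow> y \<in> nbrs x \<Longrightarrow> y \<in> V \<and> lev y \<le> Suc (lev x) \<and> lev x \<le> Suc (lev y)"
  using nbrs_in[of y x] E_cases[of x y] lev_par[of x] lev_par[of y] unfolding nbrs_def by auto

lemma finite_le_level: "finite {x \<in> V. lev x \<le> n}"
proof -
  have "{x \<in> V. lev x \<le> n} = (\<Union>k\<le>n. {x \<in> V. lev x = k})" by auto
  then show ?thesis using finite_level by simp
qed

lemma finite_nbrs: "x \<in> V \<Longrightarrow> finite (nbrs x)"
  using nbrs_lev by (intro finite_subset[OF _ finite_le_level[of "Suc (lev x)"]]) blast

lemma lev_children: "y \<in> children x \<Longrightarrow> lev y = Suc (lev x)"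
  using lev_par[of y] unfolding children_def by auto

lemma children_nbrs: "children x \<subseteq> nbrs x"
  using E_par E_sym unfolding children_def nbrs_def by blast

lemma nbrs_eq: "x \<in> V \<Longrightarrow> x \<noteq> root \<Longrightarrow> nbrs x = insert (par x) (children x \<union> peers x)"
proof (intro equalityI subsetI)
  fix y assume x: "x \<in> V" "x \<noteq> root" and y: "y \<in> nbrs x"
  then show "y \<in> insert (par x) (children x \<union> peers x)"
    using E_cases[of x y] nbrs_in[OF y] unfolding nbrs_def peers_def children_def by auto
next
  fix y assume x: "x \<in> V" "x \<noteq> root" and y: "y \<in> insert (par x) (children x \<union> peers x)"
  then show "y \<in> nbrs x"
    using E_par[OF x] children_nbrs[of x] unfolding nbrs_def peers_def by auto
qed

lemma nbrs_root: "nbrs root = children root"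
proof -
  have "y \<in> children root" if "(root, y) \<in> E" for y
    using E_cases[OF that] lev_0[of y] E_subset that unfolding children_def by auto
  then show ?thesis using children_nbrs[of root] unfolding nbrs_def by blast
qed

lemma sum_nbrs:
  assumes x: "x \<in> V" "x \<noteq> root"
  shows "(\<Sum>y\<in>nbrs x. f y) = f (par x) + (\<Sum>y\<in>children x. f y) + (\<Sum>y\<in>peers x. f y :: real)"
proof -
  have "finite (children x \<union> peers x)"
    using finite_nbrs[OF x(1)] nbrs_eq[OF x] by simp
  moreover have "par x \<notin> children x \<union> peers x" "children x \<inter> peers x = {}"
    using lev_par[OF x] lev_children[of _ x] unfolding peers_def by fastforce+
  ultimately show ?thesis
    unfolding nbrs_eq[OF x] by (simp add: sum.union_disjoint)
qed

lemma mass_bounds':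
  assumes x: "x \<in> V" "x \<noteq> root"
  shows "c x (par x) * (1 + 1 / lam) \<le> mass x" "mass x \<le> c x (par x) * (1 + 1 / lam + H)"
proof -
  have "mass x = c x (par x) + c x (par x) / lam + (\<Sum>y\<in>peers x. c x y)"
    unfolding mass_def sum_nbrs[OF x] using c_children[OF x] by (simp add: children_def)
  moreover have "0 \<le> (\<Sum>y\<in>peers x. c x y)"
    using c_nonneg x E_subset unfolding peers_def by (intro sum_nonneg) auto
  ultimately show "c x (par x) * (1 + 1 / lam) \<le> mass x" "mass x \<le> c x (par x) * (1 + 1 / lam + H)"
    using c_peers[OF x] by (auto simp: peers_def algebra_simps)
qed

lemma mass_pos: assumes x: "x \<in> V" shows "0 < mass x"
proof (cases "x = root")
  case True
  then show ?thesis using c_root nbrs_root unfolding mass_def children_def by simp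
next
  case False
  have "0 < c x (par x) * (1 + 1 / lam)"
    using c_par_pos[OF x False] lam by (simp add: add_pos_pos)
  then show ?thesis using mass_bounds'[OF x False] by linarith
qed

lemma prob_eq: assumes x: "x \<in> V" shows "prob x y = c x y / mass x"
proof -
  have "(\<Sum>\<^sub>\<infinity>z\<in>V. c x z) = (\<Sum>\<^sub>\<infinity>z\<in>nbrs x. c x z)"
    using x nbrs_in c_off by (intro infsum_cong_neutral) (auto simp: nbrs_def)
  then show ?thesis
    using finite_nbrs[OF x] by (simp add: prob_def transition_prob_def mass_def)
qed

lemma mass_bounds:
  obtains m1 m2 where "0 < m1" "0 < m2" "\<And>x. x \<in> V \<Longrightarrow> m1 * \<theta> ^ lev x \<le> mass x"
    "\<And>x. x \<in> V \<Longrightarrow> mass x \<le> m2 * \<theta> ^ lev x"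
proof
  let ?m1 = "min (mass root) w1" and ?m2 = "max (mass root) (w2 * (1 + 1 / lam + H))"
  show "0 < ?m1" "0 < ?m2" using mass_pos[OF root_in] w1 by auto
  fix x assume x: "x \<in> V"
  show "?m1 * \<theta> ^ lev x \<le> mass x"
  proof (cases "x = root")
    case False
    have "?m1 * \<theta> ^ lev x \<le> w1 * \<theta> ^ lev x" using \<theta> by (intro mult_right_mono) auto
    also have "\<dots> \<le> c x (par x)" using c_par'[OF x False] by simp
    also have "\<dots> \<le> c x (par x) * (1 + 1 / lam)" using c_par_pos[OF x False] lam by simp
    finally show ?thesis using mass_bounds'[OF x False] by linarith
  qed auto
  show "mass x \<le> ?m2 * \<theta> ^ lev x"
  proof (cases "x = root")
    case False
    have "mass x \<le> c x (par x) * (1 + 1 / lam + H)" using mass_bounds'[OF x False] by simp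
    also have "\<dots> \<le> w2 * \<theta> ^ lev x * (1 + 1 / lam + H)"
      using c_par'[OF x False] H lam by (intro mult_right_mono) auto
    also have "\<dots> = (w2 * (1 + 1 / lam + H)) * \<theta> ^ lev x" by simp
    also have "\<dots> \<le> ?m2 * \<theta> ^ lev x" using \<theta> by (intro mult_right_mono) auto
    finally show ?thesis .
  qed auto
qed

sublocale finite_range_chain V prob nbrs
proof
  fix x assume x: "x \<in> V"
  show "finite (nbrs x)" "nbrs x \<subseteq> V" using x finite_nbrs nbrs_lev by auto
  show "(\<Sum>z\<in>nbrs x. prob x z) = 1"
    using mass_pos[OF x] by (simp add: prob_eq[OF x] mass_def flip: sum_divide_distrib)
  fix z assume "z \<in> V"
  then show "0 \<le> prob x z" "z \<notin> nbrs x \<Longrightarrow> prob x z = 0"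
    using x mass_pos[OF x] by (auto simp: prob_eq c_nonneg c_off nbrs_def)
qed

lemma up_bounds:
  assumes x: "x \<in> V" "x \<noteq> root"
  shows "p0 \<le> up x" "up x + up x / lam \<le> 1"
proof -
  have "mass x * p0 \<le> c x (par x)"
    using mass_bounds'[OF x] H lam by (auto simp: p0_def field_simps add_pos_nonneg)
  then show "p0 \<le> up x"
    using mass_pos[OF x(1)] by (simp add: up_def prob_eq[OF x(1)] field_simps)
  show "up x + up x / lam \<le> 1"
    using mass_bounds'[OF x] mass_pos[OF x(1)] lam by (simp add: up_def prob_eq[OF x(1)] field_simps)
qed

text \<open>One step of the walk: it moves to the parent with probability \<^term>\<open>up x\<close>, to a child with
  probability \<^term>\<open>up x / lam\<close>, and otherwise stays in the level.\<close>

lemma avg_le: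
  assumes x: "x \<in> V" "x \<noteq> root" and "f (par x) \<le> a" "\<And>y. y \<in> children x \<Longrightarrow> f y \<le> b"
    "\<And>y. y \<in> peers x \<Longrightarrow> f y \<le> d"
  shows "avg f x \<le> up x * a + up x / lam * b + (1 - up x - up x / lam) * d"
proof -
  have sub: "children x \<subseteq> V" "peers x \<subseteq> V" using E_subset unfolding children_def peers_def by auto
  have ch: "(\<Sum>y\<in>children x. prob x y) = up x / lam"
    unfolding up_def prob_eq[OF x(1)] using c_children[OF x] by (simp add: children_def flip: sum_divide_distrib)
  have pe: "(\<Sum>y\<in>peers x. prob x y) = 1 - up x - up x / lam"
    using P_sum[OF x(1)] ch unfolding sum_nbrs[OF x] up_def by linarith
  have "avg f x = up x * f (par x) + (\<Sum>y\<in>children x. prob x y * f y) + (\<Sum>y\<in>peers x. prob x y * f y)"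
    unfolding avg_def sum_nbrs[OF x] up_def ..
  also have "\<dots> \<le> up x * a + (\<Sum>y\<in>children x. prob x y * b) + (\<Sum>y\<in>peers x. prob x y * d)"
    using assms sub up_bounds[OF x] p0
    by (intro add_mono mult_left_mono sum_mono P_nonneg) auto
  finally show ?thesis by (simp add: ch pe flip: sum_distrib_right)
qed

lemma avg_root_le:
  assumes "\<And>y. y \<in> children root \<Longrightarrow> f y \<le> b"
  shows "avg f root \<le> b"
  using avg_mono[of root f "\<lambda>_. b"] avg_const[of root b] root_in assms nbrs_root by simp

subsection \<open>The level process\<close>

lemma avg_lam_lev: assumes x: "x \<in> V" "x \<noteq> root" shows "avg (\<lambda>z. lam ^ lev z) x = lam ^ lev x"
proof -
  let ?l = "lam ^ lev x"
  have 1: "lam ^ lev (par x) = ?l / lam" using lev_par[OF x] lam by simp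
  have 2: "lam ^ lev y = lam * ?l" if "y \<in> children x" for y using lev_children[OF that] by simp
  have 3: "lam ^ lev y = ?l" if "y \<in> peers x" for y using that by (simp add: peers_def)
  have "avg (\<lambda>z. lam ^ lev z) x \<le> up x * (?l / lam) + up x / lam * (lam * ?l) + (1 - up x - up x / lam) * ?l"
    using 1 2 3 by (intro avg_le[OF x]) auto
  moreover have "avg (\<lambda>z. - (lam ^ lev z)) x \<le>
      up x * (- (?l / lam)) + up x / lam * (- (lam * ?l)) + (1 - up x - up x / lam) * (- ?l)"
    using 1 2 3 by (intro avg_le[OF x]) auto
  moreover have "avg (\<lambda>z. - (lam ^ lev z)) x = - avg (\<lambda>z. lam ^ lev z) x"
    using avg_cmult[of "-1"] by simp
  ultimately show ?thesis using lam by (simp add: algebra_simps)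
qed

lemma avg_lam_lev_le: assumes x: "x \<in> V" shows "avg (\<lambda>z. lam ^ lev z) x \<le> lam ^ lev x"
proof (cases "x = root")
  case True
  have "lam ^ lev y \<le> 1" for y using lam by (simp add: power_le_one)
  then show ?thesis using avg_root_le[of "\<lambda>z. lam ^ lev z" 1] True by simp
qed (use avg_lam_lev x in auto)

lemma hit_lam: assumes "x \<in> V" "y \<in> V" shows "hit x y * lam ^ lev y \<le> lam ^ lev x"
  using lam assms by (intro hit_mult_le_superharmonic avg_lam_lev_le) auto

text \<open>From \<open>y\<close> the walk steps to a child with probability at least \<^term>\<open>p0\<close>, and from there it
  returns to the level of \<open>y\<close> with probability at most \<^term>\<open>lam\<close>.\<close>

lemma escape: assumes y: "y \<in> V" shows "avg (\<lambda>z. hit z y) y \<le> 1 - p0 * (1 - lam)"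
proof -
  have le: "hit z y \<le> lam" if "z \<in> children y" for z
  proof -
    have "hit z y * lam ^ lev y \<le> lam * lam ^ lev y"
      using hit_lam[of z y] lev_children[OF that] that y by (simp add: children_def)
    then show ?thesis using lam by simp
  qed
  show ?thesis
  proof (cases "y = root")
    case True
    have "p0 * (1 - lam) \<le> 1 * (1 - lam)" using p0 lam by (intro mult_right_mono) auto
    then show ?thesis using avg_root_le[of "\<lambda>z. hit z y" lam] le True by simp
  next
    case False
    have "avg (\<lambda>z. hit z y) y \<le> up y * 1 + up y / lam * lam + (1 - up y - up y / lam) * 1"
      using le y False par_in E_subset by (intro avg_le hit_le_1) (auto simp: peers_def)
    also have "\<dots> = 1 - up y / lam * (1 - lam)" using lam by (simp add: field_simps)
    also have "\<dots> \<le> 1 - p0 * (1 - lam)"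
    proof -
      have "p0 \<le> up y / 1" using up_bounds[OF y False] by simp
      also have "\<dots> \<le> up y / lam" using up_bounds[OF y False] p0 lam by (intro divide_left_mono) auto
      finally show ?thesis using lam mult_right_mono[of p0 "up y / lam" "1 - lam"] by simp
    qed
    finally show ?thesis .
  qed
qed

definition gr :: "'v \<Rightarrow> 'v \<Rightarrow> real" where "gr = green V prob"

lemma escape_pos: "0 < p0 * (1 - lam)"
  using p0 lam by simp

lemma summable_step_prob: "x \<in> V \<Longrightarrow> y \<in> V \<Longrightarrow> summable (\<lambda>k. step_prob V prob k x y)"
  using green_le_hit(1)[OF escape_pos escape] by blast

lemma gr_hit: assumes "x \<in> V" "y \<in> V"
  shows "hit x y \<le> gr x y" "gr x y \<le> hit x y / (p0 * (1 - lam))"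
  unfolding gr_def using assms
  by (auto intro!: hit_le_green green_le_hit(2)[OF escape_pos escape] intro: summable_step_prob)

lemma gr_eq: "x \<in> V \<Longrightarrow> y \<in> V \<Longrightarrow> gr x y = of_bool (x = y) + avg (\<lambda>z. gr z y) x"
  unfolding gr_def by (rule green_eq) (auto intro: summable_step_prob)

lemma gr_reversible: assumes "x \<in> V" "y \<in> V" shows "mass x * gr x y = mass y * gr y x"
  unfolding gr_def
proof (rule green_reversible)
  show "mass x * prob x y = mass y * prob y x" if "x \<in> V" "y \<in> V" for x y
    using that mass_pos[of x] mass_pos[of y] c_sym by (auto simp: prob_eq)
qed (use assms in \<open>auto simp: nbrs_def E_sym summable_step_prob\<close>)

text \<open>Reversibility turns estimates for going up into estimates for going down.\<close>

lemma hit_reverse: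
  obtains C where "0 < C" "\<And>x y. x \<in> V \<Longrightarrow> y \<in> V \<Longrightarrow> hit x y * \<theta> ^ lev x \<le> C * (hit y x * \<theta> ^ lev y)"
proof -
  obtain m1 m2 where m: "0 < m1" "0 < m2" and mass1: "\<And>x. x \<in> V \<Longrightarrow> m1 * \<theta> ^ lev x \<le> mass x"
    and mass2: "\<And>x. x \<in> V \<Longrightarrow> mass x \<le> m2 * \<theta> ^ lev x"
    using mass_bounds by blast
  define C where "C = m2 / (p0 * (1 - lam)) / m1"
  have "hit x y * \<theta> ^ lev x \<le> C * (hit y x * \<theta> ^ lev y)" if x: "x \<in> V" and y: "y \<in> V" for x y
  proof -
    have "m1 * (hit x y * \<theta> ^ lev x) = (m1 * \<theta> ^ lev x) * hit x y" by simp
    also have "\<dots> \<le> mass x * gr x y"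
      using x y gr_hit hit_nonneg mass1 m mass_pos[OF x] by (intro mult_mono) auto
    also have "\<dots> = mass y * gr y x" by (rule gr_reversible[OF x y])
    also have "\<dots> \<le> (m2 * \<theta> ^ lev y) * (hit y x / (p0 * (1 - lam)))"
      using x y gr_hit[OF y x] hit_nonneg[of y x] mass2[OF y] m mass_pos[OF y] \<theta> by (intro mult_mono) auto
    finally show ?thesis
      using m p0 lam by (simp add: C_def field_simps)
  qed
  moreover have "0 < C" using m p0 lam by (simp add: C_def)
  ultimately show ?thesis using that by blast
qed

text \<open>The reversed walk has to go from \<open>y\<close> to \<open>x\<close>, which costs the factor of \<open>hit_lam\<close>; together with the
  ratio of the total conductances this is a power of \<^term>\<open>ra = \<theta> * lam\<close>.\<close>

lemma hit_ra:
  obtains C where "0 < C" "\<And>x y. x \<in> V \<Longrightarrow> y \<in> V \<Longrightarrow> hit x y * ra ^ lev x \<le> C * ra ^ lev y"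
proof -
  obtain C where C: "0 < C" "\<And>x y. x \<in> V \<Longrightarrow> y \<in> V \<Longrightarrow> hit x y * \<theta> ^ lev x \<le> C * (hit y x * \<theta> ^ lev y)"
    using hit_reverse by blast
  have ra_eq: "ra = \<theta> * lam" using lam by (simp add: \<theta>_def)
  have "hit x y * ra ^ lev x \<le> C * ra ^ lev y" if xy: "x \<in> V" "y \<in> V" for x y
  proof -
    have "hit x y * ra ^ lev x = hit x y * \<theta> ^ lev x * lam ^ lev x"
      by (simp add: ra_eq power_mult_distrib)
    also have "\<dots> \<le> C * (hit y x * \<theta> ^ lev y) * lam ^ lev x"
      using C(2)[OF xy] lam by (intro mult_right_mono) auto
    also have "\<dots> = C * \<theta> ^ lev y * (hit y x * lam ^ lev x)" by simp
    also have "\<dots> \<le> C * \<theta> ^ lev y * lam ^ lev y"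
      using hit_lam[OF xy(2,1)] C \<theta> by (intro mult_left_mono) auto
    finally show ?thesis by (simp add: ra_eq power_mult_distrib mult.assoc)
  qed
  with C(1) show ?thesis using that by blast
qed

end

section \<open>A superharmonic function adapted to a point\<close>

text \<open>The one-step inequality for the function \<open>cone_fun\<close> below: \<open>t\<close> is the ratio of the scale
  \<open>r ^ lev x\<close> to \<open>a * r ^ lev x + dist (pos x) \<xi>\<close>, and \<open>p\<close> is the probability of stepping to the parent.
  To first order in \<open>t\<close>, a step up gains \<open>a * (1 / r - 1) / lam\<close>, a step down loses
  \<open>a * (1 - r)\<close>, and the displacement in a step costs at most a multiple of \<open>L\<close>. The difference of the first
  two is a positive multiple of \<open>a\<close>, so a large \<open>a\<close> outweighs the displacement; a small \<open>t0\<close> then takes care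
  of the higher order terms, uniformly in \<open>p\<close>.\<close>

lemma cone_inequality:
  fixes r lam s p0 L :: real
  assumes "0 < r" "r < 1" "0 < lam" "lam < 1" "0 < s" "0 < p0" "0 < L"
  obtains a t0 where "0 < a" "0 < t0"
    "\<And>t p. 0 < t \<Longrightarrow> t \<le> t0 \<Longrightarrow> p0 \<le> p \<Longrightarrow> p + p / lam \<le> 1 \<Longrightarrow>
      L * t < 1 \<and> (a * (1 - r) + L) * t < 1 \<and> 0 < 1 + (a * (1 / r - 1) - L) * t \<and>
      p / lam * (1 + (a * (1 / r - 1) - L) * t) powr (-s) + p * (1 - (a * (1 - r) + L) * t) powr (-s)
        + (1 - p - p / lam) * (1 - L * t) powr (-s) \<le> 1"
proof -
  define \<kappa> where "\<kappa> = (1 - r) * (1 / (lam * r) - 1)"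
  have "lam * r < 1" using assms by (metis less_eq_real_def mult_strict_mono mult_1 zero_less_one)
  then have \<kappa>: "0 < \<kappa>" using assms by (simp add: \<kappa>_def)
  \<comment> \<open>The first summand makes the gain beat the displacement, the second one makes \<open>A1\<close> nonnegative.\<close>
  define a where "a = (L / p0 + 1 + L / lam + L) / \<kappa> + L * r / (1 - r)"
  have a: "0 < a" "(L / p0 + 1 + L / lam + L) / \<kappa> \<le> a" "L * r / (1 - r) \<le> a"
    using assms \<kappa> by (auto simp: a_def add_pos_pos add_nonneg_nonneg)
  define A1 where "A1 = a * (1 / r - 1) - L"
  define A2 where "A2 = a * (1 - r) + L"
  have A1: "0 \<le> A1"
  proof -
    have "L * r \<le> a * (1 - r)" using a(3) assms by (simp add: pos_divide_le_eq)
    then have "L \<le> a * (1 - r) / r" using assms by (simp add: pos_le_divide_eq)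
    also have "a * (1 - r) / r = a * (1 / r - 1)" using assms(1) by (simp add: divide_simps)
    finally show ?thesis by (simp add: A1_def)
  qed
  have A2: "0 < A2" using a assms by (simp add: A2_def add_pos_pos)
  have "L / p0 + 1 + L / lam + L \<le> a * \<kappa>"
    using a(2) \<kappa> by (simp add: pos_divide_le_eq)
  moreover have "\<kappa> = (1 / r - 1) / lam - (1 - r)"
    using assms by (simp add: \<kappa>_def divide_simps) (simp add: algebra_simps)
  then have "a * \<kappa> = a * (1 / r - 1) / lam - a * (1 - r)"
    by (simp only: right_diff_distrib times_divide_eq_right)
  then have "A1 / lam - A2 = a * \<kappa> - L / lam - L"
    by (simp add: A1_def A2_def diff_divide_distrib)
  ultimately have gain: "L / p0 < A1 / lam - A2" by linarith
  define \<psi> where "\<psi> t = p0 * (1 / lam * (1 + A1 * t) powr (-s) + (1 - A2 * t) powr (-s) - (1 / lam + 1))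
      + ((1 - L * t) powr (-s) - 1)" for t
  have D: "(\<psi> has_real_derivative p0 * (1 / lam * (- s * A1) + s * A2) + s * L) (at 0)"
    unfolding \<psi>_def using assms by (auto intro!: derivative_eq_intros)
  have "p0 * (1 / lam * (- s * A1) + s * A2) + s * L = - (s * p0) * ((A1 / lam - A2) - L / p0)"
    using assms by (simp add: divide_simps) (simp add: algebra_simps)
  then have neg: "p0 * (1 / lam * (- s * A1) + s * A2) + s * L < 0"
    using gain assms by simp
  obtain d where d: "0 < d" "\<And>h. 0 < h \<Longrightarrow> h < d \<Longrightarrow> \<psi> h < \<psi> 0"
    using DERIV_neg_dec_right[OF D neg] unfolding add_0_left by blast
  define t0 where "t0 = min (d / 2) (min (1 / (2 * L)) (1 / (2 * A2)))"
  have t0: "0 < t0" "t0 < d" "t0 \<le> 1 / (2 * L)" "t0 \<le> 1 / (2 * A2)"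
    using d(1) assms A2 by (auto simp: t0_def)
  have *: "L * t < 1 \<and> A2 * t < 1 \<and> 0 < 1 + A1 * t \<and>
      p / lam * (1 + A1 * t) powr (-s) + p * (1 - A2 * t) powr (-s)
        + (1 - p - p / lam) * (1 - L * t) powr (-s) \<le> 1"
    if t: "0 < t" "t \<le> t0" and p: "p0 \<le> p" "p + p / lam \<le> 1" for t p
  proof -
    define U where "U = 1 / lam * (1 + A1 * t) powr (-s) + (1 - A2 * t) powr (-s) - (1 / lam + 1)"
    define W where "W = (1 - L * t) powr (-s) - 1"
    have "t \<le> 1 / (2 * L)" "t \<le> 1 / (2 * A2)" using t t0 by auto
    then have small: "L * t < 1" "A2 * t < 1"
      using assms A2 t by (auto simp: pos_le_divide_eq mult_ac)
    have pos: "0 < 1 + A1 * t" using A1 t by (simp add: add_pos_nonneg)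
    have "\<psi> t < \<psi> 0" using d(2) t t0 by auto
    moreover have "\<psi> 0 = 0" by (simp add: \<psi>_def)
    ultimately have \<psi>: "p0 * U + W \<le> 0" by (simp add: \<psi>_def U_def W_def)
    have "1 powr (-s) \<le> (1 - L * t) powr (-s)"
      using small assms t by (intro powr_mono2') auto
    then have W: "0 \<le> W" by (simp add: W_def)
    then have "p0 * U \<le> 0" using \<psi> by linarith
    then have "U \<le> 0" using assms by (simp add: mult_le_0_iff)
    then have "p * U \<le> p0 * U" using p by (simp add: mult_right_mono_neg)
    moreover have "(1 - p - p / lam) * W \<le> 1 * W"
    proof (rule mult_right_mono)
      have "0 < p" using p assms(6) by linarith
      then have "0 < p / lam" using assms(3) by simp
      then show "1 - p - p / lam \<le> 1" using \<open>0 < p\<close> by linarith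
    qed (rule W)
    ultimately have "p * U + (1 - p - p / lam) * W \<le> 0" using \<psi> by linarith
    moreover have "p / lam * (1 + A1 * t) powr (-s) + p * (1 - A2 * t) powr (-s)
        + (1 - p - p / lam) * (1 - L * t) powr (-s) = 1 + (p * U + (1 - p - p / lam) * W)"
      by (simp add: U_def W_def algebra_simps)
    ultimately show ?thesis using small pos by simp
  qed
  show ?thesis
    using that[OF a(1) t0(1)] * unfolding A1_def A2_def by blast
qed

context graded_walk
begin

text \<open>The exponent with \<open>r powr s = r powr al * lam\<close>.\<close>

definition s :: real where "s = al + ln lam / ln r"

lemma s_pos: "0 < s"
  using r lam al by (simp add: s_def add_pos_pos divide_neg_neg)

lemma r_powr_s: "r powr s = ra * lam"
proof -
  have "r powr (ln lam / ln r) = lam"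
    using r lam by (simp add: powr_def)
  then show ?thesis by (simp add: s_def powr_add ra_def)
qed

lemma power_powr_s: "(r ^ n) powr s = (ra * lam) ^ n" "(r ^ n) powr (- s) = 1 / (ra * lam) ^ n"
proof -
  show "(r ^ n) powr s = (ra * lam) ^ n"
    using r ra lam unfolding r_powr_s[symmetric]
    by (simp add: powr_powr mult.commute flip: powr_realpow)
  then show "(r ^ n) powr (- s) = 1 / (ra * lam) ^ n"
    by (simp add: powr_minus_divide)
qed

text \<open>As a function of \<open>z\<close> this has the size of the Martin kernel with pole at a boundary point whose
  position is \<open>\<xi>\<close>.\<close>

definition cone_fun :: "real \<Rightarrow> 'a \<Rightarrow> 'v \<Rightarrow> real" where
  "cone_fun a \<xi> z = lam ^ lev z * (a * r ^ lev z + dist (pos z) \<xi>) powr (- s)"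

lemma dist_nbr:
  "(x, y) \<in> E \<Longrightarrow> \<bar>dist (pos y) \<xi> - dist (pos x) \<xi>\<bar> \<le> L * r ^ lev x"
  using E_pos[of x y] abs_dist_diff_le[of "pos y" \<xi> "pos x"]
  by (metis abs_dist_diff_le dist_commute order_trans)

lemma cone_fun_superharmonic:
  obtains a B where "0 < a" "0 < B"
    "\<And>x \<xi>. x \<in> V \<Longrightarrow> x \<noteq> root \<Longrightarrow> B * r ^ lev x \<le> dist (pos x) \<xi> \<Longrightarrow>
      avg (cone_fun a \<xi>) x \<le> cone_fun a \<xi> x"
proof -
  obtain a t0 where a: "0 < a" and t0: "0 < t0" and key: "\<And>t p. 0 < t \<Longrightarrow> t \<le> t0 \<Longrightarrow> p0 \<le> p \<Longrightarrow>
      p + p / lam \<le> 1 \<Longrightarrow>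
      L * t < 1 \<and> (a * (1 - r) + L) * t < 1 \<and> 0 < 1 + (a * (1 / r - 1) - L) * t \<and>
      p / lam * (1 + (a * (1 / r - 1) - L) * t) powr (-s) + p * (1 - (a * (1 - r) + L) * t) powr (-s)
        + (1 - p - p / lam) * (1 - L * t) powr (-s) \<le> 1"
    using cone_inequality[OF r lam s_pos p0(1) L] by metis
  have "avg (cone_fun a \<xi>) x \<le> cone_fun a \<xi> x"
    if x: "x \<in> V" "x \<noteq> root" and far: "1 / t0 * r ^ lev x \<le> dist (pos x) \<xi>" for x \<xi>
  proof -
    define R where "R = r ^ lev x"
    define d where "d = dist (pos x) \<xi>"
    define \<rho> where "\<rho> = a * R + d"
    define t where "t = R / \<rho>"
    define l where "l = lam ^ lev x"
    have R: "0 < R" using r by (simp add: R_def)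
    have l: "0 < l" using lam by (simp add: l_def)
    have "R \<le> t0 * d" using far t0 by (simp add: R_def d_def pos_divide_le_eq mult.commute)
    also have "\<dots> \<le> t0 * \<rho>" using t0 a R by (simp add: \<rho>_def)
    finally have \<rho>': "R \<le> t0 * \<rho>" .
    have "0 < \<rho>" using a R by (simp add: \<rho>_def d_def add_pos_nonneg)
    have t: "0 < t" "t \<le> t0"
      using \<open>0 < \<rho>\<close> R \<rho>' by (auto simp: t_def pos_divide_le_eq)
    note key' = key[OF t up_bounds[OF x]]
    have bnd: "(a * r ^ lev z + dist (pos z) \<xi>) powr (- s) \<le> \<rho> powr (- s) * (1 + A * t) powr (- s)"
      if "0 < 1 + A * t" "\<rho> + A * R \<le> a * r ^ lev z + dist (pos z) \<xi>" for z A
    proof -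
      have e: "\<rho> + A * R = \<rho> * (1 + A * t)"
        using \<open>0 < \<rho>\<close> by (simp add: t_def field_simps)
      have "(a * r ^ lev z + dist (pos z) \<xi>) powr (- s) \<le> (\<rho> * (1 + A * t)) powr (- s)"
      proof (rule powr_mono2')
        show "\<rho> * (1 + A * t) \<le> a * r ^ lev z + dist (pos z) \<xi>" using that e by simp
      qed (use that s_pos \<open>0 < \<rho>\<close> in auto)
      then show ?thesis using \<open>0 < \<rho>\<close> that by (simp add: powr_mult)
    qed
    have up': "cone_fun a \<xi> (par x) \<le> l / lam * (\<rho> powr (- s) * (1 + (a * (1 / r - 1) - L) * t) powr (- s))"
    proof -
      have e: "l / lam = lam ^ lev (par x)" "R / r = r ^ lev (par x)"
        using lev_par[OF x] lam r by (auto simp: l_def R_def)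
      have "\<rho> + (a * (1 / r - 1) - L) * R = a * (R / r) + (d - L * R)"
        by (simp add: \<rho>_def algebra_simps)
      also have "\<dots> \<le> a * (R / r) + dist (pos (par x)) \<xi>"
        using dist_nbr[OF E_par[OF x], of \<xi>] by (simp add: R_def d_def)
      finally show ?thesis
        unfolding cone_fun_def e using lam key' by (intro mult_left_mono bnd) auto
    qed
    have down: "cone_fun a \<xi> y \<le> lam * l * (\<rho> powr (- s) * (1 + - (a * (1 - r) + L) * t) powr (- s))"
      if "y \<in> children x" for y
    proof -
      have e: "lam * l = lam ^ lev y" "r * R = r ^ lev y"
        using lev_children[OF that] by (auto simp: l_def R_def)
      have "\<rho> + - (a * (1 - r) + L) * R = a * (r * R) + (d - L * R)"
        by (simp add: \<rho>_def algebra_simps)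
      also have "\<dots> \<le> a * (r * R) + dist (pos y) \<xi>"
        using dist_nbr[of x y \<xi>] children_nbrs[of x] that by (auto simp: R_def d_def nbrs_def)
      finally show ?thesis
        unfolding cone_fun_def e using lam key'
        by (intro mult_left_mono bnd) (auto simp del: minus_add_distrib)
    qed
    have side: "cone_fun a \<xi> y \<le> l * (\<rho> powr (- s) * (1 + - L * t) powr (- s))"
      if "y \<in> peers x" for y
    proof -
      have e: "l = lam ^ lev y" "R = r ^ lev y"
        using that by (auto simp: l_def R_def peers_def)
      have "\<rho> + - L * R = a * R + (d - L * R)"
        by (simp add: \<rho>_def algebra_simps)
      also have "\<dots> \<le> a * R + dist (pos y) \<xi>"
        using dist_nbr[of x y \<xi>] that by (auto simp: R_def d_def peers_def)
      finally show ?thesis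
        unfolding cone_fun_def e(1)[symmetric] using l key' e(2)
        by (intro mult_left_mono bnd) auto
    qed
    have "avg (cone_fun a \<xi>) x \<le> up x * (l / lam * (\<rho> powr (- s) * (1 + (a * (1 / r - 1) - L) * t) powr (- s)))
      + up x / lam * (lam * l * (\<rho> powr (- s) * (1 + - (a * (1 - r) + L) * t) powr (- s)))
      + (1 - up x - up x / lam) * (l * (\<rho> powr (- s) * (1 + - L * t) powr (- s)))"
      by (intro avg_le[OF x] up' down side)
    also have "\<dots> = l * \<rho> powr (- s) * (up x / lam * (1 + (a * (1 / r - 1) - L) * t) powr (-s)
        + up x * (1 - (a * (1 - r) + L) * t) powr (-s) + (1 - up x - up x / lam) * (1 - L * t) powr (-s))"
    proof -
      have "up x * (l / lam * (q * X)) + up x / lam * (lam * l * (q * Y)) + b * (l * (q * W))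
          = l * q * (up x / lam * X + up x * Y + b * W)" for q X Y W b :: real
        using lam by (simp add: algebra_simps)
      then show ?thesis by (simp only: mult_minus_left add_uminus_conv_diff)
    qed
    also have "\<dots> \<le> l * \<rho> powr (- s) * 1"
      using key' l by (intro mult_left_mono) auto
    also have "\<dots> = cone_fun a \<xi> x"
      by (simp add: cone_fun_def l_def \<rho>_def R_def d_def)
    finally show ?thesis .
  qed
  then show ?thesis using a t0 that[of a "1 / t0"] by auto
qed

subsection \<open>Paths and positions\<close>

lemma relpow_in_V: "(x, z) \<in> E ^^ k \<Longrightarrow> x \<in> V \<Longrightarrow> z \<in> V"
  using E_subset by (induction k arbitrary: z) auto

lemma relpow_lev: "(x, z) \<in> E ^^ k \<Longrightarrow> x \<in> V \<Longrightarrow> lev x \<le> lev z + k \<and> lev z \<le> lev x + k"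
proof (induction k arbitrary: z)
  case (Suc k)
  then obtain w where w: "(x, w) \<in> E ^^ k" "(w, z) \<in> E" by auto
  have "w \<in> V" using relpow_in_V[OF w(1)] Suc.prems by simp
  then show ?case using Suc.IH[OF w(1)] Suc.prems nbrs_lev[of w z] w(2) by (auto simp: nbrs_def)
qed auto

text \<open>The \<open>i\<close>-th step of a path from \<open>x\<close> happens at level at least \<open>lev x - i\<close>, so the displacement is
  bounded by a geometric series.\<close>

lemma dist_relpow:
  "(x, z) \<in> E ^^ k \<Longrightarrow> x \<in> V \<Longrightarrow> dist (pos x) (pos z) \<le> L / (1 - r) * r powr (real (lev x) - real k)"
proof (induction k arbitrary: z)
  case (Suc k)
  then obtain w where w: "(x, w) \<in> E ^^ k" "(w, z) \<in> E" by auto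
  define \<rho> where "\<rho> = r powr (real (lev x) - real (Suc k))"
  have \<rho>: "0 < \<rho>" "r powr (real (lev x) - real k) = \<rho> * r"
    using r powr_add[of r "real (lev x) - real (Suc k)" 1] by (auto simp: \<rho>_def)
  have "r ^ lev w \<le> \<rho> * r"
    using relpow_lev[OF w(1) Suc.prems(2)] r unfolding \<rho>(2)[symmetric] powr_realpow[OF r(1), symmetric]
    by (intro powr_mono') auto
  then have "dist (pos w) (pos z) \<le> L * (\<rho> * r)"
    using E_pos[OF w(2)] L by (meson mult_left_mono less_imp_le order_trans)
  then have "dist (pos x) (pos z) \<le> L / (1 - r) * (\<rho> * r) + L * (\<rho> * r)"
    using Suc.IH[OF w(1) Suc.prems(2)] dist_triangle[of "pos x" "pos z" "pos w"] \<rho>(2) by simp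
  also have "\<dots> = L * \<rho> * (r * (2 - r)) / (1 - r)"
    using r by (simp add: field_simps)
  also have "\<dots> \<le> L * \<rho> * 1 / (1 - r)"
    using r L \<rho> sum_squares_ge_zero[of "1 - r" 0]
    by (intro divide_right_mono mult_left_mono) (auto simp: algebra_simps)
  finally show ?case by (simp add: \<rho>_def mult_ac)
qed (use L r in auto)

lemma par_pow:
  "x \<in> V \<Longrightarrow> k \<le> lev x \<Longrightarrow> (par ^^ k) x \<in> V \<and> lev ((par ^^ k) x) = lev x - k \<and> (x, (par ^^ k) x) \<in> E ^^ k"
proof (induction k)
  case (Suc k)
  let ?w = "(par ^^ k) x"
  have IH: "?w \<in> V" "lev ?w = lev x - k" "(x, ?w) \<in> E ^^ k" using Suc by auto
  then have "?w \<noteq> root" using Suc.prems lev_root by (metis Suc_le_lessD zero_less_diff less_irrefl)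
  then show ?case using IH par_in[OF IH(1)] lev_par[OF IH(1)] E_par[OF IH(1)] Suc.prems by auto
qed auto

lemma dist_ancestor:
  assumes "x \<in> V" "k \<le> lev x"
  shows "dist (pos x) (pos ((par ^^ k) x)) \<le> L / (1 - r) * r ^ (lev x - k)"
  using dist_relpow[of x "(par ^^ k) x" k] par_pow[OF assms] assms r
  by (simp flip: powr_realpow of_nat_diff)

lemma ancestor_root: "x \<in> V \<Longrightarrow> (par ^^ lev x) x = root"
  using par_pow[of x "lev x"] lev_0 by auto

lemma dist_le_diam: assumes "x \<in> V" "y \<in> V" shows "dist (pos x) (pos y) \<le> 2 * L / (1 - r)"
  using dist_ancestor[of x "lev x"] dist_ancestor[of y "lev y"] ancestor_root assms
    dist_triangle2[of "pos x" "pos y" "pos root"] by simp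

subsection \<open>Upper bound for hitting probabilities\<close>

text \<open>In the cone where \<open>dist (pos x) (pos y)\<close> is of order at most \<open>r ^ lev x\<close>, the function \<open>cone_fun\<close> has order
  \<open>1 / ra ^ lev x\<close> and the bound is \<open>hit_ra\<close>; elsewhere \<open>cone_fun\<close> is superharmonic.\<close>

lemma hit_cone:
  obtains a C where "0 < a" "0 < C"
    "\<And>x y. x \<in> V \<Longrightarrow> y \<in> V \<Longrightarrow> hit x y \<le> C * ra ^ lev y * cone_fun a (pos y) x"
proof -
  obtain a B where a: "0 < a" and B: "0 < B" and super: "\<And>x \<xi>. x \<in> V \<Longrightarrow> x \<noteq> root \<Longrightarrow>
      B * r ^ lev x \<le> dist (pos x) \<xi> \<Longrightarrow> avg (cone_fun a \<xi>) x \<le> cone_fun a \<xi> x"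
    using cone_fun_superharmonic by metis
  obtain C0 where C0: "0 < C0" "\<And>x y. x \<in> V \<Longrightarrow> y \<in> V \<Longrightarrow> hit x y * ra ^ lev x \<le> C0 * ra ^ lev y"
    using hit_ra by blast
  \<comment> \<open>The cone is widened so that it contains the root, where the step up is missing.\<close>
  define B' where "B' = B + 2 * L / (1 - r)"
  have B': "B \<le> B'" "2 * L / (1 - r) \<le> B'" "0 < B'" using B L r by (auto simp: B'_def add_pos_pos)
  define C where "C = max 1 C0 * (a + B') powr s"
  have C: "0 < C" using C0 a B' by (simp add: C_def)
  have on_cone: "ra ^ lev y / ra ^ lev x * max 1 C0 \<le> C * ra ^ lev y * cone_fun a (pos y) x"
    if "x \<in> V" "dist (pos x) (pos y) \<le> B' * r ^ lev x" for x y
  proof -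
    have "((a + B') * r ^ lev x) powr (- s) \<le> (a * r ^ lev x + dist (pos x) (pos y)) powr (- s)"
      using that a s_pos r by (intro powr_mono2') (auto simp: distrib_right intro!: add_pos_nonneg)
    then have "lam ^ lev x * ((a + B') powr (- s) / (ra * lam) ^ lev x) \<le> cone_fun a (pos y) x"
      unfolding cone_fun_def using a B' lam r
      by (intro mult_left_mono) (auto simp: powr_mult power_powr_s)
    then have "(a + B') powr (- s) / ra ^ lev x \<le> cone_fun a (pos y) x"
      using lam by (simp add: power_mult_distrib)
    then have "C * ra ^ lev y * ((a + B') powr (- s) / ra ^ lev x) \<le> C * ra ^ lev y * cone_fun a (pos y) x"
      using C ra by (intro mult_left_mono) auto
    moreover have "C * ra ^ lev y * ((a + B') powr (- s) / ra ^ lev x) = ra ^ lev y / ra ^ lev x * max 1 C0"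
    proof -
      have "(a + B') powr s * (a + B') powr (- s) = 1" using a B' by (simp flip: powr_add)
      then have "C * (a + B') powr (- s) = max 1 C0" by (simp add: C_def mult.assoc)
      then have "ra ^ lev y / ra ^ lev x * (C * (a + B') powr (- s)) = ra ^ lev y / ra ^ lev x * max 1 C0"
        by simp
      then show ?thesis by (simp add: mult_ac)
    qed
    ultimately show ?thesis by metis
  qed
  have "hit x y \<le> C * ra ^ lev y * cone_fun a (pos y) x" if "x \<in> V" "y \<in> V" for x y
  proof (rule hit_le_superharmonic[where A = "{x. dist (pos x) (pos y) \<le> B' * r ^ lev x}"])
    show "1 \<le> C * ra ^ lev y * cone_fun a (pos y) y"
      using on_cone[of y y] that B' r ra by simp
    show "0 \<le> C * ra ^ lev y * cone_fun a (pos y) x" for x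
      using C ra lam by (simp add: cone_fun_def)
    show "hit x y \<le> C * ra ^ lev y * cone_fun a (pos y) x"
      if x: "x \<in> V" "x \<in> {x. dist (pos x) (pos y) \<le> B' * r ^ lev x}" for x
    proof -
      have "hit x y * ra ^ lev x \<le> C0 * ra ^ lev y" using C0 x \<open>y \<in> V\<close> by blast
      also have "\<dots> \<le> max 1 C0 * ra ^ lev y" using ra by (intro mult_right_mono) auto
      finally have "hit x y \<le> ra ^ lev y / ra ^ lev x * max 1 C0" using ra by (simp add: field_simps)
      then show ?thesis using on_cone[of x y] x by simp
    qed
    show "avg (\<lambda>z. C * ra ^ lev y * cone_fun a (pos y) z) x \<le> C * ra ^ lev y * cone_fun a (pos y) x"
      if x: "x \<in> V" "x \<notin> {x. dist (pos x) (pos y) \<le> B' * r ^ lev x}" for x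
    proof -
      have "x \<noteq> root"
        using x dist_le_diam[of x y] \<open>y \<in> V\<close> B' by auto
      moreover have "B * r ^ lev x \<le> dist (pos x) (pos y)"
      proof -
        have "B * r ^ lev x \<le> B' * r ^ lev x" using B' r by (intro mult_right_mono) auto
        then show ?thesis using x by auto
      qed
      ultimately show ?thesis
        unfolding avg_cmult using super x C ra by (intro mult_left_mono) auto
    qed
  qed (use that in auto)
  then show ?thesis using a C that by blast
qed

text \<open>The level at which a geodesic from \<open>x\<close> to \<open>y\<close> turns round, up to a bounded error.\<close>

definition confluence :: "'v \<Rightarrow> 'v \<Rightarrow> nat \<Rightarrow> bool" where
  "confluence x y l \<longleftrightarrow> l \<le> lev x \<and> l \<le> lev y \<and> (l = 0 \<or> dist (pos x) (pos y) \<le> gam * r ^ l) \<and>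
     (l = lev x \<or> l = lev y \<or> gam * r ^ Suc l < dist (pos x) (pos y))"

lemma confluence_exists: "\<exists>l. confluence x y l"
proof -
  let ?A = "{l. l \<le> lev x \<and> l \<le> lev y \<and> (l = 0 \<or> dist (pos x) (pos y) \<le> gam * r ^ l)}"
  have fin: "finite ?A" by (rule finite_subset[of _ "{..lev x}"]) auto
  have ne: "?A \<noteq> {}" by (auto intro: exI[of _ 0])
  define n where "n = Max ?A"
  have "n \<in> ?A" using Max_in[OF fin ne] by (simp add: n_def)
  moreover have "Suc n \<notin> ?A"
    using Max_ge[OF fin, of "Suc n"] unfolding n_def[symmetric] by (meson not_less_eq_eq order_refl)
  ultimately have "confluence x y n"
    unfolding confluence_def by auto
  then show ?thesis by blast
qed

text \<open>If the confluence level is \<open>lev y\<close>, the positions may be arbitrarily close, and the bound comes from the level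
  process. Otherwise \<open>a * r ^ lev x + dist (pos x) (pos y)\<close> is at least of order \<open>r ^ l\<close>.\<close>

lemma hit_upper:
  obtains C where "0 < C" "\<And>x y l. x \<in> V \<Longrightarrow> y \<in> V \<Longrightarrow> confluence x y l \<Longrightarrow>
    hit x y * (ra * lam) ^ l \<le> C * (lam ^ lev x * ra ^ lev y)"
proof -
  obtain a C where a: "0 < a" and C: "0 < C"
    and up: "\<And>x y. x \<in> V \<Longrightarrow> y \<in> V \<Longrightarrow> hit x y \<le> C * ra ^ lev y * cone_fun a (pos y) x"
    using hit_cone by metis
  define b where "b = min a (gam * r)"
  have b: "0 < b" "b \<le> a" "b \<le> gam * r" using a gam r by (auto simp: b_def)
  define C' where "C' = max 1 (C * b powr (- s))"
  have "hit x y * (ra * lam) ^ l \<le> C' * (lam ^ lev x * ra ^ lev y)"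
    if xy: "x \<in> V" "y \<in> V" and l: "confluence x y l" for x y l
  proof (cases "l = lev y")
    case True
    have "hit x y * (ra * lam) ^ l = hit x y * lam ^ lev y * ra ^ lev y"
      by (simp add: True power_mult_distrib)
    also have "\<dots> \<le> lam ^ lev x * ra ^ lev y"
      using hit_lam[OF xy] ra by (intro mult_right_mono) auto
    also have "\<dots> \<le> C' * (lam ^ lev x * ra ^ lev y)"
      using mult_right_mono[of 1 C' "lam ^ lev x * ra ^ lev y"] lam ra by (simp add: C'_def)
    finally show ?thesis .
  next
    case False
    have "b * r ^ l \<le> a * r ^ lev x + dist (pos x) (pos y)"
    proof (cases "l = lev x")
      case True
      then show ?thesis using b r mult_right_mono[of b a "r ^ l"] by (simp add: add_increasing2)
    next
      case False
      then have "gam * r * r ^ l < dist (pos x) (pos y)"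
        using l \<open>l \<noteq> lev y\<close> by (simp add: confluence_def mult_ac)
      moreover have "b * r ^ l \<le> gam * r * r ^ l" using b r by (intro mult_right_mono) auto
      moreover have "0 \<le> a * r ^ lev x" using a r by simp
      ultimately show ?thesis by linarith
    qed
    then have "(a * r ^ lev x + dist (pos x) (pos y)) powr (- s) \<le> (b * r ^ l) powr (- s)"
      using b r s_pos by (intro powr_mono2') auto
    also have "\<dots> = b powr (- s) / (ra * lam) ^ l"
      using b r by (simp add: powr_mult power_powr_s)
    finally have "cone_fun a (pos y) x \<le> lam ^ lev x * (b powr (- s) / (ra * lam) ^ l)"
      unfolding cone_fun_def using lam by (intro mult_left_mono) auto
    then have "C * ra ^ lev y * cone_fun a (pos y) x
        \<le> C * ra ^ lev y * (lam ^ lev x * (b powr (- s) / (ra * lam) ^ l))"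
      using C ra by (intro mult_left_mono) auto
    with up[OF xy] have "hit x y \<le> C * ra ^ lev y * (lam ^ lev x * (b powr (- s) / (ra * lam) ^ l))"
      by linarith
    also have "\<dots> = C * b powr (- s) * (lam ^ lev x * ra ^ lev y) / (ra * lam) ^ l"
      by simp
    finally have "hit x y * (ra * lam) ^ l \<le> C * b powr (- s) * (lam ^ lev x * ra ^ lev y)"
      using ra lam by (simp add: pos_le_divide_eq)
    also have "\<dots> \<le> C' * (lam ^ lev x * ra ^ lev y)"
      using lam ra by (intro mult_right_mono) (auto simp: C'_def)
    finally show ?thesis .
  qed
  moreover have "0 < C'" by (simp add: C'_def)
  ultimately show ?thesis using that by blast
qed


subsection \<open>Lower bound for hitting probabilities\<close>

lemma relpow_sym: "(x, y) \<in> E ^^ k \<Longrightarrow> (y, x) \<in> E ^^ k"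
proof (induction k arbitrary: y)
  case (Suc k)
  then obtain w where "(x, w) \<in> E ^^ k" "(w, y) \<in> E" by auto
  then show ?case using Suc.IH E_sym by (blast intro: relpow_Suc_I2)
qed auto

lemma hit_path:
  obtains q where "0 < q" "q \<le> 1"
    "\<And>x y k. x \<in> V \<Longrightarrow> (x, y) \<in> E ^^ k \<Longrightarrow> q ^ k \<le> hit x y"
proof -
  obtain m1 m2 where m: "0 < m1" "0 < m2" and "\<And>x. x \<in> V \<Longrightarrow> m1 * \<theta> ^ lev x \<le> mass x"
    and mass2: "\<And>x. x \<in> V \<Longrightarrow> mass x \<le> m2 * \<theta> ^ lev x"
    using mass_bounds by blast
  define q where "q = min p0 (min (eta * p0) (w1 * \<theta> / m2))"
  have q: "0 < q" "q \<le> p0" "q \<le> eta * p0" "q \<le> w1 * \<theta> / m2"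
    using p0 eta w1 \<theta> m by (auto simp: q_def)
  have step: "q \<le> prob x y" if "(x, y) \<in> E" for x y
  proof -
    have V: "x \<in> V" "y \<in> V" using that E_subset by auto
    from E_cases[OF that] show ?thesis
    proof (elim disjE conjE)
      assume "x \<noteq> root" "y = par x"
      then show ?thesis using up_bounds[OF V(1)] q by (simp add: up_def)
    next
      assume y: "y \<noteq> root" "x = par y"
      have "w1 * \<theta> / m2 * mass x \<le> w1 * \<theta> / m2 * (m2 * \<theta> ^ lev x)"
        using mass2[OF V(1)] w1 \<theta> m by (intro mult_left_mono) auto
      also have "\<dots> = w1 * \<theta> ^ lev y" using m lev_par[OF V(2) y(1)] y by simp
      also have "\<dots> \<le> c x y" using c_par'[OF V(2) y(1)] c_sym[OF V] y by simp
      finally have "w1 * \<theta> / m2 \<le> prob x y"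
        using mass_pos[OF V(1)] by (simp add: prob_eq[OF V(1)] pos_le_divide_eq)
      then show ?thesis using q by linarith
    next
      assume xy: "x \<noteq> y" "lev x = lev y"
      have x: "x \<noteq> root" using xy lev_0[OF V(2)] by auto
      have "eta * p0 \<le> eta * up x" using up_bounds[OF V(1) x] eta by simp
      also have "\<dots> = eta * c x (par x) / mass x" by (simp add: up_def prob_eq[OF V(1)])
      also have "\<dots> \<le> prob x y"
        unfolding prob_eq[OF V(1)] using c_peer[OF that xy(2)] mass_pos[OF V(1)]
        by (intro divide_right_mono) auto
      finally show ?thesis using q by linarith
    qed
  qed
  have *: "q ^ k \<le> hit x y" if x: "x \<in> V" and "(x, y) \<in> E ^^ k" for x y k
    using that(2)
  proof (induction k arbitrary: y)
    case (Suc k)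
    then obtain w where w: "(x, w) \<in> E ^^ k" "(w, y) \<in> E" by auto
    then have V: "w \<in> V" "y \<in> V" using E_subset by auto
    have "q ^ k * q \<le> hit x w * hit w y"
      using Suc.IH[OF w(1)] step[OF w(2)] P_le_hit[OF V] q hit_nonneg[OF x]
      by (intro mult_mono) auto
    then show ?case using hit_trans[OF x V] by (simp add: mult.commute)
  qed auto
  show ?thesis
  proof (rule that[of q])
    show "q ^ k \<le> hit x y" if "x \<in> V" "(x, y) \<in> E ^^ k" for x y k by (rule *[OF that])
  qed (use q p0 in auto)
qed

lemma linked_ancestors:
  assumes xy: "x \<in> V" "y \<in> V" and l: "l \<le> lev x" "l \<le> lev y"
    and near: "l = 0 \<or> dist (pos x) (pos y) \<le> gam * r ^ l"
  shows "(par ^^ (lev x - l)) x = (par ^^ (lev y - l)) y \<or> ((par ^^ (lev x - l)) x, (par ^^ (lev y - l)) y) \<in> E"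
proof (cases "l = 0")
  case True
  then show ?thesis using ancestor_root xy by simp
next
  case False
  then show ?thesis
    using link[OF xy, of "lev x - l" "lev y - l"] near l by auto
qed

text \<open>Positions at distance of order \<open>r ^ lev x\<close> need not be joined by a horizontal path, but the ancestors
  a bounded number of levels higher are equal or adjacent.\<close>

lemma hit_near:
  obtains b where "0 < b"
    "\<And>x y. x \<in> V \<Longrightarrow> y \<in> V \<Longrightarrow> lev x = lev y \<Longrightarrow> dist (pos x) (pos y) \<le> A * r ^ lev x \<Longrightarrow> b \<le> hit x y"
proof -
  obtain q where q: "0 < q" "q \<le> 1" and path: "\<And>x y k. x \<in> V \<Longrightarrow> (x, y) \<in> E ^^ k \<Longrightarrow> q ^ k \<le> hit x y"
    using hit_path by metis
  have "(\<lambda>j. A * r ^ j) \<longlonglongrightarrow> A * 0"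
    using r by (intro tendsto_intros LIMSEQ_power_zero) auto
  then have "\<forall>\<^sub>F j in sequentially. A * r ^ j < gam"
    using gam by (intro order_tendstoD(2)) auto
  then obtain j where j: "A * r ^ j < gam"
    by (auto simp: eventually_sequentially)
  have *: "q ^ (j + 1 + j) \<le> hit x y"
    if xy: "x \<in> V" "y \<in> V" and lev: "lev x = lev y" and near: "dist (pos x) (pos y) \<le> A * r ^ lev x" for x y
  proof -
    define i where "i = min j (lev x)"
    have i: "i \<le> lev x" "i \<le> lev y" "i \<le> j" using lev by (auto simp: i_def)
    define l where "l = lev x - i"
    have "l = 0 \<or> dist (pos x) (pos y) \<le> gam * r ^ l"
    proof (cases "l = 0")
      case False
      then have "lev x = j + l" by (auto simp: l_def i_def)
      then have "A * r ^ lev x = A * r ^ j * r ^ l" by (simp add: power_add)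
      also have "\<dots> \<le> gam * r ^ l" using j r by (intro mult_right_mono) auto
      finally show ?thesis using near by simp
    qed auto
    then have lk: "(par ^^ i) x = (par ^^ i) y \<or> ((par ^^ i) x, (par ^^ i) y) \<in> E"
      using linked_ancestors[OF xy, of l] i lev by (simp add: l_def)
    have up: "(x, (par ^^ i) x) \<in> E ^^ i" "((par ^^ i) y, y) \<in> E ^^ i"
      using par_pow[OF xy(1) i(1)] par_pow[OF xy(2) i(2)] relpow_sym by auto
    have V: "(par ^^ i) x \<in> V" "(par ^^ i) y \<in> V"
      using par_pow[OF xy(1) i(1)] par_pow[OF xy(2) i(2)] by auto
    have mid: "q \<le> hit ((par ^^ i) x) ((par ^^ i) y)"
      using lk
    proof
      assume "((par ^^ i) x, (par ^^ i) y) \<in> E"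
      then have "((par ^^ i) x, (par ^^ i) y) \<in> E ^^ 1" by simp
      from path[OF V(1) this] show ?thesis by simp
    qed (use q in simp)
    have "q ^ (j + 1 + j) \<le> q ^ (i + 1 + i)" using q i by (intro power_decreasing) auto
    also have "\<dots> = q ^ i * q * q ^ i" by (simp add: power_add)
    also have "\<dots> \<le> hit x ((par ^^ i) x) * hit ((par ^^ i) x) ((par ^^ i) y) * hit ((par ^^ i) y) y"
      using path[OF xy(1) up(1)] path[OF V(2) up(2)] mid q hit_nonneg[OF xy(1)] hit_nonneg[OF V(1)]
      by (intro mult_mono) (auto intro: mult_nonneg_nonneg)
    also have "\<dots> \<le> hit x ((par ^^ i) y) * hit ((par ^^ i) y) y"
      using hit_trans[OF xy(1) V] hit_nonneg[OF V(2)] by (intro mult_right_mono) auto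
    also have "\<dots> \<le> hit x y" by (rule hit_trans[OF xy(1) V(2) xy(2)])
    finally show ?thesis .
  qed
  show ?thesis
    by (rule that[OF _ *]) (use q in auto)
qed

text \<open>A maximum principle for the infinite set of vertices of level greater than \<open>n\<close>. The growth condition acts as
  boundary condition at infinity, since \<open>lam ^ k\<close> tends to \<open>0\<close>.\<close>

lemma subharmonic_le_0:
  assumes sub: "\<And>z. z \<in> V \<Longrightarrow> n < lev z \<Longrightarrow> w z \<le> avg w z"
    and base: "\<And>z. z \<in> V \<Longrightarrow> lev z = n \<Longrightarrow> w z \<le> 0"
    and growth: "\<And>z. z \<in> V \<Longrightarrow> n \<le> lev z \<Longrightarrow> w z \<le> C * lam ^ lev z"
    and x: "x \<in> V" "n \<le> lev x"
  shows "w x \<le> 0"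
proof (rule ccontr)
  assume "\<not> w x \<le> 0"
  then have pos: "0 < w x" by simp
  have "(\<lambda>k. C * lam ^ k) \<longlonglongrightarrow> C * 0"
    using lam by (intro tendsto_intros LIMSEQ_power_zero) auto
  then have "\<forall>\<^sub>F k in sequentially. C * lam ^ k < w x"
    using pos by (intro order_tendstoD(2)) auto
  then have "\<forall>\<^sub>F k in sequentially. C * lam ^ k < w x \<and> lev x \<le> k"
    using eventually_ge_at_top[of "lev x"] by eventually_elim auto
  then obtain k where k: "C * lam ^ k < w x" "lev x \<le> k"
    by (auto simp: eventually_sequentially)
  define A where "A = {z \<in> V. n \<le> lev z \<and> lev z \<le> k}"
  have fin: "finite A" by (rule finite_subset[OF _ finite_le_level[of k]]) (auto simp: A_def)
  have xA: "x \<in> A" using x k by (simp add: A_def)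
  define mx where "mx = Max (w ` A)"
  have mx: "w z \<le> mx" if "z \<in> A" for z using fin that by (simp add: mx_def)
  have "mx \<in> w ` A" unfolding mx_def using fin xA by (intro Max_in) auto
  then have "\<exists>z. z \<in> A \<and> w z = mx" by auto
  \<comment> \<open>A maximiser of least level has a parent with a strictly smaller value.\<close>
  then obtain z where z: "z \<in> A" "w z = mx" and least: "\<And>y. y \<in> A \<Longrightarrow> w y = mx \<Longrightarrow> lev z \<le> lev y"
    using ex_has_least_nat[of "\<lambda>z. z \<in> A \<and> w z = mx" _ lev] by metis
  have "0 < mx" using mx[OF xA] pos by linarith
  have zV: "z \<in> V" "n \<le> lev z" "lev z \<le> k" using z by (auto simp: A_def)
  have "lev z \<noteq> n" using base[of z] z zV \<open>0 < mx\<close> by auto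
  moreover have "lev z \<noteq> k" using growth[of z] z zV k mx[OF xA] by auto
  ultimately have lz: "n < lev z" "lev z < k" using zV by auto
  have zr: "z \<noteq> root" using lz by auto
  have pA: "par z \<in> A" using par_in[OF zV(1) zr] lev_par[OF zV(1) zr] lz by (auto simp: A_def)
  have "w (par z) \<noteq> mx" using least[OF pA] lev_par[OF zV(1) zr] by auto
  then have lt: "w (par z) < mx" using mx[OF pA] by simp
  have "avg w z \<le> up z * w (par z) + up z / lam * mx + (1 - up z - up z / lam) * mx"
  proof (rule avg_le[OF zV(1) zr])
    fix y assume "y \<in> children z"
    then show "w y \<le> mx" using lz lev_children[of y z] by (intro mx) (auto simp: A_def children_def)
  next
    fix y assume "y \<in> peers z"
    then show "w y \<le> mx" using zV E_subset by (intro mx) (auto simp: A_def peers_def)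
  qed simp
  also have "\<dots> = mx - up z * (mx - w (par z))" by (simp add: algebra_simps)
  also have "\<dots> < mx" using lt up_bounds(1)[OF zV(1) zr] p0 by simp
  finally show False using sub[OF zV(1) lz(1)] z by simp
qed

text \<open>Weighting by \<open>lam ^ lev z\<close> conditions the walk to climb. For the conditioned walk \<open>r ^ lev z\<close> increases
  on average by a multiple of itself in each step, which pays for the growth of the displacement. The constant
  \<open>r ^ n\<close> makes the function nonnegative from level \<open>n\<close> on.\<close>

definition drift :: "real \<Rightarrow> nat \<Rightarrow> 'a \<Rightarrow> 'v \<Rightarrow> real" where
  "drift a n \<xi> z = lam ^ lev z * (dist (pos z) \<xi> + a * (r ^ n - r ^ lev z))"

lemma drift_superharmonic:
  obtains a where "0 < a" "\<And>n \<xi> z. z \<in> V \<Longrightarrow> z \<noteq> root \<Longrightarrow> avg (drift a n \<xi>) z \<le> drift a n \<xi> z"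
proof -
  define \<kappa> where "\<kappa> = (1 / r - 1) / lam - (1 - r)"
  have "1 - r < (1 - r) / (r * lam)"
    using r lam mult_strict_mono[of r 1 lam 1] by (simp add: pos_less_divide_eq)
  also have "\<dots> = (1 / r - 1) / lam" using r lam by (simp add: divide_simps)
  finally have \<kappa>: "0 < \<kappa>" by (simp add: \<kappa>_def)
  define a where "a = L / (p0 * \<kappa>)"
  have a: "0 < a" using L p0 \<kappa> by (simp add: a_def)
  have "avg (drift a n \<xi>) z \<le> drift a n \<xi> z" if z: "z \<in> V" "z \<noteq> root" for n \<xi> z
  proof -
    define R where "R = r ^ lev z"
    define l where "l = lam ^ lev z"
    define b where "b = dist (pos z) \<xi> + L * R + a * r ^ n"
    define p where "p = up z"
    have Rl: "0 < R" "0 < l" using r lam by (auto simp: R_def l_def)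
    have nb: "dist (pos y) \<xi> \<le> dist (pos z) \<xi> + L * R" if "(z, y) \<in> E" for y
      using dist_nbr[OF that, of \<xi>] by (simp add: R_def)
    have "drift a n \<xi> (par z) \<le> l / lam * (b - a * (R / r))"
    proof -
      have e: "l / lam = lam ^ lev (par z)" "R / r = r ^ lev (par z)"
        using lev_par[OF z] lam r by (auto simp: l_def R_def)
      then show ?thesis
        unfolding drift_def b_def e using nb[OF E_par[OF z]] lam
        by (intro mult_left_mono) (auto simp: right_diff_distrib)
    qed
    moreover have "drift a n \<xi> y \<le> lam * l * (b - a * (r * R))" if y: "y \<in> children z" for y
    proof -
      have e: "lam * l = lam ^ lev y" "r * R = r ^ lev y" and "(z, y) \<in> E"
        using lev_children[OF y] children_nbrs[of z] y by (auto simp: l_def R_def nbrs_def)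
      then show ?thesis
        unfolding drift_def b_def e(1) using nb[of y] lam
        by (intro mult_left_mono) (auto simp: right_diff_distrib e(2))
    qed
    moreover have "drift a n \<xi> y \<le> l * (b - a * R)" if y: "y \<in> peers z" for y
    proof -
      have e: "l = lam ^ lev y" "R = r ^ lev y" and "(z, y) \<in> E"
        using y by (auto simp: l_def R_def peers_def)
      then show ?thesis
        unfolding drift_def b_def e(1) using nb[of y] lam
        by (intro mult_left_mono) (auto simp: right_diff_distrib e(2))
    qed
    ultimately have "avg (drift a n \<xi>) z \<le> p * (l / lam * (b - a * (R / r)))
        + p / lam * (lam * l * (b - a * (r * R))) + (1 - p - p / lam) * (l * (b - a * R))"
      unfolding p_def by (intro avg_le[OF z]) auto
    also have "\<dots> = l * (b - a * R - a * R * (p * \<kappa>))"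
      using lam r by (simp add: \<kappa>_def field_simps)
    also have "\<dots> \<le> l * (b - a * R - L * R)"
    proof -
      have "L = a * (p0 * \<kappa>)" using p0 \<kappa> by (simp add: a_def)
      also have "\<dots> \<le> a * (p * \<kappa>)"
        using up_bounds(1)[OF z] a \<kappa> by (simp add: p_def)
      finally have "L * R \<le> a * R * (p * \<kappa>)" using Rl by (simp add: mult_ac)
      then show ?thesis using Rl by simp
    qed
    also have "\<dots> = drift a n \<xi> z"
      by (simp add: drift_def l_def R_def b_def algebra_simps)
    finally show ?thesis .
  qed
  with a show ?thesis using that by blast
qed

text \<open>By the superharmonicity of \<open>drift\<close> and Markov's inequality, the walk that climbs to the level \<open>n\<close> of the
  ancestor arrives within distance \<open>2 * a * r ^ n\<close> of its start with at least half of the probability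
  \<open>lam ^ k\<close> of climbing. The proof replaces the arrival time by the maximum principle, applied to the difference of
  the resulting lower bound and the hitting probability.\<close>

lemma hit_ancestor:
  obtains b where "0 < b" "\<And>x k. x \<in> V \<Longrightarrow> k \<le> lev x \<Longrightarrow> b * lam ^ k \<le> hit x ((par ^^ k) x)"
proof -
  obtain a where a: "0 < a" and super: "\<And>n \<xi> z. z \<in> V \<Longrightarrow> z \<noteq> root \<Longrightarrow> avg (drift a n \<xi>) z \<le> drift a n \<xi> z"
    using drift_superharmonic by metis
  obtain b where b: "0 < b" and near: "\<And>x y. x \<in> V \<Longrightarrow> y \<in> V \<Longrightarrow> lev x = lev y \<Longrightarrow>
      dist (pos x) (pos y) \<le> (2 * a + L / (1 - r)) * r ^ lev x \<Longrightarrow> b \<le> hit x y"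
    using hit_near by metis
  have "b / 2 * lam ^ k \<le> hit x ((par ^^ k) x)" if x: "x \<in> V" "k \<le> lev x" for x k
  proof -
    define n where "n = lev x - k"
    define x' where "x' = (par ^^ k) x"
    have x': "x' \<in> V" "lev x' = n" "dist (pos x) (pos x') \<le> L / (1 - r) * r ^ n"
      using par_pow[OF x] dist_ancestor[OF x] by (auto simp: x'_def n_def)
    define D where "D = drift a n (pos x)"
    define k0 where "k0 = 2 * a * r ^ n"
    have k0: "0 < k0" using a r by (simp add: k0_def)
    define w where "w z = b * (lam ^ lev z - D z / k0) - lam ^ n * hit z x'" for z
    have D_nonneg: "0 \<le> D z" if "n \<le> lev z" for z
    proof -
      have "r ^ lev z \<le> r ^ n" using that r by (intro power_decreasing) auto
      then show ?thesis unfolding D_def drift_def using a lam by simp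
    qed
    have "w x \<le> 0"
    proof (rule subharmonic_le_0[where n = n and C = b])
      fix z assume z: "z \<in> V" "n < lev z"
      then have zr: "z \<noteq> root" by auto
      have "avg (\<lambda>z. b * (lam ^ lev z - 1 / k0 * D z) - lam ^ n * hit z x') z
          = b * (lam ^ lev z - 1 / k0 * avg D z) - lam ^ n * avg (\<lambda>z. hit z x') z"
        by (simp only: avg_diff avg_cmult avg_lam_lev[OF z(1) zr])
      moreover have "1 / k0 * avg D z \<le> 1 / k0 * D z"
        unfolding D_def using super[OF z(1) zr] k0 by (intro mult_left_mono) auto
      then have "b * (lam ^ lev z - 1 / k0 * D z) \<le> b * (lam ^ lev z - 1 / k0 * avg D z)"
        using b by (intro mult_left_mono) auto
      moreover have "lam ^ n * avg (\<lambda>z. hit z x') z \<le> lam ^ n * hit z x'"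
        using avg_hit_le[OF z(1)] lam by (intro mult_left_mono) auto
      ultimately show "w z \<le> avg w z" unfolding w_def by simp
    next
      fix z assume z: "z \<in> V" "lev z = n"
      have D: "D z = lam ^ n * dist (pos z) (pos x)" by (simp add: D_def drift_def z)
      show "w z \<le> 0"
      proof (cases "dist (pos z) (pos x) \<le> k0")
        case True
        have "dist (pos z) (pos x') \<le> (2 * a + L / (1 - r)) * r ^ n"
          using True x'(3) dist_triangle[of "pos z" "pos x'" "pos x"] by (simp add: k0_def distrib_right)
        then have "b \<le> hit z x'" using near[OF z(1) x'(1)] z x' by simp
        then have "lam ^ n * b \<le> lam ^ n * hit z x'" using lam by (intro mult_left_mono) auto
        moreover have "b * (lam ^ lev z - D z / k0) \<le> b * lam ^ n"
          using D_nonneg[of z] z k0 b by (intro mult_left_mono) auto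
        ultimately show ?thesis by (simp add: w_def mult.commute)
      next
        case False
        then have "lam ^ n * k0 \<le> D z" unfolding D using lam by (intro mult_left_mono) auto
        then have "lam ^ n \<le> D z / k0" using k0 by (simp add: pos_le_divide_eq)
        then have "b * (lam ^ lev z - D z / k0) \<le> 0" using z b by (simp add: mult_le_0_iff)
        moreover have "0 \<le> lam ^ n * hit z x'" using hit_nonneg[OF z(1)] lam by simp
        ultimately show ?thesis by (simp add: w_def)
      qed
    next
      fix z assume z: "z \<in> V" "n \<le> lev z"
      have "b * (lam ^ lev z - D z / k0) \<le> b * lam ^ lev z"
        using D_nonneg[of z] z k0 b by (intro mult_left_mono) auto
      moreover have "0 \<le> lam ^ n * hit z x'" using hit_nonneg[OF z(1)] lam by simp
      ultimately show "w z \<le> b * lam ^ lev z" by (simp add: w_def)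
    qed (use x in \<open>auto simp: n_def\<close>)
    moreover have "D x / k0 \<le> lam ^ lev x / 2"
    proof -
      have "D x \<le> lam ^ lev x * (a * r ^ n)"
        unfolding D_def drift_def using a r lam by (intro mult_left_mono) auto
      also have "\<dots> = lam ^ lev x / 2 * k0" by (simp add: k0_def)
      finally show ?thesis using k0 by (simp add: pos_divide_le_eq)
    qed
    then have "b * (lam ^ lev x / 2) \<le> b * (lam ^ lev x - D x / k0)"
      using b by (intro mult_left_mono) auto
    ultimately have "b * (lam ^ lev x / 2) \<le> lam ^ n * hit x x'" unfolding w_def by linarith
    moreover have "lam ^ lev x = lam ^ n * lam ^ k" using x by (simp add: n_def flip: power_add)
    ultimately have "lam ^ n * (b / 2 * lam ^ k) \<le> lam ^ n * hit x x'" by (simp add: mult_ac)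
    then show ?thesis using lam by (simp add: x'_def)
  qed
  then show ?thesis using that[of "b / 2"] b by simp
qed

lemma hit_descendant:
  obtains b where "0 < b" "\<And>x k. x \<in> V \<Longrightarrow> k \<le> lev x \<Longrightarrow> b * ra ^ k \<le> hit ((par ^^ k) x) x"
proof -
  obtain b where b: "0 < b" and up: "\<And>x k. x \<in> V \<Longrightarrow> k \<le> lev x \<Longrightarrow> b * lam ^ k \<le> hit x ((par ^^ k) x)"
    using hit_ancestor by metis
  obtain C where C: "0 < C" and rev: "\<And>x y. x \<in> V \<Longrightarrow> y \<in> V \<Longrightarrow> hit x y * \<theta> ^ lev x \<le> C * (hit y x * \<theta> ^ lev y)"
    using hit_reverse by metis
  have ra_eq: "ra = \<theta> * lam" using lam by (simp add: \<theta>_def)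
  have "b / C * ra ^ k \<le> hit ((par ^^ k) x) x" if x: "x \<in> V" "k \<le> lev x" for x k
  proof -
    have V: "(par ^^ k) x \<in> V" "lev ((par ^^ k) x) = lev x - k" using par_pow[OF x] by auto
    have t: "\<theta> ^ lev x = \<theta> ^ k * \<theta> ^ (lev x - k)" using x by (simp flip: power_add)
    have "b * ra ^ k * \<theta> ^ (lev x - k) = b * lam ^ k * \<theta> ^ lev x"
      by (simp add: ra_eq power_mult_distrib t)
    also have "\<dots> \<le> hit x ((par ^^ k) x) * \<theta> ^ lev x"
      using up[OF x] \<theta> by (intro mult_right_mono) auto
    also have "\<dots> \<le> C * hit ((par ^^ k) x) x * \<theta> ^ (lev x - k)"
      using rev[OF x(1) V(1)] V(2) by (simp add: mult_ac)
    finally have "b * ra ^ k \<le> C * hit ((par ^^ k) x) x" using \<theta> by simp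
    then show ?thesis using C by (simp add: pos_divide_le_eq mult.commute)
  qed
  then show ?thesis using that[of "b / C"] b C by simp
qed

text \<open>Up to the confluence level, across one edge at most, and down again.\<close>

lemma hit_lower:
  obtains b where "0 < b" "\<And>x y l. x \<in> V \<Longrightarrow> y \<in> V \<Longrightarrow> confluence x y l \<Longrightarrow>
    b * (lam ^ lev x * ra ^ lev y) \<le> hit x y * (ra * lam) ^ l"
proof -
  obtain b1 where b1: "0 < b1" and up: "\<And>x k. x \<in> V \<Longrightarrow> k \<le> lev x \<Longrightarrow> b1 * lam ^ k \<le> hit x ((par ^^ k) x)"
    using hit_ancestor by metis
  obtain b2 where b2: "0 < b2" and down: "\<And>x k. x \<in> V \<Longrightarrow> k \<le> lev x \<Longrightarrow> b2 * ra ^ k \<le> hit ((par ^^ k) x) x"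
    using hit_descendant by metis
  obtain q where q: "0 < q" "q \<le> 1" and path: "\<And>x y k. x \<in> V \<Longrightarrow> (x, y) \<in> E ^^ k \<Longrightarrow> q ^ k \<le> hit x y"
    using hit_path by metis
  have "b1 * q * b2 * (lam ^ lev x * ra ^ lev y) \<le> hit x y * (ra * lam) ^ l"
    if xy: "x \<in> V" "y \<in> V" and "confluence x y l" for x y l
  proof -
    have l: "l \<le> lev x" "l \<le> lev y" "l = 0 \<or> dist (pos x) (pos y) \<le> gam * r ^ l"
      using \<open>confluence x y l\<close> by (auto simp: confluence_def)
    define x' where "x' = (par ^^ (lev x - l)) x"
    define y' where "y' = (par ^^ (lev y - l)) y"
    have V: "x' \<in> V" "y' \<in> V"
      using par_pow[OF xy(1), of "lev x - l"] par_pow[OF xy(2), of "lev y - l"] by (auto simp: x'_def y'_def)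
    have "x' = y' \<or> (x', y') \<in> E"
      using linked_ancestors[OF xy l] by (simp add: x'_def y'_def)
    then have mid: "q \<le> hit x' y'"
    proof
      assume "(x', y') \<in> E"
      then have "(x', y') \<in> E ^^ 1" by simp
      from path[OF V(1) this] show ?thesis by simp
    qed (use q in simp)
    have "b1 * lam ^ (lev x - l) * q * (b2 * ra ^ (lev y - l)) \<le> hit x x' * hit x' y' * hit y' y"
      using up[OF xy(1), of "lev x - l"] down[OF xy(2), of "lev y - l"] mid q b1 b2 lam ra
        hit_nonneg[OF xy(1)] hit_nonneg[OF V(1)]
      by (intro mult_mono) (auto simp: x'_def y'_def intro: mult_nonneg_nonneg)
    also have "\<dots> \<le> hit x y' * hit y' y"
      using hit_trans[OF xy(1) V] hit_nonneg[OF V(2)] by (intro mult_right_mono) auto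
    also have "\<dots> \<le> hit x y" by (rule hit_trans[OF xy(1) V(2) xy(2)])
    finally have "b1 * lam ^ (lev x - l) * q * (b2 * ra ^ (lev y - l)) * (ra * lam) ^ l \<le> hit x y * (ra * lam) ^ l"
      using ra lam by (intro mult_right_mono) auto
    moreover have "lam ^ lev x = lam ^ (lev x - l) * lam ^ l" "ra ^ lev y = ra ^ (lev y - l) * ra ^ l"
      using l by (auto simp flip: power_add)
    ultimately show ?thesis by (simp add: power_mult_distrib mult_ac)
  qed
  then show ?thesis using that[of "b1 * q * b2"] b1 b2 q by simp
qed


subsection \<open>The Gromov product\<close>

definition gp :: "'v \<Rightarrow> 'v \<Rightarrow> real" where "gp = gromov_product lev E"

lemma graph_dist_path: assumes "x \<in> V" "y \<in> V" shows "(x, y) \<in> E ^^ graph_dist E x y"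
proof -
  have "(x, root) \<in> E ^^ lev x" "(y, root) \<in> E ^^ lev y"
    using par_pow[of x "lev x"] par_pow[of y "lev y"] ancestor_root assms by auto
  then have "(x, root) \<in> E ^^ lev x" "(root, y) \<in> E ^^ lev y"
    by (auto intro: relpow_sym)
  then have "(x, y) \<in> E ^^ (lev x + lev y)"
    unfolding relpow_add by blast
  then show ?thesis unfolding graph_dist_def by (rule LeastI)
qed

lemma graph_dist_le: "(x, y) \<in> E ^^ k \<Longrightarrow> graph_dist E x y \<le> k"
  unfolding graph_dist_def by (rule Least_le)

lemma graph_dist_sym: "x \<in> V \<Longrightarrow> y \<in> V \<Longrightarrow> graph_dist E x y = graph_dist E y x"
  using graph_dist_le[OF relpow_sym[OF graph_dist_path[of x y]]]
    graph_dist_le[OF relpow_sym[OF graph_dist_path[of y x]]] by (simp add: antisym)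

lemma graph_dist_triangle:
  assumes "x \<in> V" "y \<in> V" "z \<in> V"
  shows "graph_dist E x z \<le> graph_dist E x y + graph_dist E y z"
  using relcompI[OF graph_dist_path[OF assms(1,2)] graph_dist_path[OF assms(2,3)]]
  by (intro graph_dist_le) (simp add: relpow_add)

lemma lev_graph_dist:
  "x \<in> V \<Longrightarrow> y \<in> V \<Longrightarrow> lev x \<le> lev y + graph_dist E x y \<and> lev y \<le> lev x + graph_dist E x y"
  using relpow_lev[OF graph_dist_path] by blast

lemma gp_sym: "x \<in> V \<Longrightarrow> y \<in> V \<Longrightarrow> gp x y = gp y x"
  using graph_dist_sym[of x y] by (simp add: gp_def gromov_product_def)

lemma gp_le_lev: "x \<in> V \<Longrightarrow> y \<in> V \<Longrightarrow> gp x y \<le> lev x \<and> gp x y \<le> lev y"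
  using lev_graph_dist[of x y] by (simp add: gp_def gromov_product_def)

text \<open>Cutting a geodesic from \<open>x\<close> to \<open>y\<close> at the right place, both halves end at level at least
  \<^term>\<open>gp x y\<close> up to a bounded error, which bounds the distance of the positions.\<close>

lemma dist_le_gp:
  assumes "x \<in> V" "y \<in> V"
  shows "dist (pos x) (pos y) \<le> 2 * L / (1 - r) * r powr (gp x y - 1)"
proof -
  define n where "n = graph_dist E x y"
  define k where "k = (lev x + n - lev y) div 2"
  have lev: "lev x \<le> lev y + n" "lev y \<le> lev x + n" using lev_graph_dist[OF assms] by (auto simp: n_def)
  then have "k \<le> n" by (simp add: k_def)
  then have "(x, y) \<in> E ^^ (k + (n - k))" using graph_dist_path[OF assms] by (simp add: n_def)
  then obtain z where z: "(x, z) \<in> E ^^ k" "(z, y) \<in> E ^^ (n - k)" unfolding relpow_add by blast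
  have k: "2 * k \<le> lev x + n - lev y" "lev x + n - lev y \<le> 2 * k + 1"
    unfolding k_def by presburger+
  then have "2 * real k \<le> real (lev x) + real n - real (lev y)"
    "real (lev x) + real n - real (lev y) \<le> 2 * real k + 1"
    using lev by linarith+
  moreover have "2 * gp x y = real (lev x) + real (lev y) - real n"
    by (simp add: gp_def gromov_product_def n_def)
  ultimately have e: "gp x y - 1 \<le> real (lev x) - real k" "gp x y - 1 \<le> real (lev y) - real (n - k)"
    using \<open>k \<le> n\<close> by (auto simp: of_nat_diff)
  have "dist (pos x) (pos z) \<le> L / (1 - r) * r powr (real (lev x) - real k)"
    using dist_relpow[OF z(1) assms(1)] .
  also have "\<dots> \<le> L / (1 - r) * r powr (gp x y - 1)"
    using e r L by (intro mult_left_mono powr_mono') auto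
  finally have 1: "dist (pos x) (pos z) \<le> L / (1 - r) * r powr (gp x y - 1)" .
  have "dist (pos y) (pos z) \<le> L / (1 - r) * r powr (real (lev y) - real (n - k))"
    using dist_relpow[OF relpow_sym[OF z(2)] assms(2)] .
  also have "\<dots> \<le> L / (1 - r) * r powr (gp x y - 1)"
    using e r L by (intro mult_left_mono powr_mono') auto
  finally have 2: "dist (pos y) (pos z) \<le> L / (1 - r) * r powr (gp x y - 1)" .
  have "2 * L / (1 - r) * r powr (gp x y - 1)
      = L / (1 - r) * r powr (gp x y - 1) + L / (1 - r) * r powr (gp x y - 1)"
    by simp
  then show ?thesis using 1 2 dist_triangle2[of "pos x" "pos y" "pos z"] by linarith
qed

lemma confluence_le_gp:
  assumes xy: "x \<in> V" "y \<in> V" and "confluence x y l"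
  shows "real l - 1 \<le> gp x y"
proof -
  have l: "l \<le> lev x" "l \<le> lev y" "l = 0 \<or> dist (pos x) (pos y) \<le> gam * r ^ l"
    using \<open>confluence x y l\<close> by (auto simp: confluence_def)
  define x' where "x' = (par ^^ (lev x - l)) x"
  define y' where "y' = (par ^^ (lev y - l)) y"
  have p: "x' \<in> V" "y' \<in> V" "(x, x') \<in> E ^^ (lev x - l)" "(y', y) \<in> E ^^ (lev y - l)"
    using par_pow[OF xy(1), of "lev x - l"] par_pow[OF xy(2), of "lev y - l"] relpow_sym
    by (auto simp: x'_def y'_def)
  have "x' = y' \<or> (x', y') \<in> E"
    using linked_ancestors[OF xy l] by (simp add: x'_def y'_def)
  then have "graph_dist E x' y' \<le> 1"
    using graph_dist_le[of x' y' 0] graph_dist_le[of x' y' 1] by auto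
  then have "graph_dist E x y \<le> (lev x - l) + 1 + (lev y - l)"
    using graph_dist_triangle[OF xy(1) p(1) xy(2)] graph_dist_triangle[OF p(1,2) xy(2)]
      graph_dist_le[OF p(3)] graph_dist_le[OF p(4)] by linarith
  then have "real (graph_dist E x y) \<le> real (lev x) + real (lev y) - 2 * real l + 1"
    using l by linarith
  then show ?thesis by (simp add: gp_def gromov_product_def)
qed

text \<open>Below the confluence level the positions are too far apart for a larger Gromov product, by
  \<open>dist_le_gp\<close>.\<close>

lemma gp_le_confluence:
  obtains \<delta> where "0 \<le> \<delta>" "\<And>x y l. x \<in> V \<Longrightarrow> y \<in> V \<Longrightarrow> confluence x y l \<Longrightarrow> gp x y \<le> real l + \<delta>"
proof -
  define C where "C = 2 * L / (1 - r)"
  have C: "0 < C" using L r by (simp add: C_def)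
  define \<delta> where "\<delta> = max 0 (2 - ln (C / gam) / ln r)"
  have "gp x y \<le> real l + \<delta>" if xy: "x \<in> V" "y \<in> V" and l: "confluence x y l" for x y l
  proof (cases "l = lev x \<or> l = lev y")
    case True
    then show ?thesis using gp_le_lev[OF xy] by (auto simp: \<delta>_def)
  next
    case False
    then have "gam * r ^ Suc l < dist (pos x) (pos y)" using l by (simp add: confluence_def)
    also have "\<dots> \<le> C * r powr (gp x y - 1)" using dist_le_gp[OF xy] by (simp add: C_def)
    finally have "gam * r powr (real l + 1) < C * r powr (gp x y - 1)"
      using r by (simp add: powr_add powr_realpow mult.commute)
    then have "ln (gam * r powr (real l + 1)) < ln (C * r powr (gp x y - 1))"
      using gam C r by (subst ln_less_cancel_iff) auto
    then have "ln gam + (real l + 1) * ln r < ln C + (gp x y - 1) * ln r"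
      using gam C r by (simp add: ln_mult ln_powr)
    then have "(real l + 2 - gp x y) * ln r < ln (C / gam)"
      using C gam by (simp add: ln_div algebra_simps)
    then have "ln (C / gam) / ln r < real l + 2 - gp x y"
      using r by (simp add: neg_divide_less_eq)
    then show ?thesis by (simp add: \<delta>_def)
  qed
  then show ?thesis using that[of \<delta>] by (simp add: \<delta>_def)
qed

text \<open>Hyperbolicity: \<^term>\<open>r powr gp x y\<close> is comparable to \<open>r ^ lev x + r ^ lev y\<close> plus the distance of
  the positions, which satisfies a triangle inequality.\<close>

lemma gp_triangle:
  obtains C where "0 < C" "\<And>x y z. x \<in> V \<Longrightarrow> y \<in> V \<Longrightarrow> z \<in> V \<Longrightarrow>
    r powr gp x y \<le> C * (r powr gp x z + r powr gp z y)"
proof -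
  define D where "D x y = r ^ lev x + r ^ lev y + dist (pos x) (pos y)" for x y
  define C1 where "C1 = 2 + 2 * L / (1 - r) / r"
  define C2 where "C2 = 1 + 1 / (gam * r)"
  have C1: "0 < C1" using L r by (simp add: C1_def add_pos_pos)
  have C2: "1 \<le> C2" "1 / (gam * r) \<le> C2" using gam r by (auto simp: C2_def)
  have lower: "D x y \<le> C1 * r powr gp x y" if xy: "x \<in> V" "y \<in> V" for x y
  proof -
    have "r powr lev x \<le> r powr gp x y" "r powr lev y \<le> r powr gp x y"
      using gp_le_lev[OF xy] r by (auto intro!: powr_mono')
    then show ?thesis
      using dist_le_gp[OF xy] r by (simp add: D_def C1_def powr_realpow powr_diff distrib_right)
  qed
  have upper: "r powr gp x y \<le> C2 / r * D x y" if xy: "x \<in> V" "y \<in> V" for x y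
  proof -
    obtain l where l: "confluence x y l" using confluence_exists by blast
    have nn: "0 \<le> r ^ lev x" "0 \<le> r ^ lev y" using r by auto
    have "r powr gp x y \<le> r powr (real l - 1)"
      using confluence_le_gp[OF xy l] r by (intro powr_mono') auto
    also have "\<dots> = r ^ l / r" using r by (simp add: powr_diff powr_realpow)
    also have "\<dots> \<le> C2 * D x y / r"
    proof (intro divide_right_mono)
      consider "l = lev x \<or> l = lev y" | "gam * r * r ^ l < dist (pos x) (pos y)"
        using l by (auto simp: confluence_def mult_ac)
      then show "r ^ l \<le> C2 * D x y"
      proof cases
        case 1
        then have "1 * r ^ l \<le> C2 * D x y"
          using C2 nn by (intro mult_mono) (auto simp: D_def add_nonneg_nonneg)
        then show ?thesis by simp
      next
        case 2
        then have "r ^ l \<le> 1 / (gam * r) * dist (pos x) (pos y)"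
          using gam r by (simp add: pos_le_divide_eq mult_ac)
        also have "\<dots> \<le> C2 * D x y"
          using C2 nn by (intro mult_mono) (auto simp: D_def)
        finally show ?thesis .
      qed
    qed (use r in simp)
    finally show ?thesis by simp
  qed
  have "r powr gp x y \<le> C2 / r * C1 * (r powr gp x z + r powr gp z y)"
    if V: "x \<in> V" "y \<in> V" "z \<in> V" for x y z
  proof -
    have "D x y \<le> D x z + D z y"
      using dist_triangle[of "pos x" "pos y" "pos z"] zero_less_power[OF r(1), of "lev z"] by (simp add: D_def)
    also have "\<dots> \<le> C1 * (r powr gp x z + r powr gp z y)"
      using lower[of x z] lower[of z y] V by (simp add: distrib_left)
    finally have "C2 / r * D x y \<le> C2 / r * (C1 * (r powr gp x z + r powr gp z y))"
      using C2 r by (intro mult_left_mono) auto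
    then show ?thesis using upper[OF V(1,2)] by (simp only: mult.assoc)
  qed
  moreover have "0 < C2 / r * C1" using C1 C2 r by simp
  ultimately show ?thesis using that by blast
qed

subsection \<open>Two-sided estimates\<close>

text \<open>The size of the Martin kernel when the Gromov product is \<open>g\<close>; see \<open>\<kappa>_eq\<close>.\<close>

definition \<kappa> :: "'v \<Rightarrow> real \<Rightarrow> real" where
  "\<kappa> x g = lam ^ lev x * r powr (- (s * g))"

lemma \<kappa>_pos: "0 < \<kappa> x g"
  using lam r by (simp add: \<kappa>_def)

lemma \<kappa>_eq: "\<kappa> x g = lam powr (real (lev x) - g) * r powr (- al * g)"
proof -
  have "r powr (- (s * g)) = r powr (- al * g) * r powr ((ln lam / ln r) * (- g))"
    by (simp add: s_def algebra_simps flip: powr_add)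
  also have "r powr ((ln lam / ln r) * (- g)) = lam powr (- g)"
    using r lam by (simp add: powr_def)
  finally have "\<kappa> x g = lam powr real (lev x) * lam powr (- g) * r powr (- al * g)"
    using lam by (simp add: \<kappa>_def powr_realpow)
  then show ?thesis by (simp flip: powr_add)
qed

lemma \<kappa>_mono: "g \<le> g' \<Longrightarrow> \<kappa> x g \<le> \<kappa> x g'"
  unfolding \<kappa>_def using r lam s_pos by (intro mult_left_mono powr_mono') auto

lemma \<kappa>_shift: "\<kappa> x (g + h) = r powr (- (s * h)) * \<kappa> x g"
proof -
  have "r powr (- (s * (g + h))) = r powr (- (s * h)) * r powr (- (s * g))"
    by (simp add: algebra_simps flip: powr_add)
  then show ?thesis by (simp add: \<kappa>_def)
qed

lemma ra_power: "ra ^ n = r powr (al * n)"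
  using r by (simp add: ra_def powr_powr flip: powr_realpow)

theorem hit_estimate:
  obtains b C where "0 < b" "0 < C"
    "\<And>x y. x \<in> V \<Longrightarrow> y \<in> V \<Longrightarrow> b * (ra ^ lev y * \<kappa> x (gp x y)) \<le> hit x y"
    "\<And>x y. x \<in> V \<Longrightarrow> y \<in> V \<Longrightarrow> hit x y \<le> C * (ra ^ lev y * \<kappa> x (gp x y))"
proof -
  obtain b where b: "0 < b" and lower: "\<And>x y l. x \<in> V \<Longrightarrow> y \<in> V \<Longrightarrow> confluence x y l \<Longrightarrow>
      b * (lam ^ lev x * ra ^ lev y) \<le> hit x y * (ra * lam) ^ l"
    using hit_lower by metis
  obtain C where C: "0 < C" and upper: "\<And>x y l. x \<in> V \<Longrightarrow> y \<in> V \<Longrightarrow> confluence x y l \<Longrightarrow>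
      hit x y * (ra * lam) ^ l \<le> C * (lam ^ lev x * ra ^ lev y)"
    using hit_upper by metis
  obtain \<delta> where \<delta>: "0 \<le> \<delta>" "\<And>x y l. x \<in> V \<Longrightarrow> y \<in> V \<Longrightarrow> confluence x y l \<Longrightarrow> gp x y \<le> real l + \<delta>"
    using gp_le_confluence by metis
  have \<kappa>_l: "lam ^ lev x = \<kappa> x (real l) * (ra * lam) ^ l" for x l
  proof -
    have "(ra * lam) ^ l = r powr (s * l)"
      using r by (simp add: powr_powr flip: r_powr_s powr_realpow)
    then show ?thesis using r by (simp add: \<kappa>_def flip: powr_add)
  qed
  have q: "0 < (ra * lam) ^ l" for l using ra lam by simp
  have 1: "b * r powr (s * \<delta>) * (ra ^ lev y * \<kappa> x (gp x y)) \<le> hit x y" if xy: "x \<in> V" "y \<in> V" for x y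
  proof -
    obtain l where l: "confluence x y l" using confluence_exists by blast
    have "\<kappa> x (gp x y) \<le> \<kappa> x (real l + \<delta>)" by (rule \<kappa>_mono[OF \<delta>(2)[OF xy l]])
    also have "\<dots> = r powr (- (s * \<delta>)) * \<kappa> x (real l)" by (rule \<kappa>_shift)
    finally have "r powr (s * \<delta>) * \<kappa> x (gp x y) \<le> r powr (s * \<delta>) * (r powr (- (s * \<delta>)) * \<kappa> x (real l))"
      using r by (intro mult_left_mono) auto
    also have "\<dots> = \<kappa> x (real l)" using r by (simp flip: mult.assoc powr_add)
    finally have "b * ra ^ lev y * (r powr (s * \<delta>) * \<kappa> x (gp x y)) \<le> b * ra ^ lev y * \<kappa> x (real l)"
      using b ra by (intro mult_left_mono) auto
    also have "\<dots> \<le> hit x y"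
    proof -
      have "b * ra ^ lev y * \<kappa> x (real l) * (ra * lam) ^ l \<le> hit x y * (ra * lam) ^ l"
        using lower[OF xy l] by (simp add: \<kappa>_l[of x l] mult_ac)
      then show ?thesis using q by (simp only: mult_le_cancel_right_pos)
    qed
    finally show ?thesis by (simp add: mult_ac)
  qed
  have 2: "hit x y \<le> C * r powr (- s) * (ra ^ lev y * \<kappa> x (gp x y))" if xy: "x \<in> V" "y \<in> V" for x y
  proof -
    obtain l where l: "confluence x y l" using confluence_exists by blast
    have "hit x y * (ra * lam) ^ l \<le> C * ra ^ lev y * \<kappa> x (real l) * (ra * lam) ^ l"
      using upper[OF xy l] by (simp add: \<kappa>_l[of x l] mult_ac)
    then have "hit x y \<le> C * ra ^ lev y * \<kappa> x (real l)"
      using q by (simp only: mult_le_cancel_right_pos)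
    also have "\<kappa> x (real l) \<le> \<kappa> x (gp x y + 1)"
      using confluence_le_gp[OF xy l] by (intro \<kappa>_mono) simp
    then have "C * ra ^ lev y * \<kappa> x (real l) \<le> C * ra ^ lev y * \<kappa> x (gp x y + 1)"
      using C ra by (intro mult_left_mono) auto
    also have "\<dots> = C * r powr (- s) * (ra ^ lev y * \<kappa> x (gp x y))"
      by (simp add: \<kappa>_shift[of x _ 1, simplified])
    finally show ?thesis .
  qed
  show ?thesis
    by (rule that[OF _ _ 1 2]) (use b C r in auto)
qed

lemma gp_root: assumes "y \<in> V" shows "gp root y = 0"
proof -
  have "(y, root) \<in> E ^^ lev y" using par_pow[of y "lev y"] ancestor_root assms by auto
  then have "graph_dist E root y \<le> lev y" by (rule graph_dist_le[OF relpow_sym])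
  then show ?thesis
    using lev_graph_dist[OF root_in assms] by (simp add: gp_def gromov_product_def)
qed

definition mk :: "'v \<Rightarrow> 'v \<Rightarrow> real" where "mk = martin_kernel V prob root"

lemma mk_eq: "mk x y = gr x y / gr root y"
  by (simp add: mk_def martin_kernel_def gr_def)

text \<open>The Gromov product with the root vanishes, so the denominator \<open>gr root y\<close> is of order
  \<open>ra ^ lev y\<close>.\<close>

theorem mk_estimate:
  obtains b C where "0 < b" "0 < C"
    "\<And>x y. x \<in> V \<Longrightarrow> y \<in> V \<Longrightarrow> b * \<kappa> x (gp x y) \<le> mk x y"
    "\<And>x y. x \<in> V \<Longrightarrow> y \<in> V \<Longrightarrow> mk x y \<le> C * \<kappa> x (gp x y)"
proof -
  obtain b C where bC: "0 < b" "0 < C"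
    and lower: "\<And>x y. x \<in> V \<Longrightarrow> y \<in> V \<Longrightarrow> b * (ra ^ lev y * \<kappa> x (gp x y)) \<le> hit x y"
    and upper: "\<And>x y. x \<in> V \<Longrightarrow> y \<in> V \<Longrightarrow> hit x y \<le> C * (ra ^ lev y * \<kappa> x (gp x y))"
    using hit_estimate by metis
  define \<epsilon> where "\<epsilon> = p0 * (1 - lam)"
  have \<epsilon>: "0 < \<epsilon>" using escape_pos by (simp add: \<epsilon>_def)
  have up: "gr x y \<le> C / \<epsilon> * (ra ^ lev y * \<kappa> x (gp x y))" if "x \<in> V" "y \<in> V" for x y
    using gr_hit(2)[OF that] upper[OF that] \<epsilon> divide_right_mono[OF upper[OF that], of \<epsilon>] by (simp add: \<epsilon>_def)
  have lo: "b * (ra ^ lev y * \<kappa> x (gp x y)) \<le> gr x y" if "x \<in> V" "y \<in> V" for x y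
    using gr_hit(1)[OF that] lower[OF that] by simp
  have \<kappa>_root: "\<kappa> root (gp root y) = 1" if "y \<in> V" for y
    using that r by (simp add: gp_root \<kappa>_def)
  have root: "b * ra ^ lev y \<le> gr root y" "gr root y \<le> C / \<epsilon> * ra ^ lev y" "0 < gr root y" if "y \<in> V" for y
    using lo[OF root_in that] up[OF root_in that] \<kappa>_root[OF that] bC ra
    by (auto intro: less_le_trans[of 0 "b * ra ^ lev y"])
  have 1: "b * \<epsilon> / C * \<kappa> x (gp x y) \<le> mk x y" if xy: "x \<in> V" "y \<in> V" for x y
  proof -
    have "b * \<epsilon> / C * \<kappa> x (gp x y) * gr root y \<le> b * \<epsilon> / C * \<kappa> x (gp x y) * (C / \<epsilon> * ra ^ lev y)"
      using root(2)[OF xy(2)] bC \<epsilon> \<kappa>_pos[of x "gp x y"] by (intro mult_left_mono) auto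
    also have "\<dots> = b * (ra ^ lev y * \<kappa> x (gp x y))" using bC \<epsilon> by simp
    also have "\<dots> \<le> gr x y" by (rule lo[OF xy])
    finally show ?thesis using root(3)[OF xy(2)] by (simp add: mk_eq pos_le_divide_eq)
  qed
  have 2: "mk x y \<le> C / \<epsilon> / b * \<kappa> x (gp x y)" if xy: "x \<in> V" "y \<in> V" for x y
  proof -
    have "gr x y \<le> C / \<epsilon> / b * \<kappa> x (gp x y) * (b * ra ^ lev y)"
      using up[OF xy] bC by (simp add: mult_ac)
    also have "\<dots> \<le> C / \<epsilon> / b * \<kappa> x (gp x y) * gr root y"
      using root(1)[OF xy(2)] bC \<epsilon> \<kappa>_pos[of x "gp x y"] by (intro mult_left_mono) auto
    finally show ?thesis using root(3)[OF xy(2)] by (simp add: mk_eq pos_divide_le_eq)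
  qed
  show ?thesis
    by (rule that[OF _ _ 1 2]) (use bC \<epsilon> in auto)
qed

end

section \<open>The Martin boundary\<close>

context finite_range_chain
begin

text \<open>Let \<open>T\<close> be the supremum of \<open>w / h\<close>. The function \<open>T * h - w\<close> is nonnegative and harmonic, so its value
  at \<open>x\<close> is at least its value at \<open>y k\<close> times the probability of going there. By \<open>rec\<close> this compares the
  deficits: \<open>T - w / h\<close> at \<open>y k\<close> is at most \<open>1 / \<delta>\<close> times its value at \<open>x\<close>, and \<open>x\<close> can be chosen to make
  the latter small.\<close>

lemma ratio_tendsto_Sup:
  assumes h: "\<And>x. x \<in> V \<Longrightarrow> 0 < h x" "\<And>x. x \<in> V \<Longrightarrow> avg h x = h x"
    and w: "\<And>x. x \<in> V \<Longrightarrow> avg w x = w x" and bd: "\<And>x. x \<in> V \<Longrightarrow> w x \<le> C * h x"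
    and y: "\<And>k. y k \<in> V" and \<delta>: "0 < \<delta>"
    and rec: "\<And>x. x \<in> V \<Longrightarrow> \<forall>\<^sub>F k in sequentially. \<delta> * h x \<le> hit x (y k) * h (y k)"
  shows "(\<lambda>k. w (y k) / h (y k)) \<longlonglongrightarrow> (SUP x\<in>V. w x / h x)"
proof -
  define q where "q x = w x / h x" for x
  define T where "T = (SUP x\<in>V. q x)"
  have bdd: "bdd_above (q ` V)"
    using bd h(1) by (intro bdd_aboveI[of _ C]) (auto simp: q_def pos_divide_le_eq)
  have ne: "V \<noteq> {}" using y by auto
  have qT: "q x \<le> T" if "x \<in> V" for x
    unfolding T_def using that bdd by (rule cSUP_upper)
  have wq: "w x = q x * h x" if "x \<in> V" for x using h(1)[OF that] by (simp add: q_def)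
  have lower: "\<forall>\<^sub>F k in sequentially. a < q (y k)" if "a < T" for a
  proof -
    have "T - \<delta> * (T - a) < T" using that \<delta> by simp
    then obtain x where x: "x \<in> V" "T - \<delta> * (T - a) < q x"
      unfolding T_def using less_cSUP_iff[OF ne bdd] by blast
    have "\<forall>\<^sub>F k in sequentially. \<delta> * h x \<le> hit x (y k) * h (y k)" by (rule rec[OF x(1)])
    then show ?thesis
    proof eventually_elim
      case (elim k)
      have "hit x (y k) * (T * h (y k) - w (y k)) \<le> T * h x - w x"
      proof (rule hit_mult_le_superharmonic[OF x(1) y])
        fix z assume z: "z \<in> V"
        show "0 \<le> T * h z - w z"
          using qT[OF z] h(1)[OF z] by (simp add: wq[OF z] flip: left_diff_distrib)
        show "avg (\<lambda>z. T * h z - w z) z \<le> T * h z - w z"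
          using h(2) w z by (simp add: avg_diff avg_cmult)
      qed
      then have "(T - q (y k)) * (hit x (y k) * h (y k)) \<le> (T - q x) * h x"
        unfolding wq[OF y] wq[OF x(1)] by (simp add: algebra_simps)
      moreover have "(T - q (y k)) * (\<delta> * h x) \<le> (T - q (y k)) * (hit x (y k) * h (y k))"
        using elim qT[OF y[of k]] by (intro mult_left_mono) auto
      ultimately have "((T - q (y k)) * \<delta>) * h x \<le> (T - q x) * h x" by (simp only: mult.assoc)
      then have "(T - q (y k)) * \<delta> \<le> T - q x" using h(1)[OF x(1)] by simp
      also have "\<dots> < (T - a) * \<delta>" using x(2) by (simp add: mult.commute)
      finally show ?case using \<delta> by simp
    qed
  qed
  have "(\<lambda>k. q (y k)) \<longlonglongrightarrow> T"
  proof (rule order_tendstoI)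
    fix a assume "T < a"
    then have "q (y k) < a" for k using qT[OF y[of k]] by linarith
    then show "\<forall>\<^sub>F k in sequentially. q (y k) < a" by (rule always_eventually[OF allI])
  qed (rule lower)
  then show ?thesis by (simp add: q_def T_def)
qed

text \<open>Applied to \<open>w\<close> and to \<open>- w\<close>, the previous lemma shows that the supremum and the infimum of \<open>w / h\<close> are
  both its limit along \<open>y\<close>.\<close>

lemma comparable_harmonic_eq:
  assumes h: "\<And>x. x \<in> V \<Longrightarrow> 0 < h x" "\<And>x. x \<in> V \<Longrightarrow> avg h x = h x"
    and w: "\<And>x. x \<in> V \<Longrightarrow> 0 \<le> w x" "\<And>x. x \<in> V \<Longrightarrow> avg w x = w x"
    and bd: "\<And>x. x \<in> V \<Longrightarrow> w x \<le> C * h x"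
    and y: "\<And>k. y k \<in> V" and \<delta>: "0 < \<delta>"
    and rec: "\<And>x. x \<in> V \<Longrightarrow> \<forall>\<^sub>F k in sequentially. \<delta> * h x \<le> hit x (y k) * h (y k)"
    and o: "o' \<in> V" "w o' = h o'" and x: "x \<in> V"
  shows "w x = h x"
proof -
  let ?q = "\<lambda>x. w x / h x"
  have up: "(\<lambda>k. ?q (y k)) \<longlonglongrightarrow> (SUP x\<in>V. ?q x)"
    by (rule ratio_tendsto_Sup[OF h w(2) bd y \<delta> rec])
  have bd': "- w x \<le> 0 * h x" if "x \<in> V" for x using w(1)[OF that] by simp
  have harm': "avg (\<lambda>z. - w z) x = - w x" if "x \<in> V" for x
    using w(2)[OF that] avg_cmult[of "-1" w x] by simp
  have "(\<lambda>k. - w (y k) / h (y k)) \<longlonglongrightarrow> (SUP x\<in>V. - w x / h x)"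
    by (rule ratio_tendsto_Sup[OF h harm' bd' y \<delta> rec])
  then have "(\<lambda>k. - ?q (y k)) \<longlonglongrightarrow> (SUP x\<in>V. - w x / h x)" by simp
  then have eq: "(SUP x\<in>V. - w x / h x) = - (SUP x\<in>V. ?q x)"
    using LIMSEQ_unique[OF tendsto_minus[OF up]] by metis
  have "?q x = (SUP x\<in>V. ?q x)" if x: "x \<in> V" for x
  proof (rule antisym)
    show "?q x \<le> (SUP x\<in>V. ?q x)"
      using bd h(1) x by (intro cSUP_upper bdd_aboveI[of _ C]) (auto simp: pos_divide_le_eq)
    have "- w x / h x \<le> (SUP x\<in>V. - w x / h x)"
      using w(1) h(1) x by (intro cSUP_upper bdd_aboveI[of _ 0]) (auto simp: pos_divide_le_eq less_imp_le)
    then show "(SUP x\<in>V. ?q x) \<le> ?q x" using eq by simp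
  qed
  from this[OF x] this[OF o(1)] show ?thesis
    using o h(1)[OF x] h(1)[OF o(1)] by simp
qed

end

context graded_walk
begin

definition rays :: "(nat \<Rightarrow> 'v) set" where "rays = geodesic_rays V E root"

definition ray_gp :: "(nat \<Rightarrow> 'v) \<Rightarrow> 'v \<Rightarrow> real" where
  "ray_gp t x = lim (\<lambda>n. gp (t n) x)"

definition emb :: "'v \<Rightarrow> 'v martin_point" where "emb = martin_embedding V mk"

definition equiv_rays :: "(nat \<Rightarrow> 'v) \<Rightarrow> (nat \<Rightarrow> 'v) \<Rightarrow> bool" where
  "equiv_rays t u \<longleftrightarrow> filterlim (\<lambda>n. gp (t n) (u n)) at_top sequentially"

lemma ray_in: "t \<in> rays \<Longrightarrow> t n \<in> V"
  unfolding rays_def geodesic_rays_def by auto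

lemma ray_dist: "t \<in> rays \<Longrightarrow> m \<le> n \<Longrightarrow> graph_dist E (t m) (t n) = n - m"
  unfolding rays_def geodesic_rays_def by auto

lemma lev_ray: assumes "t \<in> rays" shows "lev (t n) = n"
proof -
  have "graph_dist E root (t n) = n"
    using ray_dist[OF assms, of 0 n] assms by (simp add: rays_def geodesic_rays_def)
  then show ?thesis
    using gp_root[OF ray_in[OF assms]] by (simp add: gp_def gromov_product_def)
qed

lemma gp_ray_ray: "t \<in> rays \<Longrightarrow> k \<le> n \<Longrightarrow> gp (t n) (t k) = k"
  using ray_dist[of t k n] graph_dist_sym[of "t k" "t n"] ray_in[of t]
  by (simp add: gp_def gromov_product_def lev_ray of_nat_diff)

lemma gp_ray_tendsto: assumes t: "t \<in> rays" and x: "x \<in> V"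
  shows "(\<lambda>n. gp (t n) x) \<longlonglongrightarrow> ray_gp t x" "gp (t n) x \<le> ray_gp t x" "ray_gp t x \<le> lev x"
proof -
  have "incseq (\<lambda>n. gp (t n) x)"
  proof (rule incseq_SucI)
    fix n
    have "graph_dist E (t (Suc n)) x \<le> graph_dist E (t (Suc n)) (t n) + graph_dist E (t n) x"
      by (intro graph_dist_triangle ray_in t x)
    also have "graph_dist E (t (Suc n)) (t n) = 1"
      using ray_dist[OF t, of n "Suc n"] graph_dist_sym[of "t n" "t (Suc n)"] ray_in[OF t] by simp
    finally show "gp (t n) x \<le> gp (t (Suc n)) x"
      by (simp add: gp_def gromov_product_def lev_ray[OF t])
  qed
  moreover have bd: "gp (t n) x \<le> lev x" for n using gp_le_lev[OF ray_in[OF t] x] by blast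
  ultimately obtain g where g: "(\<lambda>n. gp (t n) x) \<longlonglongrightarrow> g" "\<And>n. gp (t n) x \<le> g"
    using incseq_convergent[of "\<lambda>n. gp (t n) x" "lev x"] by metis
  then have "ray_gp t x = g" unfolding ray_gp_def by (intro limI)
  then show "(\<lambda>n. gp (t n) x) \<longlonglongrightarrow> ray_gp t x" "gp (t n) x \<le> ray_gp t x" "ray_gp t x \<le> lev x"
    using g LIMSEQ_le_const2[OF g(1)] bd by auto
qed

lemma ray_gp_ray: assumes "t \<in> rays" shows "ray_gp t (t k) = k"
proof -
  have "\<forall>\<^sub>F n in sequentially. gp (t n) (t k) = k"
    using eventually_ge_at_top[of k] by eventually_elim (rule gp_ray_ray[OF assms])
  then have "(\<lambda>n. gp (t n) (t k)) \<longlonglongrightarrow> k" by (rule tendsto_eventually)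
  then show ?thesis unfolding ray_gp_def by (rule limI)
qed

lemma equiv_rays_refl: assumes "t \<in> rays" shows "equiv_rays t t"
  using filterlim_real_sequentially gp_ray_ray[OF assms order_refl] by (simp add: equiv_rays_def)

lemma equiv_rays_sym: "t \<in> rays \<Longrightarrow> u \<in> rays \<Longrightarrow> equiv_rays t u \<Longrightarrow> equiv_rays u t"
  using gp_sym[OF ray_in ray_in, of t u] by (simp add: equiv_rays_def)

text \<open>In the limit along the rays, the term \<open>r powr gp (t n) (u n)\<close> of \<open>gp_triangle\<close> vanishes.\<close>

lemma ray_gp_equiv:
  obtains \<delta> where "\<And>t u x. t \<in> rays \<Longrightarrow> u \<in> rays \<Longrightarrow> equiv_rays t u \<Longrightarrow> x \<in> V \<Longrightarrow> ray_gp u x \<le> ray_gp t x + \<delta>"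
proof -
  obtain C where C: "0 < C" and tri: "\<And>x y z. x \<in> V \<Longrightarrow> y \<in> V \<Longrightarrow> z \<in> V \<Longrightarrow>
      r powr gp x y \<le> C * (r powr gp x z + r powr gp z y)"
    using gp_triangle by metis
  have "ray_gp u x \<le> ray_gp t x + (- ln C / ln r)"
    if t: "t \<in> rays" and u: "u \<in> rays" and eq: "equiv_rays t u" and x: "x \<in> V" for t u x
  proof -
    have lim: "(\<lambda>n. r powr gp (v n) x) \<longlonglongrightarrow> r powr ray_gp v x" if "v \<in> rays" for v
      using r gp_ray_tendsto[OF that x] by (intro tendsto_intros) auto
    have "(\<lambda>n. exp (gp (t n) (u n) * ln r)) \<longlonglongrightarrow> 0"
      using eq r unfolding equiv_rays_def
      by (intro filterlim_compose[OF exp_at_bot] filterlim_tendsto_neg_mult_at_bot[OF tendsto_const])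
        (simp_all add: mult.commute[of _ "ln r"] filterlim_tendsto_neg_mult_at_bot[OF tendsto_const])
    then have "(\<lambda>n. r powr gp (t n) (u n)) \<longlonglongrightarrow> 0" using r by (simp add: powr_def)
    then have "(\<lambda>n. C * (r powr gp (t n) (u n) + r powr gp (u n) x)) \<longlonglongrightarrow> C * (0 + r powr ray_gp u x)"
      by (intro tendsto_intros lim u)
    then have "r powr ray_gp t x \<le> C * (0 + r powr ray_gp u x)"
      by (rule LIMSEQ_le[OF lim[OF t]]) (auto intro!: exI[of _ 0] tri ray_in t u x)
    then have "ln (r powr ray_gp t x) \<le> ln (C * r powr ray_gp u x)"
      using r by (intro ln_mono) auto
    then have "ray_gp t x * ln r \<le> ln C + ray_gp u x * ln r"
      using r C by (simp add: ln_mult ln_powr)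
    then have "(ray_gp t x - ray_gp u x) * ln r \<le> ln C" by (simp add: algebra_simps)
    then have "ln C / ln r \<le> ray_gp t x - ray_gp u x"
      using r by (simp add: neg_divide_le_eq)
    then show ?thesis by simp
  qed
  then show ?thesis using that by blast
qed

lemma \<kappa>_tendsto: "(f \<longlongrightarrow> g) F \<Longrightarrow> ((\<lambda>n. \<kappa> x (f n)) \<longlongrightarrow> \<kappa> x g) F"
  unfolding \<kappa>_def using r by (intro tendsto_intros) auto

lemma gr_root_pos: assumes y: "y \<in> V" shows "0 < gr root y"
proof -
  obtain b where b: "0 < b" "\<And>x k. x \<in> V \<Longrightarrow> k \<le> lev x \<Longrightarrow> b * ra ^ k \<le> hit ((par ^^ k) x) x"
    using hit_descendant by metis
  have "0 < b * ra ^ lev y" using b ra by simp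
  also have "\<dots> \<le> hit root y" using b(2)[OF y order_refl] ancestor_root[OF y] by simp
  also have "\<dots> \<le> gr root y" by (rule gr_hit[OF root_in y])
  finally show ?thesis .
qed

lemma mk_root: "y \<in> V \<Longrightarrow> mk root y = 1"
  using gr_root_pos[of y] by (simp add: mk_eq)

lemma mk_avg: assumes "x \<in> V" "y \<in> V" "x \<noteq> y" shows "avg (\<lambda>z. mk z y) x = mk x y"
  using gr_eq[OF assms(1,2)] assms(3) avg_cmult[of "1 / gr root y" "\<lambda>z. gr z y" x] by (simp add: mk_eq)

lemma mk_bounded: assumes x: "x \<in> V" shows "bounded (mk x ` V)"
proof -
  obtain b C where C: "0 < b" "0 < C" "\<And>x y. x \<in> V \<Longrightarrow> y \<in> V \<Longrightarrow> b * \<kappa> x (gp x y) \<le> mk x y"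
    "\<And>x y. x \<in> V \<Longrightarrow> y \<in> V \<Longrightarrow> mk x y \<le> C * \<kappa> x (gp x y)"
    using mk_estimate by blast
  have "norm (mk x y) \<le> C * \<kappa> x (lev x)" if y: "y \<in> V" for y
  proof -
    have "0 \<le> mk x y" using C(3)[OF x y] \<kappa>_pos[of x "gp x y"] C(1) by (smt (verit) mult_pos_pos)
    moreover have "mk x y \<le> C * \<kappa> x (lev x)"
      using C(4)[OF x y] \<kappa>_mono[of "gp x y" "lev x" x] gp_le_lev[OF x y] C(2)
      by (smt (verit) mult_left_mono)
    ultimately show ?thesis by simp
  qed
  then show ?thesis by (intro boundedI) auto
qed

lemma compact_emb: "compact (closure (emb ` V))"
  using compact_martin_compactification[OF mk_bounded]
  by (simp add: martin_compactification_def emb_def)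

text \<open>As a function of its first argument the Martin kernel is harmonic except at its pole. Along a ray the pole
  leaves every vertex, so the limits are harmonic.\<close>

lemma limit_point_props:
  assumes t: "t \<in> rays" and \<sigma>: "strict_mono \<sigma>" and lim: "(\<lambda>n. emb (t (\<sigma> n))) \<longlonglongrightarrow> q"
  shows "fst q = (\<lambda>_. 0)" "\<And>x. x \<notin> V \<Longrightarrow> snd q x = 0"
    "\<And>x. x \<in> V \<Longrightarrow> (\<lambda>n. mk x (t (\<sigma> n))) \<longlonglongrightarrow> snd q x"
    "\<And>x. x \<in> V \<Longrightarrow> avg (snd q) x = snd q x" "snd q root = 1"
proof -
  have coord: "(\<lambda>n. fst (emb (t (\<sigma> n))) x) \<longlonglongrightarrow> fst q x" "(\<lambda>n. snd (emb (t (\<sigma> n))) x) \<longlonglongrightarrow> snd q x" for x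
  proof -
    have "continuous_on UNIV (\<lambda>p :: 'v martin_point. fst p x)" "continuous_on UNIV (\<lambda>p :: 'v martin_point. snd p x)"
      by (rule continuous_on_product_then_coordinatewise; intro continuous_intros)+
    then show "(\<lambda>n. fst (emb (t (\<sigma> n))) x) \<longlonglongrightarrow> fst q x" "(\<lambda>n. snd (emb (t (\<sigma> n))) x) \<longlonglongrightarrow> snd q x"
      using lim by (auto elim: continuous_on_tendsto_compose)
  qed
  have away: "\<forall>\<^sub>F n in sequentially. t (\<sigma> n) \<noteq> x" for x
    using eventually_gt_at_top[of "lev x"]
  proof eventually_elim
    case (elim n)
    then have "lev x < \<sigma> n" using seq_suble[OF \<sigma>, of n] by simp
    then show ?case using lev_ray[OF t, of "\<sigma> n"] by auto
  qed
  have "fst q x = 0" for x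
  proof -
    have "(\<lambda>n. fst (emb (t (\<sigma> n))) x) \<longlonglongrightarrow> 0"
      using away[of x] by (intro tendsto_eventually) (auto simp: emb_def martin_embedding_def elim!: eventually_mono)
    then show ?thesis using coord(1) LIMSEQ_unique by blast
  qed
  then show "fst q = (\<lambda>_. 0)" by auto
  show "snd q x = 0" if "x \<notin> V" for x
    using coord(2)[of x] that LIMSEQ_unique[OF _ tendsto_const] by (simp add: emb_def martin_embedding_def)
  show mk: "(\<lambda>n. mk x (t (\<sigma> n))) \<longlonglongrightarrow> snd q x" if "x \<in> V" for x
    using coord(2)[of x] that by (simp add: emb_def martin_embedding_def)
  show "avg (snd q) x = snd q x" if x: "x \<in> V" for x
  proof -
    have "(\<lambda>n. avg (\<lambda>z. mk z (t (\<sigma> n))) x) \<longlonglongrightarrow> avg (snd q) x"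
      using x by (intro avg_tendsto mk) (auto dest: nb_in)
    moreover have "\<forall>\<^sub>F n in sequentially. avg (\<lambda>z. mk z (t (\<sigma> n))) x = mk x (t (\<sigma> n))"
      using away[of x] by eventually_elim (use mk_avg[OF x ray_in[OF t]] in auto)
    ultimately have "(\<lambda>n. mk x (t (\<sigma> n))) \<longlonglongrightarrow> avg (snd q) x"
      by (simp add: tendsto_cong)
    then show ?thesis using mk[OF x] LIMSEQ_unique by blast
  qed
  have "(\<lambda>n. mk root (t (\<sigma> n))) \<longlonglongrightarrow> 1" by (simp add: mk_root ray_in[OF t])
  then show "snd q root = 1" using mk[OF root_in] LIMSEQ_unique by blast
qed

lemma limit_point_estimate:
  obtains b C where "0 < b" "0 < C"
    "\<And>t \<sigma> q x. t \<in> rays \<Longrightarrow> strict_mono \<sigma> \<Longrightarrow> (\<lambda>n. emb (t (\<sigma> n))) \<longlonglongrightarrow> q \<Longrightarrow> x \<in> V \<Longrightarrow>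
      b * \<kappa> x (ray_gp t x) \<le> snd q x \<and> snd q x \<le> C * \<kappa> x (ray_gp t x)"
proof -
  obtain b C where C: "0 < b" "0 < C" "\<And>x y. x \<in> V \<Longrightarrow> y \<in> V \<Longrightarrow> b * \<kappa> x (gp x y) \<le> mk x y"
    "\<And>x y. x \<in> V \<Longrightarrow> y \<in> V \<Longrightarrow> mk x y \<le> C * \<kappa> x (gp x y)"
    using mk_estimate by blast
  have *: "b * \<kappa> x (ray_gp t x) \<le> snd q x \<and> snd q x \<le> C * \<kappa> x (ray_gp t x)"
    if t: "t \<in> rays" and \<sigma>: "strict_mono \<sigma>" and lim: "(\<lambda>n. emb (t (\<sigma> n))) \<longlonglongrightarrow> q" and x: "x \<in> V" for t \<sigma> q x
  proof -
    have mk: "(\<lambda>n. mk x (t (\<sigma> n))) \<longlonglongrightarrow> snd q x"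
      by (rule limit_point_props(3)[OF t \<sigma> lim x])
    have "(\<lambda>n. gp (t (\<sigma> n)) x) \<longlonglongrightarrow> ray_gp t x"
      using LIMSEQ_subseq_LIMSEQ[OF gp_ray_tendsto(1)[OF t x] \<sigma>] by (simp add: o_def)
    then have "(\<lambda>n. gp x (t (\<sigma> n))) \<longlonglongrightarrow> ray_gp t x"
      using gp_sym[OF x ray_in[OF t]] by simp
    then have \<kappa>: "(\<lambda>n. A * \<kappa> x (gp x (t (\<sigma> n)))) \<longlonglongrightarrow> A * \<kappa> x (ray_gp t x)" for A
      by (intro tendsto_intros \<kappa>_tendsto)
    show ?thesis
      using LIMSEQ_le[OF \<kappa> mk] LIMSEQ_le[OF mk \<kappa>] C(3,4)[OF x ray_in[OF t]] by blast
  qed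
  show ?thesis by (rule that[OF C(1,2) *])
qed

text \<open>Both limits have the same order of magnitude because the Gromov products with equivalent rays differ by a
  bounded amount. The hypothesis \<open>rec\<close> of \<open>comparable_harmonic_eq\<close> holds along \<open>u\<close> because \<open>hit x (u k)\<close> has
  order \<open>ra ^ k * \<kappa> x (ray_gp u x)\<close> for large \<open>k\<close>, while the limit at \<open>u k\<close> has order \<open>1 / ra ^ k\<close>.\<close>

lemma limit_point_unique:
  assumes t: "t \<in> rays" and u: "u \<in> rays" and tu: "equiv_rays t u"
    and \<sigma>: "strict_mono \<sigma>" and q: "(\<lambda>n. emb (t (\<sigma> n))) \<longlonglongrightarrow> q"
    and \<tau>: "strict_mono \<tau>" and p: "(\<lambda>n. emb (u (\<tau> n))) \<longlonglongrightarrow> p"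
  shows "q = p"
proof -
  note P = limit_point_props[OF u \<tau> p] and Q = limit_point_props[OF t \<sigma> q]
  obtain b C where bC: "0 < b" "0 < C" and est: "\<And>t \<sigma> q x. t \<in> rays \<Longrightarrow> strict_mono \<sigma> \<Longrightarrow>
      (\<lambda>n. emb (t (\<sigma> n))) \<longlonglongrightarrow> q \<Longrightarrow> x \<in> V \<Longrightarrow>
      b * \<kappa> x (ray_gp t x) \<le> snd q x \<and> snd q x \<le> C * \<kappa> x (ray_gp t x)"
    using limit_point_estimate by blast
  obtain b' C' where b': "0 < b'" and hit_lo: "\<And>x y. x \<in> V \<Longrightarrow> y \<in> V \<Longrightarrow> b' * (ra ^ lev y * \<kappa> x (gp x y)) \<le> hit x y"
    using hit_estimate by metis
  obtain \<delta> where \<delta>: "\<And>t u x. t \<in> rays \<Longrightarrow> u \<in> rays \<Longrightarrow> equiv_rays t u \<Longrightarrow> x \<in> V \<Longrightarrow> ray_gp u x \<le> ray_gp t x + \<delta>"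
    using ray_gp_equiv by blast
  have estP: "b * \<kappa> x (ray_gp u x) \<le> snd p x" "snd p x \<le> C * \<kappa> x (ray_gp u x)" if "x \<in> V" for x
    using est[OF u \<tau> p that] by auto
  have posP: "0 < snd p x" if "x \<in> V" for x
    using estP(1)[OF that] bC \<kappa>_pos[of x "ray_gp u x"] by (smt (verit) mult_pos_pos)
  have eq: "snd q x = snd p x" if x: "x \<in> V" for x
  proof (rule comparable_harmonic_eq[where y = u and o' = root and \<delta> = "b * b' / (2 * C)"
        and C = "C * r powr (- (s * \<delta>)) / b"])
    fix x assume x: "x \<in> V"
    have est': "b * \<kappa> x (ray_gp t x) \<le> snd q x" "snd q x \<le> C * \<kappa> x (ray_gp t x)"
      using est[OF t \<sigma> q x] by auto
    show "0 \<le> snd q x"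
      using est'(1) bC \<kappa>_pos[of x "ray_gp t x"] by (smt (verit) mult_pos_pos)
    have "\<kappa> x (ray_gp t x) \<le> \<kappa> x (ray_gp u x + \<delta>)"
      by (rule \<kappa>_mono[OF \<delta>[OF u t equiv_rays_sym[OF t u tu] x]])
    also have "\<dots> = r powr (- (s * \<delta>)) * \<kappa> x (ray_gp u x)" by (rule \<kappa>_shift)
    finally have "snd q x \<le> C * (r powr (- (s * \<delta>)) * \<kappa> x (ray_gp u x))"
      using est'(2) bC by (smt (verit) mult_left_mono)
    also have "\<dots> = C * r powr (- (s * \<delta>)) / b * (b * \<kappa> x (ray_gp u x))" using bC by simp
    also have "\<dots> \<le> C * r powr (- (s * \<delta>)) / b * snd p x"
      using estP(1)[OF x] bC r by (intro mult_left_mono) auto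
    finally show "snd q x \<le> C * r powr (- (s * \<delta>)) / b * snd p x" .
    have "(\<lambda>k. \<kappa> x (gp x (u k))) \<longlonglongrightarrow> \<kappa> x (ray_gp u x)"
      using gp_ray_tendsto(1)[OF u x] gp_sym[OF x ray_in[OF u]] by (intro \<kappa>_tendsto) simp
    then have "\<forall>\<^sub>F k in sequentially. \<kappa> x (ray_gp u x) / 2 < \<kappa> x (gp x (u k))"
      using \<kappa>_pos[of x "ray_gp u x"] by (intro order_tendstoD(1)) auto
    then show "\<forall>\<^sub>F k in sequentially. b * b' / (2 * C) * snd p x \<le> hit x (u k) * snd p (u k)"
    proof eventually_elim
      case (elim k)
      have one: "ra ^ k * \<kappa> (u k) (ray_gp u (u k)) = 1"
      proof -
        have "(ra * lam) ^ k = r powr (s * k)"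
          using r by (simp add: powr_powr flip: r_powr_s powr_realpow)
        then have "ra ^ k * lam ^ k * r powr (- (s * k)) = 1"
          using r by (simp add: power_mult_distrib flip: powr_add)
        then show ?thesis by (simp add: \<kappa>_def ray_gp_ray[OF u] lev_ray[OF u] mult_ac)
      qed
      have "b * b' / (2 * C) * snd p x \<le> b * b' / (2 * C) * (C * \<kappa> x (ray_gp u x))"
        using estP(2)[OF x] bC b' by (intro mult_left_mono) auto
      also have "\<dots> = b * b' * (\<kappa> x (ray_gp u x) / 2)" using bC by simp
      also have "\<dots> \<le> b * b' * \<kappa> x (gp x (u k))"
        using elim bC b' by (intro mult_left_mono) auto
      also have "\<dots> = b * b' * \<kappa> x (gp x (u k)) * (ra ^ k * \<kappa> (u k) (ray_gp u (u k)))"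
        by (simp add: one)
      also have "\<dots> = b' * (ra ^ lev (u k) * \<kappa> x (gp x (u k))) * (b * \<kappa> (u k) (ray_gp u (u k)))"
        by (simp add: lev_ray[OF u])
      also have "\<dots> \<le> hit x (u k) * snd p (u k)"
        using hit_lo[OF x ray_in[OF u]] estP(1)[OF ray_in[OF u]] hit_nonneg[OF x] bC \<kappa>_pos
        by (intro mult_mono) (auto intro: less_imp_le)
      finally show ?case .
    qed
  qed (use P Q posP bC b' ray_in[OF u] root_in x in auto)
  have "snd q = snd p"
  proof
    fix x show "snd q x = snd p x" using eq P(2) Q(2) by (cases "x \<in> V") auto
  qed
  then show ?thesis using P(1) Q(1) by (simp add: prod_eq_iff)
qed

definition hbd :: "(nat \<Rightarrow> 'v) set set" where "hbd = hyperbolic_boundary lev V E root"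

lemma hbd_class: assumes "\<xi> \<in> hbd"
  obtains t where "t \<in> rays" "t \<in> \<xi>" "\<And>u. u \<in> \<xi> \<Longrightarrow> u \<in> rays \<and> equiv_rays t u"
proof -
  obtain t where t: "t \<in> rays" "\<xi> = {u. t \<in> rays \<and> u \<in> rays \<and> equiv_rays t u}"
    using assms unfolding hbd_def hyperbolic_boundary_def quotient_def rays_def equiv_rays_def gp_def
    by auto
  show ?thesis
    by (rule that[of t]) (use t equiv_rays_refl[OF t(1)] in auto)
qed

text \<open>The closure of the embedded vertices is compact and metrizable, so a sequence whose
  convergent subsequences all have the same limit converges.\<close>

theorem martin_boundary_point:
  assumes \<xi>: "\<xi> \<in> hbd"
  obtains q where "martin_point_of V mk \<xi> = q" "\<And>u. u \<in> \<xi> \<Longrightarrow> (\<lambda>n. emb (u n)) \<longlonglongrightarrow> q"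
proof -
  obtain t where t: "t \<in> rays" "t \<in> \<xi>" and cls: "\<And>u. u \<in> \<xi> \<Longrightarrow> u \<in> rays \<and> equiv_rays t u"
    using hbd_class[OF \<xi>] by blast
  let ?K = "closure (emb ` V)"
  have inK: "emb (u n) \<in> ?K" if "u \<in> rays" for u n
    by (rule subsetD[OF closure_subset imageI[OF ray_in[OF that]]])
  have sub: "\<exists>q \<tau>. q \<in> ?K \<and> strict_mono \<tau> \<and> (\<lambda>n. emb (u (\<sigma> (\<tau> n)))) \<longlonglongrightarrow> q" if u: "u \<in> rays" for u and \<sigma> :: "nat \<Rightarrow> nat"
  proof -
    have "seq_compact ?K" using compact_emb by (simp only: compact_eq_seq_compact_metric)
    then obtain p \<tau> where "p \<in> ?K" "strict_mono \<tau>" "((\<lambda>n. emb (u (\<sigma> n))) \<circ> \<tau>) \<longlonglongrightarrow> p"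
      using inK[OF u] by (elim seq_compactE[where f = "\<lambda>n. emb (u (\<sigma> n))"]) auto
    then show ?thesis unfolding o_def by blast
  qed
  obtain q \<tau> where q: "q \<in> ?K" "strict_mono \<tau>" "(\<lambda>n. emb (t (\<tau> n))) \<longlonglongrightarrow> q"
    using sub[OF t(1), of id] by auto
  have conv: "(\<lambda>n. emb (u n)) \<longlonglongrightarrow> q" if u\<xi>: "u \<in> \<xi>" for u
  proof (rule ccontr)
    assume "\<not> (\<lambda>n. emb (u n)) \<longlonglongrightarrow> q"
    then obtain e where e: "0 < e" "\<not> (\<forall>\<^sub>F n in sequentially. dist (emb (u n)) q < e)"
      unfolding tendsto_iff by blast
    then have "\<exists>\<^sub>F n in sequentially. e \<le> dist (emb (u n)) q"
      by (simp add: not_eventually not_less)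
    then have "infinite {n. e \<le> dist (emb (u n)) q}"
      by (simp add: frequently_cofinite flip: cofinite_eq_sequentially)
    then obtain \<sigma> :: "nat \<Rightarrow> nat" where \<sigma>: "strict_mono \<sigma>" "\<And>n. e \<le> dist (emb (u (\<sigma> n))) q"
      using infinite_enumerate by blast
    obtain p \<tau>' where p: "strict_mono \<tau>'" "(\<lambda>n. emb (u (\<sigma> (\<tau>' n)))) \<longlonglongrightarrow> p"
      using sub[of u \<sigma>] cls[OF u\<xi>] by blast
    have "q = p"
      by (rule limit_point_unique[of t u \<tau> q "\<sigma> \<circ> \<tau>'"])
        (use t cls[OF u\<xi>] q p strict_mono_o[OF \<sigma>(1) p(1)] in \<open>auto simp: o_def\<close>)
    have "(\<lambda>n. dist (emb (u (\<sigma> (\<tau>' n)))) q) \<longlonglongrightarrow> 0"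
      unfolding \<open>q = p\<close> using p(2) by (rule tendsto_dist_iff[THEN iffD1])
    then have "\<forall>\<^sub>F n in sequentially. dist (emb (u (\<sigma> (\<tau>' n)))) q < e"
      using e(1) by (intro order_tendstoD(2)) auto
    then obtain n where "dist (emb (u (\<sigma> (\<tau>' n)))) q < e"
      using eventually_happens trivial_limit_sequentially by blast
    then show False using \<sigma>(2)[of "\<tau>' n"] by simp
  qed
  have "q \<notin> emb ` V"
  proof
    assume "q \<in> emb ` V"
    then obtain y where "q = emb y" by blast
    then have "fst q y = 1" by (simp add: emb_def martin_embedding_def)
    then show False using limit_point_props(1)[OF t(1) q(2,3)] by simp
  qed
  then have qb: "q \<in> martin_boundary V mk"
    using q(1) by (simp add: martin_boundary_def martin_compactification_def emb_def)
  have "martin_point_of V mk \<xi> = q"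
    unfolding martin_point_of_def
  proof (rule the_equality)
    show "q \<in> martin_boundary V mk \<and> (\<forall>s\<in>\<xi>. (\<lambda>n. martin_embedding V mk (s n)) \<longlonglongrightarrow> q)"
      using qb conv by (simp add: emb_def)
    fix p assume "p \<in> martin_boundary V mk \<and> (\<forall>s\<in>\<xi>. (\<lambda>n. martin_embedding V mk (s n)) \<longlonglongrightarrow> p)"
    then have "(\<lambda>n. emb (t n)) \<longlonglongrightarrow> p" using t by (simp add: emb_def)
    then show "p = q" using conv[OF t(2)] LIMSEQ_unique by blast
  qed
  then show ?thesis using that conv by blast
qed

text \<open>The supremum over the rays of the class that defines the Gromov product differs from its value for one
  ray by a bounded amount.\<close>

theorem boundary_kernel_estimate:
  obtains b C where "0 < b" "0 < C"
    "\<And>x \<xi>. x \<in> V \<Longrightarrow> \<xi> \<in> hbd \<Longrightarrow> b * \<kappa> x (gromov_product_boundary lev E x \<xi>) \<le> martin_kernel_boundary V prob root x \<xi>"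
    "\<And>x \<xi>. x \<in> V \<Longrightarrow> \<xi> \<in> hbd \<Longrightarrow> martin_kernel_boundary V prob root x \<xi> \<le> C * \<kappa> x (gromov_product_boundary lev E x \<xi>)"
proof -
  obtain b C where bC: "0 < b" "0 < C" and est: "\<And>t \<sigma> q x. t \<in> rays \<Longrightarrow> strict_mono \<sigma> \<Longrightarrow>
      (\<lambda>n. emb (t (\<sigma> n))) \<longlonglongrightarrow> q \<Longrightarrow> x \<in> V \<Longrightarrow>
      b * \<kappa> x (ray_gp t x) \<le> snd q x \<and> snd q x \<le> C * \<kappa> x (ray_gp t x)"
    using limit_point_estimate by blast
  obtain \<delta> where \<delta>: "\<And>t u x. t \<in> rays \<Longrightarrow> u \<in> rays \<Longrightarrow> equiv_rays t u \<Longrightarrow> x \<in> V \<Longrightarrow> ray_gp u x \<le> ray_gp t x + \<delta>"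
    using ray_gp_equiv by blast
  have *: "b * r powr (s * \<delta>) * \<kappa> x (gromov_product_boundary lev E x \<xi>) \<le> martin_kernel_boundary V prob root x \<xi> \<and>
      martin_kernel_boundary V prob root x \<xi> \<le> C * \<kappa> x (gromov_product_boundary lev E x \<xi>)"
    if x: "x \<in> V" and \<xi>: "\<xi> \<in> hbd" for x \<xi>
  proof -
    obtain t where t: "t \<in> rays" "t \<in> \<xi>" and cls: "\<And>u. u \<in> \<xi> \<Longrightarrow> u \<in> rays \<and> equiv_rays t u"
      using hbd_class[OF \<xi>] by blast
    obtain q where q: "martin_point_of V mk \<xi> = q" "\<And>u. u \<in> \<xi> \<Longrightarrow> (\<lambda>n. emb (u n)) \<longlonglongrightarrow> q"
      using martin_boundary_point[OF \<xi>] by blast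
    have val: "martin_kernel_boundary V prob root x \<xi> = snd q x"
      using q(1) by (simp add: martin_kernel_boundary_def martin_extension_def mk_def)
    define g where "g = gromov_product_boundary lev E x \<xi>"
    have g: "g = (SUP u\<in>\<xi>. ray_gp u x)"
      by (simp add: g_def gromov_product_boundary_def ray_gp_def gp_def)
    have "bdd_above ((\<lambda>u. ray_gp u x) ` \<xi>)"
      using gp_ray_tendsto(3)[OF _ x] cls by (intro bdd_aboveI[of _ "real (lev x)"]) auto
    then have lo: "ray_gp t x \<le> g" unfolding g using t(2) by (intro cSUP_upper)
    have hi: "g \<le> ray_gp t x + \<delta>"
      unfolding g using t cls \<delta>[OF t(1) _ _ x] by (intro cSUP_least) auto
    have e: "b * \<kappa> x (ray_gp t x) \<le> snd q x" "snd q x \<le> C * \<kappa> x (ray_gp t x)"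
      using est[OF t(1) strict_mono_id _ x, of q] q(2)[OF t(2)] by auto
    have "r powr (s * \<delta>) * \<kappa> x g \<le> r powr (s * \<delta>) * \<kappa> x (ray_gp t x + \<delta>)"
      using \<kappa>_mono[OF hi] r by (intro mult_left_mono) auto
    also have "\<dots> = \<kappa> x (ray_gp t x)"
      using r by (simp add: \<kappa>_shift flip: mult.assoc powr_add)
    finally have "b * (r powr (s * \<delta>) * \<kappa> x g) \<le> b * \<kappa> x (ray_gp t x)"
      using bC by (intro mult_left_mono) auto
    moreover have "C * \<kappa> x (ray_gp t x) \<le> C * \<kappa> x g"
      using \<kappa>_mono[OF lo] bC by (intro mult_left_mono) auto
    ultimately show ?thesis using e val by (simp add: g_def mult_ac)
  qed
  show ?thesis
  proof (rule that)
    show "0 < b * r powr (s * \<delta>)" "0 < C" using bC r by auto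
  qed (use * in blast)+
qed

end

section \<open>Words and cylinder sets of a self-similar iterated function system\<close>

locale osc_ifs =
  fixes N :: nat and S :: "nat \<Rightarrow> 'a::euclidean_space \<Rightarrow> 'a" and \<rho> :: "nat \<Rightarrow> real"
    and K :: "'a set" and \<alpha> :: real
  assumes ifs: "similitude_ifs N S \<rho>" and osc: "open_set_condition N S"
    and self_similar: "self_similar_set N S K" and dim: "(\<Sum>i=1..N. \<rho> i powr \<alpha>) = 1"
begin

definition r :: real where "r = min_ratio N \<rho>"

abbreviation words :: "nat list set" where "words \<equiv> lists {1..N}"
abbreviation wr :: "nat list \<Rightarrow> real" where "wr \<equiv> word_ratio \<rho>"
abbreviation J :: "nat \<Rightarrow> nat list set" where "J \<equiv> level_set N \<rho>"

lemma N: "2 \<le> N" and \<rho>: "i \<in> {1..N} \<Longrightarrow> 0 < \<rho> i" "i \<in> {1..N} \<Longrightarrow> \<rho> i < 1"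
  and dist_S: "i \<in> {1..N} \<Longrightarrow> dist (S i u) (S i v) = \<rho> i * dist u v"
  using ifs unfolding similitude_ifs_def by auto

lemma r_le: "i \<in> {1..N} \<Longrightarrow> r \<le> \<rho> i"
  unfolding r_def min_ratio_def by (intro Min_le) auto

lemma r: "0 < r" "r < 1"
proof -
  have "r \<in> \<rho> ` {1..N}" unfolding r_def min_ratio_def using N by (intro Min_in) auto
  then show "0 < r" "r < 1" using \<rho> by auto
qed

lemma \<alpha>: "0 < \<alpha>"
proof (rule ccontr)
  assume "\<not> 0 < \<alpha>"
  have "1 \<le> \<rho> i powr \<alpha>" if "i \<in> {1..N}" for i
    using powr_mono'[of \<alpha> 0 "\<rho> i"] \<rho>[OF that] \<open>\<not> 0 < \<alpha>\<close> by simp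
  then have "(\<Sum>i=1..N. 1) \<le> (\<Sum>i=1..N. \<rho> i powr \<alpha>)" by (intro sum_mono)
  then show False using dim N by simp
qed

subsection \<open>Ratios, levels and parents\<close>

lemma wr_simps [simp]: "wr [] = 1" "wr (i # x) = \<rho> i * wr x" "wr (x @ y) = wr x * wr y"
  by (simp_all add: word_ratio_def)

lemma wr_pos: "x \<in> words \<Longrightarrow> 0 < wr x"
  by (induction x) (auto simp: \<rho>)

lemma wr_le_1: "x \<in> words \<Longrightarrow> wr x \<le> 1"
proof (induction x)
  case (Cons i x)
  then have "\<rho> i * wr x \<le> 1 * 1"
    using \<rho>[of i] wr_pos[of x] by (intro mult_mono) auto
  then show ?case by simp
qed auto

lemma wr_antimono: assumes "prefix x y" "y \<in> words" shows "wr y \<le> wr x"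
proof -
  obtain z where z: "y = x @ z" using assms by (auto elim: prefixE)
  then have "wr x * wr z \<le> wr x * 1"
    using assms wr_le_1[of z] wr_pos[of x] by (intro mult_left_mono) auto
  then show ?thesis using z by simp
qed

lemma prefix_butlast: assumes "prefix x y" "x \<noteq> y" shows "prefix x (butlast y)"
proof -
  obtain z where z: "y = x @ z" using assms by (auto elim: prefixE)
  then have "z \<noteq> []" using assms by auto
  then show ?thesis using z by (simp add: butlast_append)
qed

lemma butlast_words: "x \<in> words \<Longrightarrow> butlast x \<in> words"
  by (auto dest: in_set_butlastD)

lemma J_words: "x \<in> J n \<Longrightarrow> x \<in> words"
  by (auto simp: level_set_def split: if_splits)

lemma J_iff: "0 < n \<Longrightarrow> x \<in> J n \<longleftrightarrow> x \<in> words \<and> x \<noteq> [] \<and> wr x \<le> r ^ n \<and> r ^ n < wr (butlast x)"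
  by (auto simp: level_set_def r_def)

lemma J_0 [simp]: "J 0 = {[]}"
  by (simp add: level_set_def)

lemma J_ratio: assumes "x \<in> J n" shows "r ^ Suc n < wr x" "wr x \<le> r ^ n"
proof -
  have "r ^ Suc n < wr x \<and> wr x \<le> r ^ n"
  proof (cases "n = 0")
    case False
    then have x: "x \<in> words" "x \<noteq> []" "wr x \<le> r ^ n" "r ^ n < wr (butlast x)"
      using assms J_iff by auto
    have l: "last x \<in> {1..N}" using x last_in_set[of x] by auto
    have "wr x = wr (butlast x) * \<rho> (last x)"
      using wr_simps(3)[of "butlast x" "[last x]"] x by simp
    moreover have "r ^ n * r < wr (butlast x) * \<rho> (last x)"
      using x(4) r_le[OF l] r by (intro mult_less_le_imp_less) auto
    ultimately show ?thesis using x by (simp add: mult.commute)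
  qed (use assms r in auto)
  then show "r ^ Suc n < wr x" "wr x \<le> r ^ n" by auto
qed

lemma J_unique: assumes "x \<in> J n" "x \<in> J m" shows "n = m"
proof -
  have "\<not> k < l" if "x \<in> J k" "x \<in> J l" for k l
  proof
    assume "k < l"
    then have "r ^ l \<le> r ^ Suc k" using r by (intro power_decreasing) auto
    then show False using J_ratio(1)[OF that(1)] J_ratio(2)[OF that(2)] by linarith
  qed
  then show ?thesis using assms by (meson linorder_neqE_nat)
qed

lemma level_eq: "x \<in> J n \<Longrightarrow> level N \<rho> x = n"
  unfolding level_def using J_unique by blast

lemma vertices_iff: "x \<in> vertices N \<rho> \<longleftrightarrow> x \<in> J (level N \<rho> x)"
  unfolding vertices_def using level_eq by auto

lemma J_vertices: "x \<in> J n \<Longrightarrow> x \<in> vertices N \<rho>"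
  unfolding vertices_def by auto

lemma root_vertex: "[] \<in> vertices N \<rho>" "level N \<rho> [] = 0"
  using J_vertices[of "[]" 0] level_eq[of "[]" 0] by auto

lemma J_antichain: assumes "x \<in> J n" "y \<in> J n" "prefix x y" shows "x = y"
proof (rule ccontr)
  assume "x \<noteq> y"
  then have p: "prefix x (butlast y)" using prefix_butlast assms by blast
  have "n \<noteq> 0" using \<open>x \<noteq> y\<close> assms by (metis J_0 singletonD)
  then have "wr (butlast y) \<le> wr x" "r ^ n < wr (butlast y)"
    using wr_antimono[OF p] butlast_words J_words[OF assms(2)] assms(2) J_iff[of n y] by auto
  then show False using J_ratio(2)[OF assms(1)] by linarith
qed

text \<open>The shortest prefix whose ratio is at most \<open>r ^ n\<close>.\<close>

lemma ancestor_exists: assumes x: "x \<in> words" "wr x \<le> r ^ n" shows "\<exists>y. prefix y x \<and> y \<in> J n"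
proof (cases "n = 0")
  case False
  define k where "k = (LEAST k. wr (take k x) \<le> r ^ n)"
  have k: "wr (take k x) \<le> r ^ n"
    unfolding k_def by (rule LeastI[of _ "length x"]) (use x in simp)
  have le: "k \<le> length x" unfolding k_def by (rule Least_le) (use x in simp)
  have "r ^ n < 1" using r False by (simp add: power_less_one_iff)
  then have "k \<noteq> 0" using k by (metis take0 wr_simps(1) not_less)
  then have "k - 1 < k" by simp
  then have "r ^ n < wr (take (k - 1) x)"
    unfolding k_def using not_less_Least[of "k - 1" "\<lambda>k. wr (take k x) \<le> r ^ n"] by (simp add: k_def)
  moreover have "butlast (take k x) = take (k - 1) x"
    using le by (rule butlast_take)
  moreover have "take k x \<noteq> []" using le \<open>k \<noteq> 0\<close> by auto
  moreover have "take k x \<in> words" using x by (auto dest: in_set_takeD)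
  ultimately have "take k x \<in> J n" using False k J_iff[of n "take k x"] by simp
  then show ?thesis using take_is_prefix by blast
qed auto

lemma parent_eqI: assumes "x \<in> J (Suc n)" "prefix y x" "y \<in> J n" shows "parent N \<rho> x = y"
  unfolding parent_def level_eq[OF assms(1)]
proof (rule the_equality)
  show "prefix y x \<and> y \<in> J (Suc n - 1)" using assms by simp
  fix z assume "prefix z x \<and> z \<in> J (Suc n - 1)"
  then show "z = y" using assms J_antichain[of z n y] J_antichain[of y n z] prefix_same_cases[of z x y] by auto
qed

lemma parent: assumes "x \<in> J (Suc n)" shows "prefix (parent N \<rho> x) x" "parent N \<rho> x \<in> J n"
proof -
  have "r ^ Suc n \<le> r ^ n" using r by (intro power_decreasing) auto
  then have "wr x \<le> r ^ n" using J_ratio(2)[OF assms] by linarith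
  then obtain y where y: "prefix y x" "y \<in> J n" using ancestor_exists J_words[OF assms] by blast
  then show "prefix (parent N \<rho> x) x" "parent N \<rho> x \<in> J n" using parent_eqI[OF assms] by auto
qed

lemma vertex_Suc: assumes "x \<in> vertices N \<rho>" "x \<noteq> []"
  shows "x \<in> J (Suc (level N \<rho> x - 1))" "0 < level N \<rho> x"
proof -
  have "level N \<rho> x \<noteq> 0" using assms vertices_iff[of x] by (metis J_0 singletonD)
  then show "x \<in> J (Suc (level N \<rho> x - 1))" "0 < level N \<rho> x" using assms vertices_iff[of x] by auto
qed

subsection \<open>The mass of a cut set\<close>

text \<open>The words extending \<open>x\<close> at which the ratio first drops to at most \<open>t\<close>. For a vertex \<open>x\<close> of level \<open>n\<close> and
  \<open>t = r ^ Suc n\<close> these are the children of \<open>x\<close>.\<close>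

definition cut :: "real \<Rightarrow> nat list \<Rightarrow> nat list set" where
  "cut t x = {y \<in> words. prefix x y \<and> wr y \<le> t \<and> t < wr (butlast y)}"

lemma cut_step:
  assumes x: "x \<in> words" "t < wr x"
  shows "cut t x = (\<Union>i\<in>{1..N}. if wr (x @ [i]) \<le> t then {x @ [i]} else cut t (x @ [i]))"
proof (intro equalityI subsetI)
  fix y assume y: "y \<in> cut t x"
  then obtain w where w: "y = x @ w" by (auto simp: cut_def elim: prefixE)
  have "w \<noteq> []" using y w x by (auto simp: cut_def)
  then obtain i z where z: "y = x @ [i] @ z" using w by (cases w) auto
  have i: "i \<in> {1..N}" using y z by (auto simp: cut_def)
  have "z = []" if "wr (x @ [i]) \<le> t"
  proof (rule ccontr)
    assume "z \<noteq> []"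
    then have "prefix (x @ [i]) (butlast y)" using z prefix_butlast[of "x @ [i]" y] by auto
    then have "wr (butlast y) \<le> wr (x @ [i])"
      using wr_antimono butlast_words y unfolding cut_def by blast
    then show False using that y by (simp add: cut_def)
  qed
  then have "y \<in> (if wr (x @ [i]) \<le> t then {x @ [i]} else cut t (x @ [i]))"
    using y z unfolding cut_def by auto
  then show "y \<in> (\<Union>i\<in>{1..N}. if wr (x @ [i]) \<le> t then {x @ [i]} else cut t (x @ [i]))"
    using i by blast
next
  fix y assume "y \<in> (\<Union>i\<in>{1..N}. if wr (x @ [i]) \<le> t then {x @ [i]} else cut t (x @ [i]))"
  then obtain i where i: "i \<in> {1..N}" "y \<in> (if wr (x @ [i]) \<le> t then {x @ [i]} else cut t (x @ [i]))"
    by blast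
  show "y \<in> cut t x"
  proof (cases "wr (x @ [i]) \<le> t")
    case True
    then show ?thesis using i x by (simp add: cut_def butlast_append)
  next
    case False
    then have "y \<in> cut t (x @ [i])" using i by simp
    then show ?thesis using append_prefixD[of x "[i]" y] by (simp add: cut_def)
  qed
qed

text \<open>Since \<open>\<Sum>\<^sub>i \<rho>\<^sub>i\<^sup>\<alpha> = 1\<close>, replacing a word by its one-letter extensions preserves the mass. The ratios shrink
  geometrically, so the cut set is reached after finitely many replacements.\<close>

lemma cut_mass:
  assumes "0 < t" "x \<in> words" "t < wr x"
  shows "finite (cut t x) \<and> (\<Sum>y\<in>cut t x. wr y powr \<alpha>) = wr x powr \<alpha>"
proof -
  define m where "m = Max (\<rho> ` {1..N})"
  have mi: "\<rho> i \<le> m" if "i \<in> {1..N}" for i unfolding m_def using that by (intro Max_ge) auto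
  have "m \<in> \<rho> ` {1..N}" unfolding m_def using N by (intro Max_in) auto
  then have m: "0 < m" "m < 1" using \<rho> by auto
  have main: "finite (cut t x) \<and> (\<Sum>y\<in>cut t x. wr y powr \<alpha>) = wr x powr \<alpha>"
    if "x \<in> words" "t < wr x" "wr x * m ^ k \<le> t" for x k
    using that
  proof (induction k arbitrary: x)
    case (Suc k)
    let ?D = "\<lambda>i. if wr (x @ [i]) \<le> t then {x @ [i]} else cut t (x @ [i])"
    have D: "finite (?D i) \<and> (\<Sum>y\<in>?D i. wr y powr \<alpha>) = wr (x @ [i]) powr \<alpha>" if i: "i \<in> {1..N}" for i
    proof (cases "wr (x @ [i]) \<le> t")
      case False
      have "wr (x @ [i]) * m ^ k \<le> wr x * m * m ^ k"
        using mi[OF i] wr_pos[OF Suc.prems(1)] m by (intro mult_right_mono) auto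
      also have "\<dots> \<le> t" using Suc.prems(3) by (simp add: mult_ac)
      finally have "finite (cut t (x @ [i])) \<and> (\<Sum>y\<in>cut t (x @ [i]). wr y powr \<alpha>) = wr (x @ [i]) powr \<alpha>"
        using Suc.prems(1) i False by (intro Suc.IH) auto
      then show ?thesis using False by (simp only: if_False)
    qed auto
    have disj: "?D i \<inter> ?D j = {}" if "i \<noteq> j" for i j
    proof -
      have *: "prefix (x @ [i]) y" if "y \<in> ?D i" for y i
        using that by (auto simp: cut_def split: if_splits)
      have "y ! length x = i" if "y \<in> ?D i" for y i
        using *[OF that] by (auto elim!: prefixE simp: nth_append)
      then show ?thesis using \<open>i \<noteq> j\<close> by blast
    qed
    have "(\<Sum>y\<in>cut t x. wr y powr \<alpha>) = (\<Sum>i\<in>{1..N}. \<Sum>y\<in>?D i. wr y powr \<alpha>)"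
      unfolding cut_step[OF Suc.prems(1,2)]
      by (rule sum.UNION_disjoint) (use D disj in blast)+
    also have "\<dots> = (\<Sum>i\<in>{1..N}. wr (x @ [i]) powr \<alpha>)" using D by (intro sum.cong) blast+
    also have "\<dots> = wr x powr \<alpha> * (\<Sum>i\<in>{1..N}. \<rho> i powr \<alpha>)"
      using wr_pos[OF Suc.prems(1)] \<rho>(1)
      by (auto simp: sum_distrib_left powr_mult less_imp_le intro!: sum.cong)
    finally have "(\<Sum>y\<in>cut t x. wr y powr \<alpha>) = wr x powr \<alpha>" using dim by simp
    moreover have "finite (cut t x)"
      unfolding cut_step[OF Suc.prems(1,2)] using D by blast
    ultimately show ?case by simp
  qed auto
  have "(\<lambda>k. wr x * m ^ k) \<longlonglongrightarrow> wr x * 0"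
    using m by (intro tendsto_intros LIMSEQ_power_zero) auto
  then have "\<forall>\<^sub>F k in sequentially. wr x * m ^ k < t"
    using assms by (intro order_tendstoD(2)) auto
  then obtain k where "wr x * m ^ k < t" by (auto simp: eventually_sequentially)
  then show ?thesis using main[of x k] assms by simp
qed

lemma J_Suc_cut: assumes "x \<in> J n" shows "{y \<in> J (Suc n). prefix x y} = cut (r ^ Suc n) x"
proof -
  have "y \<noteq> []" if "prefix x y" "wr y \<le> r ^ Suc n" for y
    using that J_ratio(1)[OF assms] by auto
  then show ?thesis using J_iff[of "Suc n"] unfolding cut_def by blast
qed

lemma finite_J: "finite (J n)"
proof (cases n)
  case (Suc k)
  have "r ^ n < 1" using r Suc by (simp add: power_less_one_iff del: power_Suc)
  then have "finite (cut (r ^ n) [])" using cut_mass[of "r ^ n" "[]"] r by simp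
  moreover have "J n \<subseteq> cut (r ^ n) []" using J_iff[of n] Suc unfolding cut_def by auto
  ultimately show ?thesis by (rule finite_subset[rotated])
qed simp

lemma children_eq: assumes "x \<in> J n"
  shows "{y \<in> vertices N \<rho>. y \<noteq> [] \<and> parent N \<rho> y = x} = {y \<in> J (Suc n). prefix x y}"
proof (intro equalityI subsetI)
  fix y assume "y \<in> {y \<in> vertices N \<rho>. y \<noteq> [] \<and> parent N \<rho> y = x}"
  then have y: "y \<in> J (Suc (level N \<rho> y - 1))" "parent N \<rho> y = x" using vertex_Suc by blast+
  then show "y \<in> {y \<in> J (Suc n). prefix x y}"
    using parent[OF y(1)] J_unique[OF assms, of "level N \<rho> y - 1"] by auto
next
  fix y assume y: "y \<in> {y \<in> J (Suc n). prefix x y}"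
  then have "y \<noteq> []" using J_iff[of "Suc n" y] by auto
  then show "y \<in> {y \<in> vertices N \<rho>. y \<noteq> [] \<and> parent N \<rho> y = x}"
    using y assms parent_eqI J_vertices by blast
qed

lemma children_mass: assumes "x \<in> J n"
  shows "(\<Sum>y\<in>{y \<in> J (Suc n). prefix x y}. wr y powr \<alpha>) = wr x powr \<alpha>"
  unfolding J_Suc_cut[OF assms] using cut_mass[of "r ^ Suc n" x] J_ratio[OF assms] J_words[OF assms] r by simp

subsection \<open>Cylinder sets\<close>

abbreviation wm :: "nat list \<Rightarrow> 'a \<Rightarrow> 'a" where "wm \<equiv> word_map S"

lemma wm_simps [simp]: "wm [] u = u" "wm (i # x) u = S i (wm x u)"
  by (simp_all add: word_map_def)

lemma wm_append [simp]: "wm (x @ y) u = wm x (wm y u)"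
  by (induction x) auto

lemma dist_wm: "x \<in> words \<Longrightarrow> dist (wm x u) (wm x v) = wr x * dist u v"
  by (induction x) (auto simp: dist_S)

lemma wm_invariant:
  assumes "\<And>i. i \<in> {1..N} \<Longrightarrow> S i ` A \<subseteq> A" "x \<in> words" shows "wm x ` A \<subseteq> A"
  using assms(2)
proof (induction x)
  case (Cons i x)
  have "S i (wm x u) \<in> A" if "u \<in> A" for u
    using assms(1)[of i] Cons that by blast
  then show ?case by auto
qed auto

lemma K: "compact K" "K \<noteq> {}" "i \<in> {1..N} \<Longrightarrow> S i ` K \<subseteq> K"
  using self_similar unfolding self_similar_set_def by blast+

lemma wm_K_antimono: assumes "prefix x y" "y \<in> words" shows "wm y ` K \<subseteq> wm x ` K"
proof -
  obtain z where z: "y = x @ z" using assms by (auto elim: prefixE)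
  then have "wm z ` K \<subseteq> K" using assms K(3) by (intro wm_invariant) auto
  then show ?thesis using z by auto
qed

text \<open>A map that scales distances is linear up to a translation, and an injective linear map of a
  Euclidean space to itself is onto.\<close>

lemma wm_surj: assumes "x \<in> words" shows "surj (wm x)"
proof -
  define f where "f u = wm x u - wm x 0" for u
  have d: "dist (f u) (f v) = wr x * dist u v" for u v
    using dist_wm[OF assms, of u v] by (simp add: f_def dist_norm)
  then have lin: "linear f" by (intro scaling_linear[where c = "wr x"]) (auto simp: f_def)
  have "inj f"
  proof (rule injI)
    fix u v assume "f u = f v"
    then have "wr x * dist u v = 0" using d[of u v] by simp
    then show "u = v" using wr_pos[OF assms] by simp
  qed
  then have sf: "surj f" using lin linear_injective_imp_surjective by blast
  have "\<exists>u. v = wm x u" for v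
  proof -
    obtain u where "v - wm x 0 = f u" using sf by (metis surjD)
    then show ?thesis by (auto simp: f_def)
  qed
  then show ?thesis unfolding surj_def by blast
qed

text \<open>Take a point \<open>u\<close> of the open set with a ball around it. By surjectivity the image of the ball under \<open>wm x\<close>
  is the full ball of radius \<open>\<epsilon> * wr x\<close> around \<open>wm x u\<close>, and the images of the open set under
  distinct words of one level are disjoint.\<close>

lemma separated:
  obtains u \<epsilon> where "0 < \<epsilon>" "\<And>n x y. x \<in> J n \<Longrightarrow> y \<in> J n \<Longrightarrow> x \<noteq> y \<Longrightarrow> \<epsilon> * r ^ n \<le> dist (wm x u) (wm y u)"
proof -
  obtain U where U: "U \<noteq> {}" "open U" "\<And>i. i \<in> {1..N} \<Longrightarrow> S i ` U \<subseteq> U"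
    "\<And>i j. i \<in> {1..N} \<Longrightarrow> j \<in> {1..N} \<Longrightarrow> i \<noteq> j \<Longrightarrow> S i ` U \<inter> S j ` U = {}"
    using osc unfolding open_set_condition_def by metis
  obtain u where u: "u \<in> U" using U(1) by blast
  obtain \<epsilon> where \<epsilon>: "0 < \<epsilon>" "ball u \<epsilon> \<subseteq> U" using U(2) u openE by blast
  have disj: "wm x ` U \<inter> wm y ` U = {}" if xy: "x \<in> J n" "y \<in> J n" "x \<noteq> y" for n x y
  proof -
    have "\<not> prefix x y" "\<not> prefix y x" using xy J_antichain by blast+
    then have "x \<parallel> y" by blast
    then obtain p i x' j y' where p: "i \<noteq> j" "x = p @ i # x'" "y = p @ j # y'"
      using parallel_decomp by blast
    have w: "p \<in> words" "i \<in> {1..N}" "j \<in> {1..N}" "x' \<in> words" "y' \<in> words"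
      using J_words[OF xy(1)] J_words[OF xy(2)] p by auto
    have sub: "wm x' ` U \<subseteq> U" "wm y' ` U \<subseteq> U" using U(3) w wm_invariant by auto
    show ?thesis
    proof (rule ccontr)
      assume "wm x ` U \<inter> wm y ` U \<noteq> {}"
      then obtain a b where ab: "a \<in> U" "b \<in> U" "wm x a = wm y b" by blast
      then have "wr p * dist (S i (wm x' a)) (S j (wm y' b)) = 0"
        using dist_wm[OF w(1), of "S i (wm x' a)" "S j (wm y' b)"] p by simp
      then have "S i (wm x' a) = S j (wm y' b)" using wr_pos[OF w(1)] by simp
      then show False using U(4)[OF w(2,3) p(1)] sub ab by blast
    qed
  qed
  have *: "\<epsilon> * r * r ^ n \<le> dist (wm x u) (wm y u)" if xy: "x \<in> J n" "y \<in> J n" "x \<noteq> y" for n x y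
  proof (rule ccontr)
    assume "\<not> \<epsilon> * r * r ^ n \<le> dist (wm x u) (wm y u)"
    then have "dist (wm x u) (wm y u) < \<epsilon> * r ^ Suc n" by (simp add: mult.assoc)
    also have "\<dots> \<le> \<epsilon> * wr x" using J_ratio(1)[OF xy(1)] \<epsilon> by (intro mult_left_mono) auto
    finally have lt: "dist (wm x u) (wm y u) < \<epsilon> * wr x" .
    obtain v where v: "wm y u = wm x v" using wm_surj[OF J_words[OF xy(1)]] by (metis surjD)
    then have "wr x * dist u v < wr x * \<epsilon>"
      using lt dist_wm[OF J_words[OF xy(1)], of u v] by (simp add: mult.commute)
    then have "dist u v < \<epsilon>" using wr_pos[OF J_words[OF xy(1)]] by simp
    then have "v \<in> U" using \<epsilon> by auto
    then show False using disj[OF xy] v u by blast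
  qed
  show ?thesis
  proof (rule that[of "\<epsilon> * r" u])
    show "0 < \<epsilon> * r" using \<epsilon> r by simp
  qed (rule *)
qed

text \<open>Rescaled by \<open>r ^ n\<close>, the points \<open>wm x u\<close> are uniformly separated and lie in a fixed ball.\<close>

lemma card_near:
  obtains B where "\<And>n A p. A \<subseteq> J n \<Longrightarrow> (\<And>x. x \<in> A \<Longrightarrow> dist (wm x \<xi>) p \<le> R * r ^ n) \<Longrightarrow> card A \<le> B"
proof -
  obtain u \<epsilon> where \<epsilon>: "0 < \<epsilon>"
    and sep: "\<And>n x y. x \<in> J n \<Longrightarrow> y \<in> J n \<Longrightarrow> x \<noteq> y \<Longrightarrow> \<epsilon> * r ^ n \<le> dist (wm x u) (wm y u)"
    using separated by metis
  let ?C = "cball (0::'a) (R + dist u \<xi>)"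
  have "\<exists>T. finite T \<and> T \<subseteq> ?C \<and> ?C \<subseteq> (\<Union>z\<in>T. ball z (\<epsilon> / 2))"
    using compact_imp_seq_compact[OF compact_cball] seq_compact_imp_totally_bounded \<epsilon>
    by (metis half_gt_zero)
  then obtain T where T: "finite T" "?C \<subseteq> (\<Union>z\<in>T. ball z (\<epsilon> / 2))" by blast
  have *: "card A \<le> card T" if A: "A \<subseteq> J n" and near: "\<And>x. x \<in> A \<Longrightarrow> dist (wm x \<xi>) p \<le> R * r ^ n" for n A p
  proof -
    define f where "f x = (wm x u - p) /\<^sub>R r ^ n" for x
    have rn: "0 < r ^ n" using r by simp
    have "\<exists>z\<in>T. dist z (f x) < \<epsilon> / 2" if x: "x \<in> A" for x
    proof -
      have xJ: "x \<in> J n" using x A by blast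
      have "dist (wm x u) p \<le> dist (wm x u) (wm x \<xi>) + dist (wm x \<xi>) p" by (rule dist_triangle)
      also have "\<dots> \<le> r ^ n * dist u \<xi> + R * r ^ n"
        using near[OF x] dist_wm[OF J_words[OF xJ], of u \<xi>] J_ratio(2)[OF xJ]
        by (intro add_mono) (auto intro: mult_right_mono)
      finally have "norm (wm x u - p) \<le> (R + dist u \<xi>) * r ^ n" by (simp add: dist_norm algebra_simps)
      moreover have "norm (f x) = norm (wm x u - p) / r ^ n"
        using r by (simp add: f_def divide_inverse mult.commute)
      ultimately have "norm (f x) \<le> R + dist u \<xi>"
        using rn by (simp add: pos_divide_le_eq)
      then have "f x \<in> (\<Union>z\<in>T. ball z (\<epsilon> / 2))" by (intro subsetD[OF T(2)]) simp
      then show ?thesis unfolding UN_iff mem_ball .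
    qed
    then obtain g where g: "\<And>x. x \<in> A \<Longrightarrow> g x \<in> T \<and> dist (g x) (f x) < \<epsilon> / 2" by metis
    have "inj_on g A"
    proof (rule inj_onI, rule ccontr)
      fix x y assume xy: "x \<in> A" "y \<in> A" "g x = g y" "x \<noteq> y"
      have "dist (f x) (f y) < \<epsilon>"
        using g[OF xy(1)] g[OF xy(2)] xy(3) dist_triangle3[of "f x" "f y" "g x"] by auto
      moreover have "f x - f y = (wm x u - wm y u) /\<^sub>R r ^ n"
        by (simp add: f_def flip: scaleR_diff_right)
      then have "dist (f x) (f y) = dist (wm x u) (wm y u) / r ^ n"
        using r by (simp add: dist_norm divide_inverse mult.commute)
      ultimately have "dist (wm x u) (wm y u) < \<epsilon> * r ^ n" using rn by (simp add: pos_divide_less_eq)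
      moreover have "\<epsilon> * r ^ n \<le> dist (wm x u) (wm y u)" using sep xy A by blast
      ultimately show False by simp
    qed
    then show ?thesis using g T(1) by (intro card_inj_on_le[of g]) auto
  qed
  show ?thesis by (rule that[OF *])
qed

end

section \<open>Natural random walks\<close>

locale natural_walk = osc_ifs N S \<rho> K \<alpha>
  for N :: nat and S :: "nat \<Rightarrow> 'a::euclidean_space \<Rightarrow> 'a" and \<rho> :: "nat \<Rightarrow> real"
    and K :: "'a set" and \<alpha> :: real +
  fixes \<gamma> lam :: real and c :: "nat list \<Rightarrow> nat list \<Rightarrow> real"
  assumes \<gamma>: "0 < \<gamma>" and lam: "0 < lam" "lam < 1"
    and conductance: "natural_conductance N S \<rho> K \<gamma> \<alpha> lam c"
begin

abbreviation X :: "nat list set" where "X \<equiv> vertices N \<rho>"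
abbreviation lv :: "nat list \<Rightarrow> nat" where "lv \<equiv> level N \<rho>"
abbreviation pa :: "nat list \<Rightarrow> nat list" where "pa \<equiv> parent N \<rho>"
abbreviation E :: "(nat list \<times> nat list) set" where "E \<equiv> augmented_tree_edges N S \<rho> K \<gamma>"
abbreviation Eh :: "(nat list \<times> nat list) set" where "Eh \<equiv> horizontal_edges N S \<rho> K \<gamma>"

lemma X_words: "x \<in> X \<Longrightarrow> x \<in> words"
  using vertices_iff[of x] J_words by blast

lemma X_ratio: "x \<in> X \<Longrightarrow> r ^ Suc (lv x) < wr x" "x \<in> X \<Longrightarrow> wr x \<le> r ^ lv x"
  using vertices_iff[of x] J_ratio by blast+

lemma pa_props: assumes "x \<in> X" "x \<noteq> []"
  shows "pa x \<in> X" "lv x = Suc (lv (pa x))" "prefix (pa x) x"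
proof -
  note v = vertex_Suc[OF assms]
  show "pa x \<in> X" using parent(2)[OF v(1)] J_vertices by blast
  have "lv (pa x) = lv x - 1" using parent(2)[OF v(1)] level_eq by blast
  then show "lv x = Suc (lv (pa x))" using v(2) by simp
  show "prefix (pa x) x" by (rule parent(1)[OF v(1)])
qed

lemma pa_pow: "x \<in> X \<Longrightarrow> i \<le> lv x \<Longrightarrow> (pa ^^ i) x \<in> X \<and> lv ((pa ^^ i) x) = lv x - i \<and> prefix ((pa ^^ i) x) x"
proof (induction i)
  case (Suc i)
  then have IH: "(pa ^^ i) x \<in> X" "lv ((pa ^^ i) x) = lv x - i" "prefix ((pa ^^ i) x) x" by auto
  then have ne: "(pa ^^ i) x \<noteq> []" using Suc.prems root_vertex(2) by (metis Suc_le_lessD zero_less_diff less_irrefl)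
  show ?case using pa_props[OF IH(1) ne] IH Suc.prems prefix_order.trans by auto
qed auto

lemma E_iff: "(x, y) \<in> E \<longleftrightarrow> x \<in> X \<and> y \<in> X \<and>
    ((x \<noteq> [] \<and> y = pa x) \<or> (y \<noteq> [] \<and> x = pa y) \<or>
     (x \<noteq> y \<and> lv x = lv y \<and> setdist (wm x ` K) (wm y ` K) \<le> \<gamma> * r ^ lv x))"
  unfolding augmented_tree_edges_def vertical_edges_def horizontal_edges_def r_def by auto

lemma Eh_iff: "(x, y) \<in> Eh \<longleftrightarrow> (x, y) \<in> E \<and> lv x = lv y"
proof
  assume "(x, y) \<in> Eh"
  then show "(x, y) \<in> E \<and> lv x = lv y"
    unfolding E_iff unfolding horizontal_edges_def r_def by auto
next
  assume a: "(x, y) \<in> E \<and> lv x = lv y"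
  then have X: "x \<in> X" "y \<in> X" by (auto simp: E_iff)
  have "\<not> (x \<noteq> [] \<and> y = pa x)" "\<not> (y \<noteq> [] \<and> x = pa y)"
    using a pa_props(2)[OF X(1)] pa_props(2)[OF X(2)] by (metis n_not_Suc_n)+
  then show "(x, y) \<in> Eh"
    using a unfolding E_iff unfolding horizontal_edges_def r_def by auto
qed

lemma c_parent: assumes "x \<in> X" "x \<noteq> []" shows "c x (pa x) = wr x powr \<alpha> / lam ^ lv x"
proof -
  have "c x (pa x) = wr x powr \<alpha> * lam powr (- real (lv x))"
    using conductance vertex_Suc[OF assms] assms vertices_iff[of x]
    unfolding natural_conductance_def by (metis Suc_leI One_nat_def)
  then show ?thesis using lam by (simp add: powr_minus_divide powr_realpow)
qed

lemma c_props: "x \<in> X \<Longrightarrow> y \<in> X \<Longrightarrow> c x y = c y x" "x \<in> X \<Longrightarrow> y \<in> X \<Longrightarrow> 0 \<le> c x y"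
  "x \<in> X \<Longrightarrow> y \<in> X \<Longrightarrow> (x, y) \<notin> E \<Longrightarrow> c x y = 0"
  using conductance unfolding natural_conductance_def by blast+

lemma c_children:
  assumes x: "x \<in> X"
  shows "(\<Sum>y\<in>{y \<in> X. y \<noteq> [] \<and> pa y = x}. c x y) = wr x powr \<alpha> / lam ^ lv x / lam"
proof -
  have xJ: "x \<in> J (lv x)" using x vertices_iff by blast
  let ?A = "{y \<in> J (Suc (lv x)). prefix x y}"
  have "(\<Sum>y\<in>?A. c x y) = (\<Sum>y\<in>?A. wr y powr \<alpha> / lam ^ Suc (lv x))"
  proof (rule sum.cong)
    fix y assume "y \<in> ?A"
    then have "y \<in> {y \<in> X. y \<noteq> [] \<and> pa y = x}" and "lv y = Suc (lv x)"
      unfolding children_eq[OF xJ] using level_eq by auto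
    then show "c x y = wr y powr \<alpha> / lam ^ Suc (lv x)"
      using c_props(1)[OF x, of y] c_parent[of y] by auto
  qed simp
  also have "\<dots> = wr x powr \<alpha> / lam ^ lv x / lam"
    using children_mass[OF xJ] by (simp add: mult.commute flip: sum_divide_distrib)
  finally show ?thesis unfolding children_eq[OF xJ] .
qed

text \<open>The position of \<open>x\<close> is the image under \<open>wm x\<close> of one point of \<open>K\<close>, the same for all \<open>x\<close>. It lies in the cylinder \<open>wm x ` K\<close>, whose
  diameter is of order \<open>r ^ lv x\<close> and which is contained in the cylinders of the ancestors of \<open>x\<close>; so small distances
  of positions give horizontal edges between ancestors. The number of horizontal neighbours is bounded
  by \<open>card_near\<close>.\<close>

lemma is_graded_walk:
  obtains pos :: "nat list \<Rightarrow> 'a" and L w1 w2 eta H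
  where "graded_walk X [] lv pa E pos c r lam \<alpha> \<gamma> L w1 w2 eta H"
proof -
  obtain \<xi> where \<xi>: "\<xi> \<in> K" using K(2) by blast
  obtain \<Delta> where \<Delta>: "0 < \<Delta>" "\<And>u v. u \<in> K \<Longrightarrow> v \<in> K \<Longrightarrow> dist u v \<le> \<Delta>"
  proof -
    obtain e where "\<And>u v. u \<in> K \<Longrightarrow> v \<in> K \<Longrightarrow> dist u v \<le> e"
      using compact_imp_bounded[OF K(1)] unfolding bounded_two_points by blast
    then show ?thesis by (intro that[of "max 1 e"]) (auto simp: le_max_iff_disj)
  qed
  have diam: "dist a b \<le> \<Delta> * r ^ lv x" if "x \<in> X" "a \<in> wm x ` K" "b \<in> wm x ` K" for x a b
  proof -
    obtain u v where uv: "u \<in> K" "v \<in> K" "a = wm x u" "b = wm x v" using \<open>a \<in> _\<close> \<open>b \<in> _\<close> by blast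
    have "dist a b = wr x * dist u v" using dist_wm[OF X_words[OF \<open>x \<in> X\<close>]] uv by simp
    also have "\<dots> \<le> r ^ lv x * \<Delta>"
      using X_ratio(2)[OF \<open>x \<in> X\<close>] \<Delta> uv r by (intro mult_mono) auto
    finally show ?thesis by (simp add: mult.commute)
  qed
  define pos where "pos x = wm x \<xi>" for x
  have pos_in: "pos x \<in> wm x ` K" for x using \<xi> by (simp add: pos_def)
  define L where "L = \<gamma> + 2 * \<Delta> + \<Delta> / r"
  have L: "0 < L" "\<Delta> / r \<le> L" "\<Delta> \<le> L" "\<gamma> + 2 * \<Delta> \<le> L"
    using \<gamma> \<Delta> r by (auto simp: L_def add_pos_pos)
  have par_dist: "dist (pos y) (pos (pa y)) \<le> \<Delta> * r ^ lv (pa y)" if "y \<in> X" "y \<noteq> []" for y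
    using diam[OF pa_props(1)[OF that], of "pos y" "pos (pa y)"] pos_in
      wm_K_antimono[OF pa_props(3)[OF that] X_words[OF that(1)]] by blast
  have E_pos: "dist (pos x) (pos y) \<le> L * r ^ lv x" if "(x, y) \<in> E" for x y
  proof -
    have X: "x \<in> X" "y \<in> X" using that E_iff by auto
    have pw: "0 \<le> r ^ lv x" using r by simp
    from that consider "x \<noteq> []" "y = pa x" | "y \<noteq> []" "x = pa y" |
      "lv x = lv y" "setdist (wm x ` K) (wm y ` K) \<le> \<gamma> * r ^ lv x"
      unfolding E_iff by blast
    then show ?thesis
    proof cases
      case 1
      have "dist (pos x) (pos y) \<le> \<Delta> / r * r ^ lv x"
        using par_dist[OF X(1) 1(1)] pa_props(2)[OF X(1) 1(1)] 1(2) r by simp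
      also have "\<dots> \<le> L * r ^ lv x" using L pw by (intro mult_right_mono)
      finally show ?thesis .
    next
      case 2
      have "dist (pos x) (pos y) \<le> \<Delta> * r ^ lv x"
        using par_dist[OF X(2) 2(1)] 2(2) by (simp add: dist_commute)
      also have "\<dots> \<le> L * r ^ lv x" using L pw by (intro mult_right_mono)
      finally show ?thesis .
    next
      case 3
      have "dist (pos x) (pos y) - 2 * \<Delta> * r ^ lv x \<le> setdist (wm x ` K) (wm y ` K)"
        unfolding le_setdist_iff
      proof (intro conjI ballI impI)
        fix a b assume ab: "a \<in> wm x ` K" "b \<in> wm y ` K"
        have "dist (pos x) (pos y) \<le> dist (pos x) a + dist a b + dist b (pos y)"
          using dist_triangle[of "pos x" "pos y" a] dist_triangle[of a "pos y" b] by linarith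
        then show "dist (pos x) (pos y) - 2 * \<Delta> * r ^ lv x \<le> dist a b"
          using diam[OF X(1) pos_in ab(1)] diam[OF X(2) ab(2) pos_in] 3(1) by simp
      qed (use K(2) in auto)
      then have "dist (pos x) (pos y) \<le> (\<gamma> + 2 * \<Delta>) * r ^ lv x"
        using 3(2) by (simp add: distrib_right)
      also have "\<dots> \<le> L * r ^ lv x" using L pw by (intro mult_right_mono)
      finally show ?thesis .
    qed
  qed
  obtain B where B: "\<And>n A p. A \<subseteq> J n \<Longrightarrow> (\<And>x. x \<in> A \<Longrightarrow> dist (wm x \<xi>) p \<le> L * r ^ n) \<Longrightarrow> card A \<le> B"
    using card_near by blast
  obtain C1 C2 where C: "0 < C1" "0 < C2"
    "\<And>x y. (x, y) \<in> Eh \<Longrightarrow> C1 * c x (pa x) \<le> c x y \<and> c x y \<le> C2 * c x (pa x)"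
  proof -
    have "comparable_on Eh (\<lambda>(x, y). c x y) (\<lambda>(x, y). c x (pa x))"
      using conductance unfolding natural_conductance_def by blast
    then obtain C1 C2 where C: "0 < C1" "0 < C2" and "\<forall>a\<in>Eh. C1 * (\<lambda>(x, y). c x (pa x)) a \<le> (\<lambda>(x, y). c x y) a \<and>
        (\<lambda>(x, y). c x y) a \<le> C2 * (\<lambda>(x, y). c x (pa x)) a"
      unfolding comparable_on_def by blast
    then have "C1 * c x (pa x) \<le> c x y \<and> c x y \<le> C2 * c x (pa x)" if "(x, y) \<in> Eh" for x y
      using that by auto
    with C show thesis by (rule that)
  qed
  have powr_\<alpha>: "(r ^ n) powr \<alpha> = (r powr \<alpha>) ^ n" for n
    using r by (simp add: powr_powr mult.commute flip: powr_realpow)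
  have "graded_walk X [] lv pa E pos c r lam \<alpha> \<gamma> L (r powr \<alpha>) 1 C1 (real B * C2)"
  proof
    show "0 < r powr \<alpha>" "0 < C1" "0 \<le> real B * C2"
      using r C by auto
    show "[] \<in> X" "lv [] = 0" by (fact root_vertex)+
    show "pa x \<in> X" "lv x = Suc (lv (pa x))" if "x \<in> X" "x \<noteq> []" for x
      by (fact pa_props[OF that])+
    show "dist (pos x) (pos y) \<le> L * r ^ lv x" if "(x, y) \<in> E" for x y by (fact E_pos[OF that])
    show "c x y = c y x" "0 \<le> c x y" if "x \<in> X" "y \<in> X" for x y by (fact c_props(1,2)[OF that])+
    show "c x y = 0" if "x \<in> X" "y \<in> X" "(x, y) \<notin> E" for x y by (fact c_props(3)[OF that])
    show "finite {x \<in> X. lv x = n}" for n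
      by (rule finite_subset[OF _ finite_J[of n]]) (auto simp: vertices_iff)
    show "x = []" if "x \<in> X" "lv x = 0" for x using that vertices_iff[of x] by simp
    show "E \<subseteq> X \<times> X" using E_iff by auto
    show "(y, x) \<in> E" if "(x, y) \<in> E" for x y
      using that unfolding E_iff by (auto simp: setdist_sym)
    show "(x, pa x) \<in> E" if "x \<in> X" "x \<noteq> []" for x using that pa_props(1) unfolding E_iff by blast
    show "x \<noteq> [] \<and> y = pa x \<or> y \<noteq> [] \<and> x = pa y \<or> x \<noteq> y \<and> lv x = lv y" if "(x, y) \<in> E" for x y
      using that unfolding E_iff by blast
    show "(pa ^^ i) x = (pa ^^ j) y \<or> ((pa ^^ i) x, (pa ^^ j) y) \<in> E"
      if xy: "x \<in> X" "y \<in> X" "i \<le> lv x" "j \<le> lv y" "lv x - i = lv y - j"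
        and near: "dist (pos x) (pos y) \<le> \<gamma> * r ^ (lv x - i)" for x y i j
    proof -
      note px = pa_pow[OF xy(1,3)] and py = pa_pow[OF xy(2,4)]
      have "setdist (wm ((pa ^^ i) x) ` K) (wm ((pa ^^ j) y) ` K) \<le> dist (pos x) (pos y)"
      proof (rule setdist_le_dist)
        have p: "prefix ((pa ^^ i) x) x" "prefix ((pa ^^ j) y) y" using px py by auto
        show "pos x \<in> wm ((pa ^^ i) x) ` K" by (rule subsetD[OF wm_K_antimono[OF p(1) X_words[OF xy(1)]] pos_in])
        show "pos y \<in> wm ((pa ^^ j) y) ` K" by (rule subsetD[OF wm_K_antimono[OF p(2) X_words[OF xy(2)]] pos_in])
      qed
      then have "setdist (wm ((pa ^^ i) x) ` K) (wm ((pa ^^ j) y) ` K) \<le> \<gamma> * r ^ lv ((pa ^^ i) x)"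
        using near px by simp
      moreover have "lv ((pa ^^ i) x) = lv ((pa ^^ j) y)" using px py xy(5) by simp
      moreover have "(pa ^^ i) x \<in> X" "(pa ^^ j) y \<in> X" using px py by auto
      ultimately show ?thesis unfolding E_iff by meson
    qed
    show "r powr \<alpha> * (r powr \<alpha> / lam) ^ lv x \<le> c x (pa x) \<and> c x (pa x) \<le> 1 * (r powr \<alpha> / lam) ^ lv x"
      if x: "x \<in> X" "x \<noteq> []" for x
    proof -
      have "(r ^ Suc (lv x)) powr \<alpha> \<le> wr x powr \<alpha>" "wr x powr \<alpha> \<le> (r ^ lv x) powr \<alpha>"
        using X_ratio[OF x(1)] r \<alpha> wr_pos[OF X_words[OF x(1)]] by (auto intro!: powr_mono2)
      then show ?thesis
        unfolding c_parent[OF x] powr_\<alpha> using lam by (simp add: power_divide divide_right_mono)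
    qed
    show "(\<Sum>y\<in>{y \<in> X. y \<noteq> [] \<and> pa y = x}. c x y) = c x (pa x) / lam" if "x \<in> X" "x \<noteq> []" for x
      using c_children[OF that(1)] c_parent[OF that] by simp
    show "0 < (\<Sum>y\<in>{y \<in> X. y \<noteq> [] \<and> pa y = []}. c [] y)"
      using c_children[OF root_vertex(1)] root_vertex(2) lam by simp
    show "(\<Sum>y\<in>{y. (x, y) \<in> E \<and> lv y = lv x}. c x y) \<le> real B * C2 * c x (pa x)"
      if x: "x \<in> X" "x \<noteq> []" for x
    proof -
      let ?A = "{y. (x, y) \<in> E \<and> lv y = lv x}"
      have AJ: "?A \<subseteq> J (lv x)"
      proof
        fix y assume "y \<in> ?A"
        then have "y \<in> X" "lv y = lv x" unfolding E_iff by blast+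
        then show "y \<in> J (lv x)" using vertices_iff[of y] by simp
      qed
      have "card ?A \<le> B"
      proof (rule B[OF AJ])
        show "dist (wm y \<xi>) (pos x) \<le> L * r ^ lv x" if "y \<in> ?A" for y
          using E_pos[of x y] that by (simp add: pos_def dist_commute)
      qed
      have cp: "0 \<le> c x (pa x)" using c_props(2) x pa_props(1) by blast
      have "(\<Sum>y\<in>?A. c x y) \<le> (\<Sum>y\<in>?A. C2 * c x (pa x))"
      proof (rule sum_mono)
        fix y assume "y \<in> ?A"
        then have "(x, y) \<in> Eh" unfolding Eh_iff by simp
        then show "c x y \<le> C2 * c x (pa x)" using C(3) by blast
      qed
      also have "\<dots> = real (card ?A) * (C2 * c x (pa x))" by simp
      also have "\<dots> \<le> real B * (C2 * c x (pa x))"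
        using \<open>card ?A \<le> B\<close> C cp by (intro mult_right_mono) auto
      finally show ?thesis by (simp add: mult.assoc)
    qed
    show "C1 * c x (pa x) \<le> c x y" if "(x, y) \<in> E" "lv x = lv y" for x y
      using C(3) Eh_iff that by blast
  qed (fact r lam \<gamma> \<alpha> L)+
  then show ?thesis by (rule that)
qed

end

theorem theorem5p3:
  fixes N :: nat
    and S :: "nat \<Rightarrow> 'a::euclidean_space \<Rightarrow> 'a"
    and \<rho> :: "nat \<Rightarrow> real"
    and K :: "'a set"
    and \<alpha> \<gamma> lam r :: real
    and c :: "nat list \<Rightarrow> nat list \<Rightarrow> real"
    and M :: "nat list \<Rightarrow> 'w measure"
    and Z :: "nat \<Rightarrow> 'w \<Rightarrow> nat list"
    and X :: "nat list set"
    and E :: "(nat list \<times> nat list) set"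
    and P :: "nat list \<Rightarrow> nat list \<Rightarrow> real"
  assumes "similitude_ifs N S \<rho>"
    and "open_set_condition N S"
    and "self_similar_set N S K"
    and "(\<Sum>i=1..N. \<rho> i powr \<alpha>) = 1"
    and "0 < \<gamma>"
    and "0 < lam" "lam < 1"
    and "natural_random_walk N S \<rho> K \<gamma> \<alpha> lam c M Z"
    and r: "r = min_ratio N \<rho>"
    and X: "X = vertices N \<rho>"
    and E: "E = augmented_tree_edges N S \<rho> K \<gamma>"
    and P: "P = transition_prob X c"
  shows
    "comparable_on (X \<times> X)
       (\<lambda>(x, y). hitting_prob M Z x y)
       (\<lambda>(x, y). lam powr (real (level N \<rho> x) - gromov_product (level N \<rho>) E x y) *
                 r powr (\<alpha> * (real (level N \<rho> y) - gromov_product (level N \<rho>) E x y)))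
     \<and> comparable_on (X \<times> X)
       (\<lambda>(x, y). martin_kernel X P [] x y)
       (\<lambda>(x, y). lam powr (real (level N \<rho> x) - gromov_product (level N \<rho>) E x y) *
                 r powr (- \<alpha> * gromov_product (level N \<rho>) E x y))
     \<and> comparable_on (X \<times> hyperbolic_boundary (level N \<rho>) X E [])
       (\<lambda>(x, \<xi>). martin_kernel_boundary X P [] x \<xi>)
       (\<lambda>(x, \<xi>). lam powr (real (level N \<rho> x) - gromov_product_boundary (level N \<rho>) E x \<xi>) *
                 r powr (- \<alpha> * gromov_product_boundary (level N \<rho>) E x \<xi>))"
proof -
  have cond: "natural_conductance N S \<rho> K \<gamma> \<alpha> lam c"
    and mc: "\<And>x. x \<in> X \<Longrightarrow> markov_chain_from X P (M x) Z x"
    using assms(8) unfolding natural_random_walk_def X P by auto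
  interpret I: natural_walk N S \<rho> K \<alpha> \<gamma> lam c
    using assms(1-7) cond by unfold_locales auto
  have rI: "I.r = r" by (simp add: I.r_def r)
  obtain pos :: "nat list \<Rightarrow> 'a" and L w1 w2 eta H
    where "graded_walk X [] (level N \<rho>) (parent N \<rho>) E pos c r lam \<alpha> \<gamma> L w1 w2 eta H"
    using I.is_graded_walk unfolding rI X E by blast
  then interpret W: graded_walk X "[]" "level N \<rho>" "parent N \<rho>" E pos c r lam \<alpha> \<gamma> L w1 w2 eta H .
  have PW: "W.prob = P" by (simp add: W.prob_def P)
  have hit: "hitting_prob M Z x y = W.hit x y" if "x \<in> X" "y \<in> X" for x y
  proof -
    have "markov_chain_from X W.prob (M x) Z x" unfolding PW by (rule mc[OF that(1)])
    then show ?thesis using that by (rule W.hitting_prob_eq_hit)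
  qed
  have target: "lam powr (real (level N \<rho> x) - g) * r powr (\<alpha> * (real (level N \<rho> y) - g)) = W.ra ^ level N \<rho> y * W.\<kappa> x g"
    for x y g
    by (simp add: W.\<kappa>_eq W.ra_power right_diff_distrib mult_ac flip: powr_add)
  have "comparable_on (X \<times> X) (\<lambda>(x, y). hitting_prob M Z x y)
       (\<lambda>(x, y). lam powr (real (level N \<rho> x) - gromov_product (level N \<rho>) E x y) *
                 r powr (\<alpha> * (real (level N \<rho> y) - gromov_product (level N \<rho>) E x y)))"
  proof -
    obtain b C where "0 < b" "0 < C"
      "\<And>x y. x \<in> X \<Longrightarrow> y \<in> X \<Longrightarrow> b * (W.ra ^ level N \<rho> y * W.\<kappa> x (W.gp x y)) \<le> W.hit x y"
      "\<And>x y. x \<in> X \<Longrightarrow> y \<in> X \<Longrightarrow> W.hit x y \<le> C * (W.ra ^ level N \<rho> y * W.\<kappa> x (W.gp x y))"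
      using W.hit_estimate by blast
    then show ?thesis
      unfolding comparable_on_def target W.gp_def by (intro exI[of _ b] exI[of _ C] conjI) (auto simp: hit)
  qed
  moreover have "comparable_on (X \<times> X) (\<lambda>(x, y). martin_kernel X P [] x y)
       (\<lambda>(x, y). lam powr (real (level N \<rho> x) - gromov_product (level N \<rho>) E x y) *
                 r powr (- \<alpha> * gromov_product (level N \<rho>) E x y))"
  proof -
    obtain b C where "0 < b" "0 < C"
      "\<And>x y. x \<in> X \<Longrightarrow> y \<in> X \<Longrightarrow> b * W.\<kappa> x (W.gp x y) \<le> W.mk x y"
      "\<And>x y. x \<in> X \<Longrightarrow> y \<in> X \<Longrightarrow> W.mk x y \<le> C * W.\<kappa> x (W.gp x y)"
      using W.mk_estimate by blast
    then show ?thesis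
      unfolding comparable_on_def W.\<kappa>_eq[symmetric] W.gp_def W.mk_def PW
      by (intro exI[of _ b] exI[of _ C] conjI) auto
  qed
  moreover have "comparable_on (X \<times> hyperbolic_boundary (level N \<rho>) X E [])
       (\<lambda>(x, \<xi>). martin_kernel_boundary X P [] x \<xi>)
       (\<lambda>(x, \<xi>). lam powr (real (level N \<rho> x) - gromov_product_boundary (level N \<rho>) E x \<xi>) *
                 r powr (- \<alpha> * gromov_product_boundary (level N \<rho>) E x \<xi>))"
  proof -
    obtain b C where "0 < b" "0 < C"
      "\<And>x \<xi>. x \<in> X \<Longrightarrow> \<xi> \<in> W.hbd \<Longrightarrow> b * W.\<kappa> x (gromov_product_boundary (level N \<rho>) E x \<xi>) \<le> martin_kernel_boundary X W.prob [] x \<xi>"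
      "\<And>x \<xi>. x \<in> X \<Longrightarrow> \<xi> \<in> W.hbd \<Longrightarrow> martin_kernel_boundary X W.prob [] x \<xi> \<le> C * W.\<kappa> x (gromov_product_boundary (level N \<rho>) E x \<xi>)"
      using W.boundary_kernel_estimate by blast
    then show ?thesis
      unfolding comparable_on_def W.\<kappa>_eq[symmetric] W.hbd_def PW
      by (intro exI[of _ b] exI[of _ C] conjI) auto
  qed
  ultimately show ?thesis by blast
qed

end
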